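(* Let $X$ be a type and $f:X\to X$. The following are logically equivalent. (i) $f$ has a splitting $(A,r,s,H,K)$ in which $s$ is an embedding. (ii) There is $I:\prod_{x:X}(f(f(x))=f(x))$, and for every $x:X$ the type $f(x)=x$ admits a weakly constant endofunction.
   Context: Intensional Martin-Löf type theory; no extensionality axioms are assumed. A splitting of $f$ consists of a type $A$, maps $r:X\to A$ and $s:A\to X$, and homotopies $H:\prod_{a:A}(r(s(a))=a)$ and $K:\prod_{x:X}(s(r(x))=f(x))$. $s:A\to X$ is an embedding if for every $x:X$ the type $\sum_{a:A}(s(a)=x)$ is a mere proposition, i.e. any two of its elements are equal. A function $g:T\to T$ is weakly constant if $\prod_{u,v:T}(g(u)=g(v))$. *)

theory Defs
  imports Main
begin

section \<open>Syntax of intensional Martin-Loef type theory\<close>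

text \<open>
  The object theory is deeply embedded: in HOL itself every equality type has at most one
  element, so the notions of embedding and of weak constancy would be trivial for HOL types.

  Terms use de Bruijn indices.  The numbers of variables bound in the arguments are:
  \<^item> one in the second argument of \<open>Pi\<close>, \<open>Lam\<close>, \<open>Sig\<close>, \<open>Pair\<close>, and in the first argument
    (the motive) of \<open>SigInd\<close>, \<open>SumInd\<close>, \<open>EmptyInd\<close>, \<open>UnitInd\<close>, \<open>NatInd\<close>;
  \<^item> two in the second argument of \<open>SigInd\<close> and in the third argument of \<open>NatInd\<close>;
  \<^item> one in the second and third argument of \<open>SumInd\<close>;
  \<^item> three in the first argument of \<open>J\<close> (two points and a path between them), and one in the
    second.
\<close>

datatype tm =
    Var nat
  | Univ nat
  | Pi tm tm | Lam tm tm | App tm tm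
  | Sig tm tm | Pair tm tm tm tm | SigInd tm tm tm
  | Eq tm tm tm | Refl tm | J tm tm tm tm tm
  | Sum tm tm | Inl tm tm tm | Inr tm tm tm | SumInd tm tm tm tm
  | Empty | EmptyInd tm tm
  | Unit | Star | UnitInd tm tm tm
  | Nat | Zero | Succ tm | NatInd tm tm tm tm

definition up_ren :: "(nat \<Rightarrow> nat) \<Rightarrow> nat \<Rightarrow> nat" where
  "up_ren \<rho> = case_nat 0 (\<lambda>n. Suc (\<rho> n))"

primrec ren :: "(nat \<Rightarrow> nat) \<Rightarrow> tm \<Rightarrow> tm" where
  "ren \<rho> (Var n) = Var (\<rho> n)"
| "ren \<rho> (Univ i) = Univ i"
| "ren \<rho> (Pi A B) = Pi (ren \<rho> A) (ren (up_ren \<rho>) B)"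
| "ren \<rho> (Lam A b) = Lam (ren \<rho> A) (ren (up_ren \<rho>) b)"
| "ren \<rho> (App f a) = App (ren \<rho> f) (ren \<rho> a)"
| "ren \<rho> (Sig A B) = Sig (ren \<rho> A) (ren (up_ren \<rho>) B)"
| "ren \<rho> (Pair A B a b) = Pair (ren \<rho> A) (ren (up_ren \<rho>) B) (ren \<rho> a) (ren \<rho> b)"
| "ren \<rho> (SigInd C g p) =
     SigInd (ren (up_ren \<rho>) C) (ren (up_ren (up_ren \<rho>)) g) (ren \<rho> p)"
| "ren \<rho> (Eq A a b) = Eq (ren \<rho> A) (ren \<rho> a) (ren \<rho> b)"
| "ren \<rho> (Refl a) = Refl (ren \<rho> a)"
| "ren \<rho> (J C c a b p) =
     J (ren (up_ren (up_ren (up_ren \<rho>))) C) (ren (up_ren \<rho>) c) (ren \<rho> a) (ren \<rho> b) (ren \<rho> p)"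
| "ren \<rho> (Sum A B) = Sum (ren \<rho> A) (ren \<rho> B)"
| "ren \<rho> (Inl A B a) = Inl (ren \<rho> A) (ren \<rho> B) (ren \<rho> a)"
| "ren \<rho> (Inr A B b) = Inr (ren \<rho> A) (ren \<rho> B) (ren \<rho> b)"
| "ren \<rho> (SumInd C c d e) =
     SumInd (ren (up_ren \<rho>) C) (ren (up_ren \<rho>) c) (ren (up_ren \<rho>) d) (ren \<rho> e)"
| "ren \<rho> Empty = Empty"
| "ren \<rho> (EmptyInd C a) = EmptyInd (ren (up_ren \<rho>) C) (ren \<rho> a)"
| "ren \<rho> Unit = Unit"
| "ren \<rho> Star = Star"
| "ren \<rho> (UnitInd C c a) = UnitInd (ren (up_ren \<rho>) C) (ren \<rho> c) (ren \<rho> a)"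
| "ren \<rho> Nat = Nat"
| "ren \<rho> Zero = Zero"
| "ren \<rho> (Succ n) = Succ (ren \<rho> n)"
| "ren \<rho> (NatInd C z s n) =
     NatInd (ren (up_ren \<rho>) C) (ren \<rho> z) (ren (up_ren (up_ren \<rho>)) s) (ren \<rho> n)"

definition wk :: "nat \<Rightarrow> tm \<Rightarrow> tm" where
  "wk k = ren (\<lambda>n. n + k)"

definition up :: "(nat \<Rightarrow> tm) \<Rightarrow> nat \<Rightarrow> tm" where
  "up \<sigma> = case_nat (Var 0) (\<lambda>n. wk 1 (\<sigma> n))"

primrec subst :: "(nat \<Rightarrow> tm) \<Rightarrow> tm \<Rightarrow> tm" where
  "subst \<sigma> (Var n) = \<sigma> n"
| "subst \<sigma> (Univ i) = Univ i"
| "subst \<sigma> (Pi A B) = Pi (subst \<sigma> A) (subst (up \<sigma>) B)"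
| "subst \<sigma> (Lam A b) = Lam (subst \<sigma> A) (subst (up \<sigma>) b)"
| "subst \<sigma> (App f a) = App (subst \<sigma> f) (subst \<sigma> a)"
| "subst \<sigma> (Sig A B) = Sig (subst \<sigma> A) (subst (up \<sigma>) B)"
| "subst \<sigma> (Pair A B a b) = Pair (subst \<sigma> A) (subst (up \<sigma>) B) (subst \<sigma> a) (subst \<sigma> b)"
| "subst \<sigma> (SigInd C g p) =
     SigInd (subst (up \<sigma>) C) (subst (up (up \<sigma>)) g) (subst \<sigma> p)"
| "subst \<sigma> (Eq A a b) = Eq (subst \<sigma> A) (subst \<sigma> a) (subst \<sigma> b)"
| "subst \<sigma> (Refl a) = Refl (subst \<sigma> a)"
| "subst \<sigma> (J C c a b p) =
     J (subst (up (up (up \<sigma>))) C) (subst (up \<sigma>) c) (subst \<sigma> a) (subst \<sigma> b) (subst \<sigma> p)"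
| "subst \<sigma> (Sum A B) = Sum (subst \<sigma> A) (subst \<sigma> B)"
| "subst \<sigma> (Inl A B a) = Inl (subst \<sigma> A) (subst \<sigma> B) (subst \<sigma> a)"
| "subst \<sigma> (Inr A B b) = Inr (subst \<sigma> A) (subst \<sigma> B) (subst \<sigma> b)"
| "subst \<sigma> (SumInd C c d e) =
     SumInd (subst (up \<sigma>) C) (subst (up \<sigma>) c) (subst (up \<sigma>) d) (subst \<sigma> e)"
| "subst \<sigma> Empty = Empty"
| "subst \<sigma> (EmptyInd C a) = EmptyInd (subst (up \<sigma>) C) (subst \<sigma> a)"
| "subst \<sigma> Unit = Unit"
| "subst \<sigma> Star = Star"
| "subst \<sigma> (UnitInd C c a) = UnitInd (subst (up \<sigma>) C) (subst \<sigma> c) (subst \<sigma> a)"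
| "subst \<sigma> Nat = Nat"
| "subst \<sigma> Zero = Zero"
| "subst \<sigma> (Succ n) = Succ (subst \<sigma> n)"
| "subst \<sigma> (NatInd C z s n) =
     NatInd (subst (up \<sigma>) C) (subst \<sigma> z) (subst (up (up \<sigma>)) s) (subst \<sigma> n)"

text \<open>
  \<open>inst k as t\<close> replaces the \<open>length as\<close> innermost variables of \<open>t\<close> by \<open>as\<close> (the head of
  \<open>as\<close> replaces variable \<open>0\<close>), where \<open>as\<close> lives in a context with \<open>k\<close> further variables.
\<close>

definition inst :: "nat \<Rightarrow> tm list \<Rightarrow> tm \<Rightarrow> tm" where
  "inst k as = subst (\<lambda>n. if n < length as then as ! n else Var (n - length as + k))"


section \<open>Judgements\<close>

text \<open>
  Contexts are lists with the most recently declared variable first.  Universes are a la Russell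
  and cumulative; a type is an element of some universe.  Neither function extensionality, nor
  univalence, nor uniqueness of identity proofs, nor equality reflection is present.  The
  definitional uniqueness (eta) rules are left out as well; adding them, or further type formers,
  can only enlarge the set of derivable judgements.
\<close>

inductive wf_ctx :: "tm list \<Rightarrow> bool"
  and has_type :: "tm list \<Rightarrow> tm \<Rightarrow> tm \<Rightarrow> bool" (\<open>(_ \<turnstile>/ _ \<Ztypecolon>/ _)\<close> [51, 51, 51] 50)
  and def_eq :: "tm list \<Rightarrow> tm \<Rightarrow> tm \<Rightarrow> tm \<Rightarrow> bool" (\<open>(_ \<turnstile>/ _ \<doteq> _ \<Ztypecolon>/ _)\<close> [51, 51, 51, 51] 50)
where
  ctx_empty: "wf_ctx []"
| ctx_ext: "\<Gamma> \<turnstile> A \<Ztypecolon> Univ i \<Longrightarrow> wf_ctx (A # \<Gamma>)"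

| ty_var: "wf_ctx \<Gamma> \<Longrightarrow> n < length \<Gamma> \<Longrightarrow> \<Gamma> \<turnstile> Var n \<Ztypecolon> wk (Suc n) (\<Gamma> ! n)"
| ty_conv: "\<Gamma> \<turnstile> a \<Ztypecolon> A \<Longrightarrow> \<Gamma> \<turnstile> A \<doteq> B \<Ztypecolon> Univ i \<Longrightarrow> \<Gamma> \<turnstile> a \<Ztypecolon> B"
| ty_univ: "wf_ctx \<Gamma> \<Longrightarrow> \<Gamma> \<turnstile> Univ i \<Ztypecolon> Univ (Suc i)"
| ty_cumul: "\<Gamma> \<turnstile> A \<Ztypecolon> Univ i \<Longrightarrow> \<Gamma> \<turnstile> A \<Ztypecolon> Univ (Suc i)"

| ty_Pi: "\<Gamma> \<turnstile> A \<Ztypecolon> Univ i \<Longrightarrow> A # \<Gamma> \<turnstile> B \<Ztypecolon> Univ i \<Longrightarrow> \<Gamma> \<turnstile> Pi A B \<Ztypecolon> Univ i"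
| ty_Lam: "A # \<Gamma> \<turnstile> b \<Ztypecolon> B \<Longrightarrow> \<Gamma> \<turnstile> Lam A b \<Ztypecolon> Pi A B"
| ty_App: "\<Gamma> \<turnstile> f \<Ztypecolon> Pi A B \<Longrightarrow> \<Gamma> \<turnstile> a \<Ztypecolon> A \<Longrightarrow> \<Gamma> \<turnstile> App f a \<Ztypecolon> inst 0 [a] B"

| ty_Sig: "\<Gamma> \<turnstile> A \<Ztypecolon> Univ i \<Longrightarrow> A # \<Gamma> \<turnstile> B \<Ztypecolon> Univ i \<Longrightarrow> \<Gamma> \<turnstile> Sig A B \<Ztypecolon> Univ i"
| ty_Pair: "A # \<Gamma> \<turnstile> B \<Ztypecolon> Univ i \<Longrightarrow> \<Gamma> \<turnstile> a \<Ztypecolon> A \<Longrightarrow> \<Gamma> \<turnstile> b \<Ztypecolon> inst 0 [a] B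
    \<Longrightarrow> \<Gamma> \<turnstile> Pair A B a b \<Ztypecolon> Sig A B"
| ty_SigInd: "Sig A B # \<Gamma> \<turnstile> C \<Ztypecolon> Univ i
    \<Longrightarrow> B # A # \<Gamma> \<turnstile> g \<Ztypecolon>
          inst 2 [Pair (wk 2 A) (ren (up_ren (\<lambda>n. n + 2)) B) (Var 1) (Var 0)] C
    \<Longrightarrow> \<Gamma> \<turnstile> p \<Ztypecolon> Sig A B
    \<Longrightarrow> \<Gamma> \<turnstile> SigInd C g p \<Ztypecolon> inst 0 [p] C"

| ty_Eq: "\<Gamma> \<turnstile> A \<Ztypecolon> Univ i \<Longrightarrow> \<Gamma> \<turnstile> a \<Ztypecolon> A \<Longrightarrow> \<Gamma> \<turnstile> b \<Ztypecolon> A \<Longrightarrow> \<Gamma> \<turnstile> Eq A a b \<Ztypecolon> Univ i"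
| ty_Refl: "\<Gamma> \<turnstile> A \<Ztypecolon> Univ i \<Longrightarrow> \<Gamma> \<turnstile> a \<Ztypecolon> A \<Longrightarrow> \<Gamma> \<turnstile> Refl a \<Ztypecolon> Eq A a a"
| ty_J: "Eq (wk 2 A) (Var 1) (Var 0) # wk 1 A # A # \<Gamma> \<turnstile> C \<Ztypecolon> Univ i
    \<Longrightarrow> A # \<Gamma> \<turnstile> c \<Ztypecolon> inst 1 [Refl (Var 0), Var 0, Var 0] C
    \<Longrightarrow> \<Gamma> \<turnstile> a \<Ztypecolon> A \<Longrightarrow> \<Gamma> \<turnstile> b \<Ztypecolon> A \<Longrightarrow> \<Gamma> \<turnstile> p \<Ztypecolon> Eq A a b
    \<Longrightarrow> \<Gamma> \<turnstile> J C c a b p \<Ztypecolon> inst 0 [p, b, a] C"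

| ty_Sum: "\<Gamma> \<turnstile> A \<Ztypecolon> Univ i \<Longrightarrow> \<Gamma> \<turnstile> B \<Ztypecolon> Univ i \<Longrightarrow> \<Gamma> \<turnstile> Sum A B \<Ztypecolon> Univ i"
| ty_Inl: "\<Gamma> \<turnstile> A \<Ztypecolon> Univ i \<Longrightarrow> \<Gamma> \<turnstile> B \<Ztypecolon> Univ i \<Longrightarrow> \<Gamma> \<turnstile> a \<Ztypecolon> A \<Longrightarrow> \<Gamma> \<turnstile> Inl A B a \<Ztypecolon> Sum A B"
| ty_Inr: "\<Gamma> \<turnstile> A \<Ztypecolon> Univ i \<Longrightarrow> \<Gamma> \<turnstile> B \<Ztypecolon> Univ i \<Longrightarrow> \<Gamma> \<turnstile> b \<Ztypecolon> B \<Longrightarrow> \<Gamma> \<turnstile> Inr A B b \<Ztypecolon> Sum A B"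
| ty_SumInd: "Sum A B # \<Gamma> \<turnstile> C \<Ztypecolon> Univ i
    \<Longrightarrow> A # \<Gamma> \<turnstile> c \<Ztypecolon> inst 1 [Inl (wk 1 A) (wk 1 B) (Var 0)] C
    \<Longrightarrow> B # \<Gamma> \<turnstile> d \<Ztypecolon> inst 1 [Inr (wk 1 A) (wk 1 B) (Var 0)] C
    \<Longrightarrow> \<Gamma> \<turnstile> e \<Ztypecolon> Sum A B
    \<Longrightarrow> \<Gamma> \<turnstile> SumInd C c d e \<Ztypecolon> inst 0 [e] C"

| ty_Empty: "wf_ctx \<Gamma> \<Longrightarrow> \<Gamma> \<turnstile> Empty \<Ztypecolon> Univ i"
| ty_EmptyInd: "Empty # \<Gamma> \<turnstile> C \<Ztypecolon> Univ i \<Longrightarrow> \<Gamma> \<turnstile> a \<Ztypecolon> Empty \<Longrightarrow> \<Gamma> \<turnstile> EmptyInd C a \<Ztypecolon> inst 0 [a] C"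

| ty_Unit: "wf_ctx \<Gamma> \<Longrightarrow> \<Gamma> \<turnstile> Unit \<Ztypecolon> Univ i"
| ty_Star: "wf_ctx \<Gamma> \<Longrightarrow> \<Gamma> \<turnstile> Star \<Ztypecolon> Unit"
| ty_UnitInd: "Unit # \<Gamma> \<turnstile> C \<Ztypecolon> Univ i \<Longrightarrow> \<Gamma> \<turnstile> c \<Ztypecolon> inst 0 [Star] C \<Longrightarrow> \<Gamma> \<turnstile> a \<Ztypecolon> Unit
    \<Longrightarrow> \<Gamma> \<turnstile> UnitInd C c a \<Ztypecolon> inst 0 [a] C"

| ty_Nat: "wf_ctx \<Gamma> \<Longrightarrow> \<Gamma> \<turnstile> Nat \<Ztypecolon> Univ i"
| ty_Zero: "wf_ctx \<Gamma> \<Longrightarrow> \<Gamma> \<turnstile> Zero \<Ztypecolon> Nat"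
| ty_Succ: "\<Gamma> \<turnstile> n \<Ztypecolon> Nat \<Longrightarrow> \<Gamma> \<turnstile> Succ n \<Ztypecolon> Nat"
| ty_NatInd: "Nat # \<Gamma> \<turnstile> C \<Ztypecolon> Univ i
    \<Longrightarrow> \<Gamma> \<turnstile> z \<Ztypecolon> inst 0 [Zero] C
    \<Longrightarrow> C # Nat # \<Gamma> \<turnstile> s \<Ztypecolon> inst 2 [Succ (Var 1)] C
    \<Longrightarrow> \<Gamma> \<turnstile> n \<Ztypecolon> Nat
    \<Longrightarrow> \<Gamma> \<turnstile> NatInd C z s n \<Ztypecolon> inst 0 [n] C"

| eq_refl: "\<Gamma> \<turnstile> a \<Ztypecolon> A \<Longrightarrow> \<Gamma> \<turnstile> a \<doteq> a \<Ztypecolon> A"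
| eq_sym: "\<Gamma> \<turnstile> a \<doteq> b \<Ztypecolon> A \<Longrightarrow> \<Gamma> \<turnstile> b \<doteq> a \<Ztypecolon> A"
| eq_trans: "\<Gamma> \<turnstile> a \<doteq> b \<Ztypecolon> A \<Longrightarrow> \<Gamma> \<turnstile> b \<doteq> c \<Ztypecolon> A \<Longrightarrow> \<Gamma> \<turnstile> a \<doteq> c \<Ztypecolon> A"
| eq_conv: "\<Gamma> \<turnstile> a \<doteq> b \<Ztypecolon> A \<Longrightarrow> \<Gamma> \<turnstile> A \<doteq> B \<Ztypecolon> Univ i \<Longrightarrow> \<Gamma> \<turnstile> a \<doteq> b \<Ztypecolon> B"
| eq_cumul: "\<Gamma> \<turnstile> A \<doteq> B \<Ztypecolon> Univ i \<Longrightarrow> \<Gamma> \<turnstile> A \<doteq> B \<Ztypecolon> Univ (Suc i)"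

| beta_Pi: "A # \<Gamma> \<turnstile> b \<Ztypecolon> B \<Longrightarrow> \<Gamma> \<turnstile> a \<Ztypecolon> A
    \<Longrightarrow> \<Gamma> \<turnstile> App (Lam A b) a \<doteq> inst 0 [a] b \<Ztypecolon> inst 0 [a] B"
| beta_Sig: "Sig A B # \<Gamma> \<turnstile> C \<Ztypecolon> Univ i
    \<Longrightarrow> B # A # \<Gamma> \<turnstile> g \<Ztypecolon>
          inst 2 [Pair (wk 2 A) (ren (up_ren (\<lambda>n. n + 2)) B) (Var 1) (Var 0)] C
    \<Longrightarrow> \<Gamma> \<turnstile> a \<Ztypecolon> A \<Longrightarrow> \<Gamma> \<turnstile> b \<Ztypecolon> inst 0 [a] B
    \<Longrightarrow> \<Gamma> \<turnstile> SigInd C g (Pair A B a b) \<doteq> inst 0 [b, a] g \<Ztypecolon> inst 0 [Pair A B a b] C"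
| beta_J: "Eq (wk 2 A) (Var 1) (Var 0) # wk 1 A # A # \<Gamma> \<turnstile> C \<Ztypecolon> Univ i
    \<Longrightarrow> A # \<Gamma> \<turnstile> c \<Ztypecolon> inst 1 [Refl (Var 0), Var 0, Var 0] C
    \<Longrightarrow> \<Gamma> \<turnstile> a \<Ztypecolon> A
    \<Longrightarrow> \<Gamma> \<turnstile> J C c a a (Refl a) \<doteq> inst 0 [a] c \<Ztypecolon> inst 0 [Refl a, a, a] C"
| beta_Inl: "Sum A B # \<Gamma> \<turnstile> C \<Ztypecolon> Univ i
    \<Longrightarrow> A # \<Gamma> \<turnstile> c \<Ztypecolon> inst 1 [Inl (wk 1 A) (wk 1 B) (Var 0)] C
    \<Longrightarrow> B # \<Gamma> \<turnstile> d \<Ztypecolon> inst 1 [Inr (wk 1 A) (wk 1 B) (Var 0)] C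
    \<Longrightarrow> \<Gamma> \<turnstile> a \<Ztypecolon> A
    \<Longrightarrow> \<Gamma> \<turnstile> SumInd C c d (Inl A B a) \<doteq> inst 0 [a] c \<Ztypecolon> inst 0 [Inl A B a] C"
| beta_Inr: "Sum A B # \<Gamma> \<turnstile> C \<Ztypecolon> Univ i
    \<Longrightarrow> A # \<Gamma> \<turnstile> c \<Ztypecolon> inst 1 [Inl (wk 1 A) (wk 1 B) (Var 0)] C
    \<Longrightarrow> B # \<Gamma> \<turnstile> d \<Ztypecolon> inst 1 [Inr (wk 1 A) (wk 1 B) (Var 0)] C
    \<Longrightarrow> \<Gamma> \<turnstile> b \<Ztypecolon> B
    \<Longrightarrow> \<Gamma> \<turnstile> SumInd C c d (Inr A B b) \<doteq> inst 0 [b] d \<Ztypecolon> inst 0 [Inr A B b] C"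
| beta_Unit: "Unit # \<Gamma> \<turnstile> C \<Ztypecolon> Univ i \<Longrightarrow> \<Gamma> \<turnstile> c \<Ztypecolon> inst 0 [Star] C
    \<Longrightarrow> \<Gamma> \<turnstile> UnitInd C c Star \<doteq> c \<Ztypecolon> inst 0 [Star] C"
| beta_Zero: "Nat # \<Gamma> \<turnstile> C \<Ztypecolon> Univ i
    \<Longrightarrow> \<Gamma> \<turnstile> z \<Ztypecolon> inst 0 [Zero] C
    \<Longrightarrow> C # Nat # \<Gamma> \<turnstile> s \<Ztypecolon> inst 2 [Succ (Var 1)] C
    \<Longrightarrow> \<Gamma> \<turnstile> NatInd C z s Zero \<doteq> z \<Ztypecolon> inst 0 [Zero] C"
| beta_Succ: "Nat # \<Gamma> \<turnstile> C \<Ztypecolon> Univ i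
    \<Longrightarrow> \<Gamma> \<turnstile> z \<Ztypecolon> inst 0 [Zero] C
    \<Longrightarrow> C # Nat # \<Gamma> \<turnstile> s \<Ztypecolon> inst 2 [Succ (Var 1)] C
    \<Longrightarrow> \<Gamma> \<turnstile> n \<Ztypecolon> Nat
    \<Longrightarrow> \<Gamma> \<turnstile> NatInd C z s (Succ n) \<doteq> inst 0 [NatInd C z s n, n] s \<Ztypecolon> inst 0 [Succ n] C"

| cong_Pi: "\<Gamma> \<turnstile> A \<doteq> A' \<Ztypecolon> Univ i \<Longrightarrow> A # \<Gamma> \<turnstile> B \<doteq> B' \<Ztypecolon> Univ i
    \<Longrightarrow> \<Gamma> \<turnstile> Pi A B \<doteq> Pi A' B' \<Ztypecolon> Univ i"
| cong_Lam: "\<Gamma> \<turnstile> A \<doteq> A' \<Ztypecolon> Univ i \<Longrightarrow> A # \<Gamma> \<turnstile> b \<doteq> b' \<Ztypecolon> B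
    \<Longrightarrow> \<Gamma> \<turnstile> Lam A b \<doteq> Lam A' b' \<Ztypecolon> Pi A B"
| cong_App: "\<Gamma> \<turnstile> f \<doteq> f' \<Ztypecolon> Pi A B \<Longrightarrow> \<Gamma> \<turnstile> a \<doteq> a' \<Ztypecolon> A
    \<Longrightarrow> \<Gamma> \<turnstile> App f a \<doteq> App f' a' \<Ztypecolon> inst 0 [a] B"
| cong_Sig: "\<Gamma> \<turnstile> A \<doteq> A' \<Ztypecolon> Univ i \<Longrightarrow> A # \<Gamma> \<turnstile> B \<doteq> B' \<Ztypecolon> Univ i
    \<Longrightarrow> \<Gamma> \<turnstile> Sig A B \<doteq> Sig A' B' \<Ztypecolon> Univ i"
| cong_Pair: "\<Gamma> \<turnstile> A \<doteq> A' \<Ztypecolon> Univ i \<Longrightarrow> A # \<Gamma> \<turnstile> B \<doteq> B' \<Ztypecolon> Univ i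
    \<Longrightarrow> \<Gamma> \<turnstile> a \<doteq> a' \<Ztypecolon> A \<Longrightarrow> \<Gamma> \<turnstile> b \<doteq> b' \<Ztypecolon> inst 0 [a] B
    \<Longrightarrow> \<Gamma> \<turnstile> Pair A B a b \<doteq> Pair A' B' a' b' \<Ztypecolon> Sig A B"
| cong_SigInd: "Sig A B # \<Gamma> \<turnstile> C \<doteq> C' \<Ztypecolon> Univ i
    \<Longrightarrow> B # A # \<Gamma> \<turnstile> g \<doteq> g' \<Ztypecolon>
          inst 2 [Pair (wk 2 A) (ren (up_ren (\<lambda>n. n + 2)) B) (Var 1) (Var 0)] C
    \<Longrightarrow> \<Gamma> \<turnstile> p \<doteq> p' \<Ztypecolon> Sig A B
    \<Longrightarrow> \<Gamma> \<turnstile> SigInd C g p \<doteq> SigInd C' g' p' \<Ztypecolon> inst 0 [p] C"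
| cong_Eq: "\<Gamma> \<turnstile> A \<doteq> A' \<Ztypecolon> Univ i \<Longrightarrow> \<Gamma> \<turnstile> a \<doteq> a' \<Ztypecolon> A \<Longrightarrow> \<Gamma> \<turnstile> b \<doteq> b' \<Ztypecolon> A
    \<Longrightarrow> \<Gamma> \<turnstile> Eq A a b \<doteq> Eq A' a' b' \<Ztypecolon> Univ i"
| cong_Refl: "\<Gamma> \<turnstile> A \<Ztypecolon> Univ i \<Longrightarrow> \<Gamma> \<turnstile> a \<doteq> a' \<Ztypecolon> A \<Longrightarrow> \<Gamma> \<turnstile> Refl a \<doteq> Refl a' \<Ztypecolon> Eq A a a"
| cong_J: "Eq (wk 2 A) (Var 1) (Var 0) # wk 1 A # A # \<Gamma> \<turnstile> C \<doteq> C' \<Ztypecolon> Univ i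
    \<Longrightarrow> A # \<Gamma> \<turnstile> c \<doteq> c' \<Ztypecolon> inst 1 [Refl (Var 0), Var 0, Var 0] C
    \<Longrightarrow> \<Gamma> \<turnstile> a \<doteq> a' \<Ztypecolon> A \<Longrightarrow> \<Gamma> \<turnstile> b \<doteq> b' \<Ztypecolon> A \<Longrightarrow> \<Gamma> \<turnstile> p \<doteq> p' \<Ztypecolon> Eq A a b
    \<Longrightarrow> \<Gamma> \<turnstile> J C c a b p \<doteq> J C' c' a' b' p' \<Ztypecolon> inst 0 [p, b, a] C"
| cong_Sum: "\<Gamma> \<turnstile> A \<doteq> A' \<Ztypecolon> Univ i \<Longrightarrow> \<Gamma> \<turnstile> B \<doteq> B' \<Ztypecolon> Univ i
    \<Longrightarrow> \<Gamma> \<turnstile> Sum A B \<doteq> Sum A' B' \<Ztypecolon> Univ i"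
| cong_Inl: "\<Gamma> \<turnstile> A \<doteq> A' \<Ztypecolon> Univ i \<Longrightarrow> \<Gamma> \<turnstile> B \<doteq> B' \<Ztypecolon> Univ i \<Longrightarrow> \<Gamma> \<turnstile> a \<doteq> a' \<Ztypecolon> A
    \<Longrightarrow> \<Gamma> \<turnstile> Inl A B a \<doteq> Inl A' B' a' \<Ztypecolon> Sum A B"
| cong_Inr: "\<Gamma> \<turnstile> A \<doteq> A' \<Ztypecolon> Univ i \<Longrightarrow> \<Gamma> \<turnstile> B \<doteq> B' \<Ztypecolon> Univ i \<Longrightarrow> \<Gamma> \<turnstile> b \<doteq> b' \<Ztypecolon> B
    \<Longrightarrow> \<Gamma> \<turnstile> Inr A B b \<doteq> Inr A' B' b' \<Ztypecolon> Sum A B"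
| cong_SumInd: "Sum A B # \<Gamma> \<turnstile> C \<doteq> C' \<Ztypecolon> Univ i
    \<Longrightarrow> A # \<Gamma> \<turnstile> c \<doteq> c' \<Ztypecolon> inst 1 [Inl (wk 1 A) (wk 1 B) (Var 0)] C
    \<Longrightarrow> B # \<Gamma> \<turnstile> d \<doteq> d' \<Ztypecolon> inst 1 [Inr (wk 1 A) (wk 1 B) (Var 0)] C
    \<Longrightarrow> \<Gamma> \<turnstile> e \<doteq> e' \<Ztypecolon> Sum A B
    \<Longrightarrow> \<Gamma> \<turnstile> SumInd C c d e \<doteq> SumInd C' c' d' e' \<Ztypecolon> inst 0 [e] C"
| cong_EmptyInd: "Empty # \<Gamma> \<turnstile> C \<doteq> C' \<Ztypecolon> Univ i \<Longrightarrow> \<Gamma> \<turnstile> a \<doteq> a' \<Ztypecolon> Empty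
    \<Longrightarrow> \<Gamma> \<turnstile> EmptyInd C a \<doteq> EmptyInd C' a' \<Ztypecolon> inst 0 [a] C"
| cong_UnitInd: "Unit # \<Gamma> \<turnstile> C \<doteq> C' \<Ztypecolon> Univ i \<Longrightarrow> \<Gamma> \<turnstile> c \<doteq> c' \<Ztypecolon> inst 0 [Star] C
    \<Longrightarrow> \<Gamma> \<turnstile> a \<doteq> a' \<Ztypecolon> Unit
    \<Longrightarrow> \<Gamma> \<turnstile> UnitInd C c a \<doteq> UnitInd C' c' a' \<Ztypecolon> inst 0 [a] C"
| cong_Succ: "\<Gamma> \<turnstile> n \<doteq> n' \<Ztypecolon> Nat \<Longrightarrow> \<Gamma> \<turnstile> Succ n \<doteq> Succ n' \<Ztypecolon> Nat"
| cong_NatInd: "Nat # \<Gamma> \<turnstile> C \<doteq> C' \<Ztypecolon> Univ i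
    \<Longrightarrow> \<Gamma> \<turnstile> z \<doteq> z' \<Ztypecolon> inst 0 [Zero] C
    \<Longrightarrow> C # Nat # \<Gamma> \<turnstile> s \<doteq> s' \<Ztypecolon> inst 2 [Succ (Var 1)] C
    \<Longrightarrow> \<Gamma> \<turnstile> n \<doteq> n' \<Ztypecolon> Nat
    \<Longrightarrow> \<Gamma> \<turnstile> NatInd C z s n \<doteq> NatInd C' z' s' n' \<Ztypecolon> inst 0 [n] C"


section \<open>Types of the object theory\<close>

text \<open>Each definition takes its parameters in one common context, hence the weakenings.\<close>

definition Arrow :: "tm \<Rightarrow> tm \<Rightarrow> tm" where
  "Arrow A B = Pi A (wk 1 B)"

definition Prod :: "tm \<Rightarrow> tm \<Rightarrow> tm" where
  "Prod A B = Sig A (wk 1 B)"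

definition Iff :: "tm \<Rightarrow> tm \<Rightarrow> tm" where
  "Iff A B = Prod (Arrow A B) (Arrow B A)"

definition IsProp :: "tm \<Rightarrow> tm" where
  "IsProp T = Pi T (Pi (wk 1 T) (Eq (wk 2 T) (Var 1) (Var 0)))"

definition Fiber :: "tm \<Rightarrow> tm \<Rightarrow> tm \<Rightarrow> tm \<Rightarrow> tm" where
  "Fiber A X s x = Sig A (Eq (wk 1 X) (App (wk 1 s) (Var 0)) (wk 1 x))"

definition IsEmbedding :: "tm \<Rightarrow> tm \<Rightarrow> tm \<Rightarrow> tm" where
  "IsEmbedding A X s = Pi X (IsProp (Fiber (wk 1 A) (wk 1 X) (wk 1 s) (Var 0)))"

definition WeaklyConstant :: "tm \<Rightarrow> tm \<Rightarrow> tm" where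
  "WeaklyConstant T g =
     Pi T (Pi (wk 1 T) (Eq (wk 2 T) (App (wk 2 g) (Var 1)) (App (wk 2 g) (Var 0))))"

definition RetractHtpy :: "tm \<Rightarrow> tm \<Rightarrow> tm \<Rightarrow> tm" where
  "RetractHtpy A r s = Pi A (Eq (wk 1 A) (App (wk 1 r) (App (wk 1 s) (Var 0))) (Var 0))"

definition SplitHtpy :: "tm \<Rightarrow> tm \<Rightarrow> tm \<Rightarrow> tm \<Rightarrow> tm" where
  "SplitHtpy X f r s =
     Pi X (Eq (wk 1 X) (App (wk 1 s) (App (wk 1 r) (Var 0))) (App (wk 1 f) (Var 0)))"

text \<open>
  The iterated sum over \<open>A : Univ i\<close>, \<open>r : X \<rightarrow> A\<close>, \<open>s : A \<rightarrow> X\<close>, which inside are the variables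
  \<open>2\<close>, \<open>1\<close> and \<open>0\<close>, and over the two homotopies and the embedding property.
\<close>

definition EmbSplitting :: "nat \<Rightarrow> tm \<Rightarrow> tm \<Rightarrow> tm" where
  "EmbSplitting i X f =
     Sig (Univ i)
      (Sig (Arrow (wk 1 X) (Var 0))
        (Sig (Arrow (Var 1) (wk 2 X))
          (Prod (RetractHtpy (Var 2) (Var 1) (Var 0))
            (Prod (SplitHtpy (wk 3 X) (wk 3 f) (Var 1) (Var 0))
              (IsEmbedding (Var 2) (wk 3 X) (Var 0))))))"

definition Idempotency :: "tm \<Rightarrow> tm \<Rightarrow> tm" where
  "Idempotency X f =
     Pi X (Eq (wk 1 X) (App (wk 1 f) (App (wk 1 f) (Var 0))) (App (wk 1 f) (Var 0)))"

definition WeaklyConstantEndo :: "tm \<Rightarrow> tm" where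
  "WeaklyConstantEndo T = Sig (Arrow T T) (WeaklyConstant (wk 1 T) (Var 0))"

definition IdempotentWithConstantEndos :: "tm \<Rightarrow> tm \<Rightarrow> tm" where
  "IdempotentWithConstantEndos X f =
     Prod (Idempotency X f)
      (Pi X (WeaklyConstantEndo (Eq (wk 1 X) (App (wk 1 f) (Var 0)) (Var 0))))"

end

theory Submission
  imports Defs
begin

text \<open>
  From (i) to (ii): the type \<open>f x = x\<close> maps to the fiber of \<open>s\<close> over \<open>x\<close> and back, since \<open>s a = x\<close>
  implies \<open>f x = x\<close>; an endofunction factoring through a proposition is weakly constant.

  From (ii) to (i): let \<open>g x\<close> be the weakly constant endofunction of \<open>f x = x\<close> and let \<open>A\<close> consist
      of
  the points \<open>x\<close> together with a fixed point of \<open>g x\<close>.  The fixed points of a weakly constant map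
  form a proposition (Kraus, Escardo, Coquand and Altenkirch), so the projection \<open>s\<close> from \<open>A\<close> to \<open>X\<close>
  is an embedding.  The map \<open>r\<close> sends \<open>x\<close> to \<open>f x\<close>, with the fixed point obtained by applying
  \<open>g (f x)\<close> to the idempotency path.  Then \<open>s (r x)\<close> is \<open>f x\<close> by computation, and \<open>r (s a) = a\<close>
  follows because \<open>s\<close> identifies the two sides.
\<close>

text \<open>Taking for \<open>A\<close> the points with a path f x = x would not do: that type may
  have many elements, so the projection need not be an embedding. The fixed points of
  \<open>g x\<close> replace it by a logically equivalent proposition, with no truncation in the
  theory. The idempotency path comes with no coherence, so a path r (s a) = a cannot be assembled
  from it componentwise; only the points of \<open>X\<close> are compared. Two features of the
  object theory shape the rest. It has only the unbased \<open>J\<close> and no eta, so based path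
  induction has to be derived, and a statement about an arbitrary element of a \<open>Sig\<close> is
  reduced to pairs by \<open>SigInd\<close>. To avoid explicit path algebra, propositions are
  recognised as retracts, where being a retract is itself an object-level type that can be
  transported. Intermediate results assert only that some term inhabits a type in a given context. A
  result about a generic element is the same result in an extended context with weakened parameters,
  so weakening and substitution are needed for the whole calculus.\<close>

section \<open>Substitution calculus\<close>

lemma up_ren_simps [simp]: "up_ren \<rho> 0 = 0" "up_ren \<rho> (Suc n) = Suc (\<rho> n)"
  by (simp_all add: up_ren_def)

lemma up_simps [simp]: "up \<sigma> 0 = Var 0" "up \<sigma> (Suc n) = ren Suc (\<sigma> n)"
  by (simp_all add: up_def wk_def)

lemma up_ren_comp: "(\<lambda>n. up_ren \<rho> (up_ren \<tau> n)) = up_ren (\<lambda>n. \<rho> (\<tau> n))"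
  by (rule ext, rename_tac n, case_tac n) auto

lemma ren_ren [simp]: "ren \<rho> (ren \<tau> t) = ren (\<lambda>n. \<rho> (\<tau> n)) t"
  by (induction t arbitrary: \<rho> \<tau>) (simp_all add: up_ren_comp)

lemma up_Var: "up (\<lambda>n. Var (\<rho> n)) = (\<lambda>n. Var (up_ren \<rho> n))"
  by (rule ext, rename_tac n, case_tac n) auto

lemma subst_Var_ren [simp]: "subst (\<lambda>n. Var (\<rho> n)) t = ren \<rho> t"
  by (induction t arbitrary: \<rho>) (simp_all add: up_Var)

lemma up_ren_id: "up_ren (\<lambda>n. n) = (\<lambda>n. n)"
  by (rule ext, rename_tac n, case_tac n) auto

lemma ren_id [simp]: "ren (\<lambda>n. n) t = t"
  by (induction t) (simp_all add: up_ren_id)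

lemma up_up_ren: "(\<lambda>n. up \<sigma> (up_ren \<rho> n)) = up (\<lambda>n. \<sigma> (\<rho> n))"
  by (rule ext, rename_tac n, case_tac n) auto

lemma subst_ren [simp]: "subst \<sigma> (ren \<rho> t) = subst (\<lambda>n. \<sigma> (\<rho> n)) t"
  by (induction t arbitrary: \<sigma> \<rho>) (simp_all add: up_up_ren)

lemma ren_up: "(\<lambda>n. ren (up_ren \<rho>) (up \<sigma> n)) = up (\<lambda>n. ren \<rho> (\<sigma> n))"
  by (rule ext, rename_tac n, case_tac n) auto

lemma ren_subst [simp]: "ren \<rho> (subst \<sigma> t) = subst (\<lambda>n. ren \<rho> (\<sigma> n)) t"
  by (induction t arbitrary: \<sigma> \<rho>) (simp_all add: ren_up)

lemma subst_up: "(\<lambda>n. subst (up \<tau>) (up \<sigma> n)) = up (\<lambda>n. subst \<tau> (\<sigma> n))"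
  by (rule ext, rename_tac n, case_tac n) auto

lemma subst_subst [simp]: "subst \<tau> (subst \<sigma> t) = subst (\<lambda>n. subst \<tau> (\<sigma> n)) t"
  by (induction t arbitrary: \<sigma> \<tau>) (simp_all add: subst_up)

lemma subst_id [simp]: "subst Var t = t"
  using subst_Var_ren[of "\<lambda>n. n" t] by simp

lemma subst_wk_up [simp]:
  "subst (up \<sigma>) (wk (Suc 0) t) = wk (Suc 0) (subst \<sigma> t)"
  "subst (up (up \<sigma>)) (wk 2 t) = wk 2 (subst \<sigma> t)"
  by (simp_all add: wk_def numeral_eq_Suc)

text \<open>This is the shape in which the family \<open>B\<close> occurs in the generic pair of
  \<open>ty_SigInd\<close>: moved past two new variables while its own variable stays in place. Both
  sides agree on that variable and on each older one.\<close>

lemma subst_Pair_up: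
  "subst (up (up (up \<sigma>))) (ren (up_ren (\<lambda>n. Suc (Suc n))) B) =
   ren (up_ren (\<lambda>n. Suc (Suc n))) (subst (up \<sigma>) B)"
  by (simp, rule arg_cong[where f = "\<lambda>s. subst s B"], rule ext, rename_tac n, case_tac n) auto

lemma subst_inst:
  "subst ((up ^^ k) \<sigma>) (inst k as t) = inst k (map (subst ((up ^^ k) \<sigma>)) as) (subst ((up ^^ length
      as) \<sigma>) t)"
proof -
  \<comment> \<open>Lifting a substitution past \<open>m\<close> binders shifts its values by
    \<open>m\<close> and fixes the \<open>m\<close> bound variables.\<close>
  have up: "(up ^^ m) \<sigma> (n + m) = ren (\<lambda>n. n + m) (\<sigma> n)" for m n
    by (induction m) auto
  have up': "(up ^^ m) \<sigma> n = Var n" if "n < m" for m n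
    using that by (induction m arbitrary: n) (auto simp: less_Suc_eq_0_disj)
  show ?thesis
    unfolding inst_def subst_subst
  proof (rule arg_cong[where f="\<lambda>s. subst s t"], rule ext)
    fix n
    show "subst ((up ^^ k) \<sigma>) (if n < length as then as ! n else Var (n - length as + k)) =
      subst (\<lambda>n. if n < length (map (subst ((up ^^ k) \<sigma>)) as)
                 then map (subst ((up ^^ k) \<sigma>)) as ! n
                 else Var (n - length (map (subst ((up ^^ k) \<sigma>)) as) + k))
          ((up ^^ length as) \<sigma> n)"
    proof (cases "n < length as")
      case True then show ?thesis by (simp add: up')
    next
      case False
      then obtain m where "n = m + length as" by (metis add.commute le_Suc_ex not_less)
      then show ?thesis by (simp add: up)
    qed
  qed
qed

text \<open>These are the arities that occur in the typing rules: offset 0 for result types, offset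
  1 for the branches of \<open>J\<close> and \<open>SumInd\<close>, offset 2 for those of
  \<open>SigInd\<close> and \<open>NatInd\<close>.\<close>

lemma subst_inst_simps:
  "subst \<sigma> (inst 0 [a] t) = inst 0 [subst \<sigma> a] (subst (up \<sigma>) t)"
  "subst \<sigma> (inst 0 [a, b] t) = inst 0 [subst \<sigma> a, subst \<sigma> b] (subst (up (up \<sigma>)) t)"
  "subst \<sigma> (inst 0 [a, b, c] t) = inst 0 [subst \<sigma> a, subst \<sigma> b, subst \<sigma> c] (subst (up (up (up \<sigma>)))
      t)"
  "subst (up \<sigma>) (inst (Suc 0) [a] t) = inst (Suc 0) [subst (up \<sigma>) a] (subst (up \<sigma>) t)"
  "subst (up \<sigma>) (inst (Suc 0) [a, b, c] t) = inst (Suc 0) [subst (up \<sigma>) a, subst (up \<sigma>) b, subst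
      (up \<sigma>) c] (subst (up (up (up \<sigma>))) t)"
  "subst (up (up \<sigma>)) (inst 2 [a] t) = inst 2 [subst (up (up \<sigma>)) a] (subst (up \<sigma>) t)"
  using subst_inst[of 0 \<sigma> "[a]" t] subst_inst[of 0 \<sigma> "[a,b]" t] subst_inst[of 0 \<sigma> "[a,b,c]" t]
    subst_inst[of 1 \<sigma> "[a]" t] subst_inst[of 1 \<sigma> "[a,b,c]" t] subst_inst[of 2 \<sigma> "[a]" t]
  by (simp_all add: numeral_eq_Suc)

section \<open>Stability of typing under substitution\<close>

text \<open>
  The introduction rules for terms do not all carry the well-formedness of the types in their
  contexts as premises.  The induction below recovers it by proving along the way that each type
  of the context is itself stable under the class \<open>S\<close> of substitutions.  Taking \<open>S\<close> to be the
  identities, the renamings and all well-typed substitutions gives well-formedness of contexts,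
  weakening and substitution; the last needs weakening for \<open>S\<close> to be closed under \<^const>\<open>up\<close>.
\<close>

primrec ctx_stable :: "(tm list \<Rightarrow> (nat \<Rightarrow> tm) \<Rightarrow> tm list \<Rightarrow> bool) \<Rightarrow> tm list \<Rightarrow> bool" where
  "ctx_stable S [] = True"
| "ctx_stable S (A # \<Gamma>) = (ctx_stable S \<Gamma> \<and>
     (\<exists>i. \<forall>\<Delta> \<sigma>. S \<Delta> \<sigma> \<Gamma> \<longrightarrow> \<Delta> \<turnstile> subst \<sigma> A \<Ztypecolon> Univ i))"

lemma subst_stable:
  assumes S: "\<And>\<Delta> \<sigma> \<Gamma>. S \<Delta> \<sigma> \<Gamma> \<Longrightarrow> wf_ctx \<Delta>"
    and V: "\<And>\<Delta> \<sigma> \<Gamma> n. S \<Delta> \<sigma> \<Gamma> \<Longrightarrow> n < length \<Gamma> \<Longrightarrow> \<Delta> \<turnstile> \<sigma> n \<Ztypecolon> subst \<sigma> (wk (Suc n) (\<Gamma> ! n))"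
    and U: "\<And>\<Delta> \<sigma> \<Gamma> A i. S \<Delta> \<sigma> \<Gamma> \<Longrightarrow> \<Delta> \<turnstile> subst \<sigma> A \<Ztypecolon> Univ i \<Longrightarrow> S (subst \<sigma> A # \<Delta>) (up \<sigma>) (A # \<Gamma>)"
  shows "wf_ctx \<Gamma> \<Longrightarrow> ctx_stable S \<Gamma>"
    and "\<Gamma> \<turnstile> a \<Ztypecolon> A \<Longrightarrow> ctx_stable S \<Gamma> \<and> (\<forall>\<Delta> \<sigma>. S \<Delta> \<sigma> \<Gamma> \<longrightarrow> \<Delta> \<turnstile> subst \<sigma> a \<Ztypecolon> subst \<sigma> A)"
    and "\<Gamma> \<turnstile> a \<doteq> b \<Ztypecolon> A \<Longrightarrow> ctx_stable S \<Gamma> \<and> (\<forall>\<Delta> \<sigma>. S \<Delta> \<sigma> \<Gamma> \<longrightarrow> \<Delta> \<turnstile> subst \<sigma> a \<doteq> subst \<sigma> b \<Ztypecolon> subst \<sigma> A)"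
proof -
  \<comment> \<open>Stability of the extended context provides the typing of the substituted type
    that closure of \<open>S\<close> under \<open>up\<close> asks for. \<open>E2\<close> and
    \<open>E3\<close> iterate this for rules that bind two and three variables.\<close>
  have E: "S (subst \<sigma> A # \<Delta>) (up \<sigma>) (A # \<Gamma>)" if "ctx_stable S (A # \<Gamma>)" "S \<Delta> \<sigma> \<Gamma>" for A \<Delta> \<sigma> \<Gamma>
    using that U by (metis ctx_stable.simps(2))
  \<comment> \<open>The fusion laws are switched off so that substitutions are pushed inwards and
    the judgements keep the shape of the typing rules.\<close>
  note [simp] = subst_inst_simps subst_Pair_up and [simp del] = subst_ren ren_subst subst_subst
  have E2: "S (subst (up \<sigma>) B # subst \<sigma> A # \<Delta>) (up (up \<sigma>)) (B # A # \<Gamma>)"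
    if "ctx_stable S (B # A # \<Gamma>)" "S \<Delta> \<sigma> \<Gamma>" for A B \<Delta> \<sigma> \<Gamma>
    using that E ctx_stable.simps(2) by metis
  have E3: "S (subst (up (up \<sigma>)) C # subst (up \<sigma>) B # subst \<sigma> A # \<Delta>) (up (up (up \<sigma>))) (C # B # A #
      \<Gamma>)"
    if "ctx_stable S (C # B # A # \<Gamma>)" "S \<Delta> \<sigma> \<Gamma>" for A B C \<Delta> \<sigma> \<Gamma>
    using that E2 E ctx_stable.simps(2) by metis
  have step: "P \<Delta> \<sigma>" if "Q \<and> (\<forall>\<Delta> \<sigma>. S \<Delta> \<sigma> \<Gamma> \<longrightarrow> P \<Delta> \<sigma>)" "S \<Delta> \<sigma> \<Gamma>" for Q P \<Delta> \<sigma> \<Gamma>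
    using that by blast
  show "wf_ctx \<Gamma> \<Longrightarrow> ctx_stable S \<Gamma>"
    and "\<Gamma> \<turnstile> a \<Ztypecolon> A \<Longrightarrow> ctx_stable S \<Gamma> \<and> (\<forall>\<Delta> \<sigma>. S \<Delta> \<sigma> \<Gamma> \<longrightarrow> \<Delta> \<turnstile> subst \<sigma> a \<Ztypecolon> subst \<sigma> A)"
    and "\<Gamma> \<turnstile> a \<doteq> b \<Ztypecolon> A \<Longrightarrow> ctx_stable S \<Gamma> \<and> (\<forall>\<Delta> \<sigma>. S \<Delta> \<sigma> \<Gamma> \<longrightarrow> \<Delta> \<turnstile> subst \<sigma> a \<doteq> subst \<sigma> b \<Ztypecolon> subst \<sigma> A)"
  proof (induction \<Gamma> and \<Gamma> a A and \<Gamma> a b A rule: wf_ctx_has_type_def_eq.inducts)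
    case ctx_empty then show ?case by (auto simp: S V intro: wf_ctx_has_type_def_eq.ctx_empty)
  next
    case ctx_ext then show ?case by auto
  next
    case ty_var then show ?case by (auto simp: S V intro: wf_ctx_has_type_def_eq.ty_var)
  next
    case ty_conv
    \<comment> \<open>Every rule with premises follows one pattern: the rule is applied to the
      induction hypotheses at the substitution, lifted once for each bound variable, and stability
      of the context is read off from the hypothesis for the last premise.\<close>
    from wf_ctx_has_type_def_eq.ty_conv[simplified,
        OF step[OF ty_conv.IH(1), simplified]
           step[OF ty_conv.IH(2), simplified]]
      conjunct1[OF ty_conv.IH(2)]
    show ?case by auto
  next
    case ty_univ then show ?case by (auto simp: S V intro: wf_ctx_has_type_def_eq.ty_univ)
  next
    case ty_cumul
    from wf_ctx_has_type_def_eq.ty_cumul[simplified,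
        OF step[OF ty_cumul.IH, simplified]]
      conjunct1[OF ty_cumul.IH]
    show ?case by auto
  next
    case ty_Pi
    from wf_ctx_has_type_def_eq.ty_Pi[simplified,
        OF step[OF ty_Pi.IH(1), simplified]
           step[OF ty_Pi.IH(2) E[OF conjunct1[OF ty_Pi.IH(2)]], simplified]]
      conjunct1[OF ty_Pi.IH(2)]
    show ?case by auto
  next
    case ty_Lam
    from wf_ctx_has_type_def_eq.ty_Lam[simplified,
        OF step[OF ty_Lam.IH E[OF conjunct1[OF ty_Lam.IH]], simplified]]
      conjunct1[OF ty_Lam.IH]
    show ?case by auto
  next
    case ty_App
    from wf_ctx_has_type_def_eq.ty_App[simplified,
        OF step[OF ty_App.IH(1), simplified]
           step[OF ty_App.IH(2), simplified]]
      conjunct1[OF ty_App.IH(2)]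
    show ?case by auto
  next
    case ty_Sig
    from wf_ctx_has_type_def_eq.ty_Sig[simplified,
        OF step[OF ty_Sig.IH(1), simplified]
           step[OF ty_Sig.IH(2) E[OF conjunct1[OF ty_Sig.IH(2)]], simplified]]
      conjunct1[OF ty_Sig.IH(2)]
    show ?case by auto
  next
    case ty_Pair
    from wf_ctx_has_type_def_eq.ty_Pair[simplified,
        OF step[OF ty_Pair.IH(1) E[OF conjunct1[OF ty_Pair.IH(1)]], simplified]
           step[OF ty_Pair.IH(2), simplified]
           step[OF ty_Pair.IH(3), simplified]]
      conjunct1[OF ty_Pair.IH(3)]
    show ?case by auto
  next
    case ty_SigInd
    from wf_ctx_has_type_def_eq.ty_SigInd[simplified,
        OF step[OF ty_SigInd.IH(1) E[OF conjunct1[OF ty_SigInd.IH(1)]], simplified]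
           step[OF ty_SigInd.IH(2) E2[OF conjunct1[OF ty_SigInd.IH(2)]], simplified]
           step[OF ty_SigInd.IH(3), simplified]]
      conjunct1[OF ty_SigInd.IH(3)]
    show ?case by auto
  next
    case ty_Eq
    from wf_ctx_has_type_def_eq.ty_Eq[simplified,
        OF step[OF ty_Eq.IH(1), simplified]
           step[OF ty_Eq.IH(2), simplified]
           step[OF ty_Eq.IH(3), simplified]]
      conjunct1[OF ty_Eq.IH(3)]
    show ?case by auto
  next
    case ty_Refl
    from wf_ctx_has_type_def_eq.ty_Refl[simplified,
        OF step[OF ty_Refl.IH(1), simplified]
           step[OF ty_Refl.IH(2), simplified]]
      conjunct1[OF ty_Refl.IH(2)]
    show ?case by auto
  next
    case ty_J
    from wf_ctx_has_type_def_eq.ty_J[simplified,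
        OF step[OF ty_J.IH(1) E3[OF conjunct1[OF ty_J.IH(1)]], simplified]
           step[OF ty_J.IH(2) E[OF conjunct1[OF ty_J.IH(2)]], simplified]
           step[OF ty_J.IH(3), simplified]
           step[OF ty_J.IH(4), simplified]
           step[OF ty_J.IH(5), simplified]]
      conjunct1[OF ty_J.IH(5)]
    show ?case by auto
  next
    case ty_Sum
    from wf_ctx_has_type_def_eq.ty_Sum[simplified,
        OF step[OF ty_Sum.IH(1), simplified]
           step[OF ty_Sum.IH(2), simplified]]
      conjunct1[OF ty_Sum.IH(2)]
    show ?case by auto
  next
    case ty_Inl
    from wf_ctx_has_type_def_eq.ty_Inl[simplified,
        OF step[OF ty_Inl.IH(1), simplified]
           step[OF ty_Inl.IH(2), simplified]
           step[OF ty_Inl.IH(3), simplified]]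
      conjunct1[OF ty_Inl.IH(3)]
    show ?case by auto
  next
    case ty_Inr
    from wf_ctx_has_type_def_eq.ty_Inr[simplified,
        OF step[OF ty_Inr.IH(1), simplified]
           step[OF ty_Inr.IH(2), simplified]
           step[OF ty_Inr.IH(3), simplified]]
      conjunct1[OF ty_Inr.IH(3)]
    show ?case by auto
  next
    case ty_SumInd
    from wf_ctx_has_type_def_eq.ty_SumInd[simplified,
        OF step[OF ty_SumInd.IH(1) E[OF conjunct1[OF ty_SumInd.IH(1)]], simplified]
           step[OF ty_SumInd.IH(2) E[OF conjunct1[OF ty_SumInd.IH(2)]], simplified]
           step[OF ty_SumInd.IH(3) E[OF conjunct1[OF ty_SumInd.IH(3)]], simplified]
           step[OF ty_SumInd.IH(4), simplified]]
      conjunct1[OF ty_SumInd.IH(4)]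
    show ?case by auto
  next
    case ty_Empty then show ?case by (auto simp: S V intro: wf_ctx_has_type_def_eq.ty_Empty)
  next
    case ty_EmptyInd
    from wf_ctx_has_type_def_eq.ty_EmptyInd[simplified,
        OF step[OF ty_EmptyInd.IH(1) E[OF conjunct1[OF ty_EmptyInd.IH(1)]], simplified]
           step[OF ty_EmptyInd.IH(2), simplified]]
      conjunct1[OF ty_EmptyInd.IH(2)]
    show ?case by auto
  next
    case ty_Unit then show ?case by (auto simp: S V intro: wf_ctx_has_type_def_eq.ty_Unit)
  next
    case ty_Star then show ?case by (auto simp: S V intro: wf_ctx_has_type_def_eq.ty_Star)
  next
    case ty_UnitInd
    from wf_ctx_has_type_def_eq.ty_UnitInd[simplified,
        OF step[OF ty_UnitInd.IH(1) E[OF conjunct1[OF ty_UnitInd.IH(1)]], simplified]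
           step[OF ty_UnitInd.IH(2), simplified]
           step[OF ty_UnitInd.IH(3), simplified]]
      conjunct1[OF ty_UnitInd.IH(3)]
    show ?case by auto
  next
    case ty_Nat then show ?case by (auto simp: S V intro: wf_ctx_has_type_def_eq.ty_Nat)
  next
    case ty_Zero then show ?case by (auto simp: S V intro: wf_ctx_has_type_def_eq.ty_Zero)
  next
    case ty_Succ
    from wf_ctx_has_type_def_eq.ty_Succ[simplified,
        OF step[OF ty_Succ.IH, simplified]]
      conjunct1[OF ty_Succ.IH]
    show ?case by auto
  next
    case ty_NatInd
    from wf_ctx_has_type_def_eq.ty_NatInd[simplified,
        OF step[OF ty_NatInd.IH(1) E[OF conjunct1[OF ty_NatInd.IH(1)]], simplified]
           step[OF ty_NatInd.IH(2), simplified]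
           step[OF ty_NatInd.IH(3) E2[OF conjunct1[OF ty_NatInd.IH(3)]], simplified]
           step[OF ty_NatInd.IH(4), simplified]]
      conjunct1[OF ty_NatInd.IH(4)]
    show ?case by auto
  next
    case eq_refl
    from wf_ctx_has_type_def_eq.eq_refl[simplified,
        OF step[OF eq_refl.IH, simplified]]
      conjunct1[OF eq_refl.IH]
    show ?case by auto
  next
    case eq_sym
    from wf_ctx_has_type_def_eq.eq_sym[simplified,
        OF step[OF eq_sym.IH, simplified]]
      conjunct1[OF eq_sym.IH]
    show ?case by auto
  next
    case eq_trans
    from wf_ctx_has_type_def_eq.eq_trans[simplified,
        OF step[OF eq_trans.IH(1), simplified]
           step[OF eq_trans.IH(2), simplified]]
      conjunct1[OF eq_trans.IH(2)]
    show ?case by auto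
  next
    case eq_conv
    from wf_ctx_has_type_def_eq.eq_conv[simplified,
        OF step[OF eq_conv.IH(1), simplified]
           step[OF eq_conv.IH(2), simplified]]
      conjunct1[OF eq_conv.IH(2)]
    show ?case by auto
  next
    case eq_cumul
    from wf_ctx_has_type_def_eq.eq_cumul[simplified,
        OF step[OF eq_cumul.IH, simplified]]
      conjunct1[OF eq_cumul.IH]
    show ?case by auto
  next
    case beta_Pi
    from wf_ctx_has_type_def_eq.beta_Pi[simplified,
        OF step[OF beta_Pi.IH(1) E[OF conjunct1[OF beta_Pi.IH(1)]], simplified]
           step[OF beta_Pi.IH(2), simplified]]
      conjunct1[OF beta_Pi.IH(2)]
    show ?case by auto
  next
    case beta_Sig
    from wf_ctx_has_type_def_eq.beta_Sig[simplified,
        OF step[OF beta_Sig.IH(1) E[OF conjunct1[OF beta_Sig.IH(1)]], simplified]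
           step[OF beta_Sig.IH(2) E2[OF conjunct1[OF beta_Sig.IH(2)]], simplified]
           step[OF beta_Sig.IH(3), simplified]
           step[OF beta_Sig.IH(4), simplified]]
      conjunct1[OF beta_Sig.IH(4)]
    show ?case by auto
  next
    case beta_J
    from wf_ctx_has_type_def_eq.beta_J[simplified,
        OF step[OF beta_J.IH(1) E3[OF conjunct1[OF beta_J.IH(1)]], simplified]
           step[OF beta_J.IH(2) E[OF conjunct1[OF beta_J.IH(2)]], simplified]
           step[OF beta_J.IH(3), simplified]]
      conjunct1[OF beta_J.IH(3)]
    show ?case by auto
  next
    case beta_Inl
    from wf_ctx_has_type_def_eq.beta_Inl[simplified,
        OF step[OF beta_Inl.IH(1) E[OF conjunct1[OF beta_Inl.IH(1)]], simplified]
           step[OF beta_Inl.IH(2) E[OF conjunct1[OF beta_Inl.IH(2)]], simplified]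
           step[OF beta_Inl.IH(3) E[OF conjunct1[OF beta_Inl.IH(3)]], simplified]
           step[OF beta_Inl.IH(4), simplified]]
      conjunct1[OF beta_Inl.IH(4)]
    show ?case by auto
  next
    case beta_Inr
    from wf_ctx_has_type_def_eq.beta_Inr[simplified,
        OF step[OF beta_Inr.IH(1) E[OF conjunct1[OF beta_Inr.IH(1)]], simplified]
           step[OF beta_Inr.IH(2) E[OF conjunct1[OF beta_Inr.IH(2)]], simplified]
           step[OF beta_Inr.IH(3) E[OF conjunct1[OF beta_Inr.IH(3)]], simplified]
           step[OF beta_Inr.IH(4), simplified]]
      conjunct1[OF beta_Inr.IH(4)]
    show ?case by auto
  next
    case beta_Unit
    from wf_ctx_has_type_def_eq.beta_Unit[simplified,
        OF step[OF beta_Unit.IH(1) E[OF conjunct1[OF beta_Unit.IH(1)]], simplified]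
           step[OF beta_Unit.IH(2), simplified]]
      conjunct1[OF beta_Unit.IH(2)]
    show ?case by auto
  next
    case beta_Zero
    from wf_ctx_has_type_def_eq.beta_Zero[simplified,
        OF step[OF beta_Zero.IH(1) E[OF conjunct1[OF beta_Zero.IH(1)]], simplified]
           step[OF beta_Zero.IH(2), simplified]
           step[OF beta_Zero.IH(3) E2[OF conjunct1[OF beta_Zero.IH(3)]], simplified]]
      conjunct1[OF beta_Zero.IH(3)]
    show ?case by auto
  next
    case beta_Succ
    from wf_ctx_has_type_def_eq.beta_Succ[simplified,
        OF step[OF beta_Succ.IH(1) E[OF conjunct1[OF beta_Succ.IH(1)]], simplified]
           step[OF beta_Succ.IH(2), simplified]
           step[OF beta_Succ.IH(3) E2[OF conjunct1[OF beta_Succ.IH(3)]], simplified]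
           step[OF beta_Succ.IH(4), simplified]]
      conjunct1[OF beta_Succ.IH(4)]
    show ?case by auto
  next
    case cong_Pi
    from wf_ctx_has_type_def_eq.cong_Pi[simplified,
        OF step[OF cong_Pi.IH(1), simplified]
           step[OF cong_Pi.IH(2) E[OF conjunct1[OF cong_Pi.IH(2)]], simplified]]
      conjunct1[OF cong_Pi.IH(2)]
    show ?case by auto
  next
    case cong_Lam
    from wf_ctx_has_type_def_eq.cong_Lam[simplified,
        OF step[OF cong_Lam.IH(1), simplified]
           step[OF cong_Lam.IH(2) E[OF conjunct1[OF cong_Lam.IH(2)]], simplified]]
      conjunct1[OF cong_Lam.IH(2)]
    show ?case by auto
  next
    case cong_App
    from wf_ctx_has_type_def_eq.cong_App[simplified,
        OF step[OF cong_App.IH(1), simplified]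
           step[OF cong_App.IH(2), simplified]]
      conjunct1[OF cong_App.IH(2)]
    show ?case by auto
  next
    case cong_Sig
    from wf_ctx_has_type_def_eq.cong_Sig[simplified,
        OF step[OF cong_Sig.IH(1), simplified]
           step[OF cong_Sig.IH(2) E[OF conjunct1[OF cong_Sig.IH(2)]], simplified]]
      conjunct1[OF cong_Sig.IH(2)]
    show ?case by auto
  next
    case cong_Pair
    from wf_ctx_has_type_def_eq.cong_Pair[simplified,
        OF step[OF cong_Pair.IH(1), simplified]
           step[OF cong_Pair.IH(2) E[OF conjunct1[OF cong_Pair.IH(2)]], simplified]
           step[OF cong_Pair.IH(3), simplified]
           step[OF cong_Pair.IH(4), simplified]]
      conjunct1[OF cong_Pair.IH(4)]
    show ?case by auto
  next
    case cong_SigInd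
    from wf_ctx_has_type_def_eq.cong_SigInd[simplified,
        OF step[OF cong_SigInd.IH(1) E[OF conjunct1[OF cong_SigInd.IH(1)]], simplified]
           step[OF cong_SigInd.IH(2) E2[OF conjunct1[OF cong_SigInd.IH(2)]], simplified]
           step[OF cong_SigInd.IH(3), simplified]]
      conjunct1[OF cong_SigInd.IH(3)]
    show ?case by auto
  next
    case cong_Eq
    from wf_ctx_has_type_def_eq.cong_Eq[simplified,
        OF step[OF cong_Eq.IH(1), simplified]
           step[OF cong_Eq.IH(2), simplified]
           step[OF cong_Eq.IH(3), simplified]]
      conjunct1[OF cong_Eq.IH(3)]
    show ?case by auto
  next
    case cong_Refl
    from wf_ctx_has_type_def_eq.cong_Refl[simplified,
        OF step[OF cong_Refl.IH(1), simplified]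
           step[OF cong_Refl.IH(2), simplified]]
      conjunct1[OF cong_Refl.IH(2)]
    show ?case by auto
  next
    case cong_J
    from wf_ctx_has_type_def_eq.cong_J[simplified,
        OF step[OF cong_J.IH(1) E3[OF conjunct1[OF cong_J.IH(1)]], simplified]
           step[OF cong_J.IH(2) E[OF conjunct1[OF cong_J.IH(2)]], simplified]
           step[OF cong_J.IH(3), simplified]
           step[OF cong_J.IH(4), simplified]
           step[OF cong_J.IH(5), simplified]]
      conjunct1[OF cong_J.IH(5)]
    show ?case by auto
  next
    case cong_Sum
    from wf_ctx_has_type_def_eq.cong_Sum[simplified,
        OF step[OF cong_Sum.IH(1), simplified]
           step[OF cong_Sum.IH(2), simplified]]
      conjunct1[OF cong_Sum.IH(2)]
    show ?case by auto
  next
    case cong_Inl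
    from wf_ctx_has_type_def_eq.cong_Inl[simplified,
        OF step[OF cong_Inl.IH(1), simplified]
           step[OF cong_Inl.IH(2), simplified]
           step[OF cong_Inl.IH(3), simplified]]
      conjunct1[OF cong_Inl.IH(3)]
    show ?case by auto
  next
    case cong_Inr
    from wf_ctx_has_type_def_eq.cong_Inr[simplified,
        OF step[OF cong_Inr.IH(1), simplified]
           step[OF cong_Inr.IH(2), simplified]
           step[OF cong_Inr.IH(3), simplified]]
      conjunct1[OF cong_Inr.IH(3)]
    show ?case by auto
  next
    case cong_SumInd
    from wf_ctx_has_type_def_eq.cong_SumInd[simplified,
        OF step[OF cong_SumInd.IH(1) E[OF conjunct1[OF cong_SumInd.IH(1)]], simplified]
           step[OF cong_SumInd.IH(2) E[OF conjunct1[OF cong_SumInd.IH(2)]], simplified]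
           step[OF cong_SumInd.IH(3) E[OF conjunct1[OF cong_SumInd.IH(3)]], simplified]
           step[OF cong_SumInd.IH(4), simplified]]
      conjunct1[OF cong_SumInd.IH(4)]
    show ?case by auto
  next
    case cong_EmptyInd
    from wf_ctx_has_type_def_eq.cong_EmptyInd[simplified,
        OF step[OF cong_EmptyInd.IH(1) E[OF conjunct1[OF cong_EmptyInd.IH(1)]], simplified]
           step[OF cong_EmptyInd.IH(2), simplified]]
      conjunct1[OF cong_EmptyInd.IH(2)]
    show ?case by auto
  next
    case cong_UnitInd
    from wf_ctx_has_type_def_eq.cong_UnitInd[simplified,
        OF step[OF cong_UnitInd.IH(1) E[OF conjunct1[OF cong_UnitInd.IH(1)]], simplified]
           step[OF cong_UnitInd.IH(2), simplified]
           step[OF cong_UnitInd.IH(3), simplified]]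
      conjunct1[OF cong_UnitInd.IH(3)]
    show ?case by auto
  next
    case cong_Succ
    from wf_ctx_has_type_def_eq.cong_Succ[simplified,
        OF step[OF cong_Succ.IH, simplified]]
      conjunct1[OF cong_Succ.IH]
    show ?case by auto
  next
    case cong_NatInd
    from wf_ctx_has_type_def_eq.cong_NatInd[simplified,
        OF step[OF cong_NatInd.IH(1) E[OF conjunct1[OF cong_NatInd.IH(1)]], simplified]
           step[OF cong_NatInd.IH(2), simplified]
           step[OF cong_NatInd.IH(3) E2[OF conjunct1[OF cong_NatInd.IH(3)]], simplified]
           step[OF cong_NatInd.IH(4), simplified]]
      conjunct1[OF cong_NatInd.IH(4)]
    show ?case by auto
  qed
qed

lemma wf_ctx_Cons: "wf_ctx (A # \<Gamma>) \<Longrightarrow> \<exists>i. \<Gamma> \<turnstile> A \<Ztypecolon> Univ i"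
  by (erule wf_ctx.cases) auto

lemma has_type_wf_ctx:
  assumes "\<Gamma> \<turnstile> a \<Ztypecolon> A"
  shows "wf_ctx \<Gamma>"
proof -
  define S where "S = (\<lambda>\<Delta> \<sigma> \<Gamma>. \<Delta> = \<Gamma> \<and> \<sigma> = Var \<and> wf_ctx \<Gamma>)"
  have "ctx_stable S \<Gamma>"
  proof (rule conjunct1[OF subst_stable(2)[where S = S, OF _ _ _ assms]])
    show "\<And>\<Delta> \<sigma> \<Gamma> A i. S \<Delta> \<sigma> \<Gamma> \<Longrightarrow> \<Delta> \<turnstile> subst \<sigma> A \<Ztypecolon> Univ i \<Longrightarrow> S (subst \<sigma> A # \<Delta>) (up \<sigma>) (A # \<Gamma>)"
      \<comment> \<open>\<open>Var\<close> is the renaming by the identity, which \<open>up\<close>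
        preserves.\<close>
      using up_Var[of "\<lambda>n. n"] by (auto simp: S_def up_ren_id intro: ctx_ext)
  qed (auto simp: S_def intro: ty_var)
  then show ?thesis
    \<comment> \<open>For the identity substitution, stability of a type over a well-formed context
      is just its typing, so the context can be rebuilt entry by entry.\<close>
    by (induction \<Gamma>) (auto simp: S_def intro: ctx_empty ctx_ext)
qed

text \<open>The condition on \<open>\<rho>\<close> compares declared types literally, so a renamed
  variable is again typed by \<open>ty_var\<close>, without conversion. It survives a binder because
  both sides are then shifted by one.\<close>

lemma ren_has_type:
  assumes "\<Gamma> \<turnstile> a \<Ztypecolon> A" and "wf_ctx \<Delta>"
    and "\<And>n. n < length \<Gamma> \<Longrightarrow> \<rho> n < length \<Delta> \<and> wk (Suc (\<rho> n)) (\<Delta> ! \<rho> n) = ren \<rho> (wk (Suc n) (\<Gamma> ! n))"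
  shows "\<Delta> \<turnstile> ren \<rho> a \<Ztypecolon> ren \<rho> A"
proof -
  define S where "S = (\<lambda>\<Delta> \<sigma> \<Gamma>. wf_ctx \<Delta> \<and> (\<exists>\<rho>. \<sigma> = (\<lambda>n. Var (\<rho> n)) \<and>
    (\<forall>n < length \<Gamma>. \<rho> n < length \<Delta> \<and> wk (Suc (\<rho> n)) (\<Delta> ! \<rho> n) = ren \<rho> (wk (Suc n) (\<Gamma> ! n)))))"
  have "\<forall>\<Delta> \<sigma>. S \<Delta> \<sigma> \<Gamma> \<longrightarrow> \<Delta> \<turnstile> subst \<sigma> a \<Ztypecolon> subst \<sigma> A"
  proof (rule conjunct2[OF subst_stable(2)[where S = S, OF _ _ _ assms(1)]])
    fix \<Delta> \<sigma> \<Gamma> A i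
    assume "S \<Delta> \<sigma> \<Gamma>" and A: "\<Delta> \<turnstile> subst \<sigma> A \<Ztypecolon> Univ i"
    then obtain \<rho> where \<rho>: "\<sigma> = (\<lambda>n. Var (\<rho> n))"
      "\<And>n. n < length \<Gamma> \<Longrightarrow> \<rho> n < length \<Delta>"
      "\<And>n. n < length \<Gamma> \<Longrightarrow> wk (Suc (\<rho> n)) (\<Delta> ! \<rho> n) = ren \<rho> (wk (Suc n) (\<Gamma> ! n))"
      by (auto simp: S_def)
    have "wk (Suc (up_ren \<rho> n)) ((ren \<rho> A # \<Delta>) ! up_ren \<rho> n) = ren (up_ren \<rho>) (wk (Suc n) ((A # \<Gamma>)
        ! n))"
      if "n < Suc (length \<Gamma>)" for n
    proof (cases n)
      case (Suc m)
      with that have "ren Suc (wk (Suc (\<rho> m)) (\<Delta> ! \<rho> m)) = ren Suc (ren \<rho> (wk (Suc m) (\<Gamma> ! m)))"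
        using \<rho>(3) by simp
      with Suc show ?thesis by (simp add: wk_def)
    qed (simp add: wk_def)
    moreover have "up_ren \<rho> n < Suc (length \<Delta>)" if "n < Suc (length \<Gamma>)" for n
      using that \<rho>(2) by (cases n) auto
    ultimately show "S (subst \<sigma> A # \<Delta>) (up \<sigma>) (A # \<Gamma>)"
      using A \<rho>(1) by (auto simp: S_def up_Var intro: ctx_ext)
  qed (auto simp: S_def dest: ty_var)
  moreover have "S \<Delta> (\<lambda>n. Var (\<rho> n)) \<Gamma>"
    using assms by (auto simp: S_def)
  ultimately show ?thesis by fastforce
qed

lemma weaken_append:
  assumes "\<Gamma> \<turnstile> a \<Ztypecolon> A" and "wf_ctx (\<Delta> @ \<Gamma>)"
  shows "\<Delta> @ \<Gamma> \<turnstile> wk (length \<Delta>) a \<Ztypecolon> wk (length \<Delta>) A"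
  unfolding wk_def
  by (rule ren_has_type[OF assms]) (auto simp: nth_append wk_def add.assoc)

lemma subst_has_type:
  assumes "\<Gamma> \<turnstile> a \<Ztypecolon> A" and "wf_ctx \<Delta>"
    and "\<And>n. n < length \<Gamma> \<Longrightarrow> \<Delta> \<turnstile> \<sigma> n \<Ztypecolon> subst \<sigma> (wk (Suc n) (\<Gamma> ! n))"
  shows "\<Delta> \<turnstile> subst \<sigma> a \<Ztypecolon> subst \<sigma> A"
proof -
  define S where "S = (\<lambda>\<Delta> \<sigma> \<Gamma>. wf_ctx \<Delta> \<and> (\<forall>n < length \<Gamma>. \<Delta> \<turnstile> \<sigma> n \<Ztypecolon> subst \<sigma> (wk (Suc n) (\<Gamma> ! n))))"
  have "\<forall>\<Delta> \<sigma>. S \<Delta> \<sigma> \<Gamma> \<longrightarrow> \<Delta> \<turnstile> subst \<sigma> a \<Ztypecolon> subst \<sigma> A"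
  proof (rule conjunct2[OF subst_stable(2)[where S = S, OF _ _ _ assms(1)]])
    fix \<Delta> \<sigma> \<Gamma> A i
    assume S: "S \<Delta> \<sigma> \<Gamma>" and A: "\<Delta> \<turnstile> subst \<sigma> A \<Ztypecolon> Univ i"
    then have wf: "wf_ctx (subst \<sigma> A # \<Delta>)" by (intro ctx_ext)
    have "subst \<sigma> A # \<Delta> \<turnstile> up \<sigma> n \<Ztypecolon> subst (up \<sigma>) (wk (Suc n) ((A # \<Gamma>) ! n))"
      if "n < Suc (length \<Gamma>)" for n
    proof (cases n)
      case 0
      then show ?thesis using ty_var[OF wf, of 0] by (simp add: wk_def)
    next
      case (Suc m)
      with that S have "\<Delta> \<turnstile> \<sigma> m \<Ztypecolon> subst \<sigma> (wk (Suc m) (\<Gamma> ! m))" by (simp add: S_def)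
      from weaken_append[OF this, of "[subst \<sigma> A]"] wf Suc show ?thesis
        by (simp add: wk_def)
    qed
    with wf show "S (subst \<sigma> A # \<Delta>) (up \<sigma>) (A # \<Gamma>)"
      by (auto simp: S_def)
  qed (auto simp: S_def)
  with assms show ?thesis by (auto simp: S_def)
qed

section \<open>Normal forms of substitutions and derived typing rules\<close>

lemma subst_cong: "(\<And>n. \<sigma> n = \<tau> n) \<Longrightarrow> subst \<sigma> t = subst \<tau> t"
  by presburger

text \<open>
  The equations \<open>db\<close> bring every substitution into the form of an iterated \<open>case_nat\<close>, so that
  simplification decides equality of substituted terms, even around variables of the metalanguage.
\<close>

lemma inst_case_nat:
  "inst k [a] t = subst (case_nat a (\<lambda>n. Var (n + k))) t"
  "inst k [a, b] t = subst (case_nat a (case_nat b (\<lambda>n. Var (n + k)))) t"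
  "inst k [a, b, c] t = subst (case_nat a (case_nat b (case_nat c (\<lambda>n. Var (n + k))))) t"
  by (auto simp: inst_def nth_Cons less_Suc_eq_0_disj split: nat.splits intro!: subst_cong)

lemma case_nat_comp:
  "(\<lambda>n. subst \<tau> (case_nat a \<sigma> n)) = case_nat (subst \<tau> a) (\<lambda>n. subst \<tau> (\<sigma> n))"
  "(\<lambda>n. ren \<rho> (case_nat a \<sigma> n)) = case_nat (ren \<rho> a) (\<lambda>n. ren \<rho> (\<sigma> n))"
  "(\<lambda>n. case_nat x g (case_nat m \<rho> n)) = case_nat (case_nat x g m) (\<lambda>n. case_nat x g (\<rho> n))"
  "case_nat (Suc m) (\<lambda>n. Suc (\<rho> n)) = (\<lambda>n. Suc (case_nat m \<rho> n))"
  "case_nat (Var m) (\<lambda>n. Var (\<rho> n)) = (\<lambda>n. Var (case_nat m \<rho> n))"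
  "case_nat 0 Suc = (\<lambda>n. n)"
  by (auto split: nat.splits)

lemmas db = wk_def inst_case_nat up_def up_ren_def case_nat_comp numeral_eq_Suc

lemma inst_has_type:
  assumes "A # \<Gamma> \<turnstile> b \<Ztypecolon> B" and "\<Gamma> \<turnstile> a \<Ztypecolon> A"
  shows "\<Gamma> \<turnstile> inst 0 [a] b \<Ztypecolon> inst 0 [a] B"
  unfolding inst_case_nat
proof (rule subst_has_type[OF assms(1) has_type_wf_ctx[OF assms(2)]])
  fix n assume "n < length (A # \<Gamma>)"
  then show "\<Gamma> \<turnstile> case_nat a (\<lambda>n. Var (n + 0)) n \<Ztypecolon>
    subst (case_nat a (\<lambda>n. Var (n + 0))) (wk (Suc n) ((A # \<Gamma>) ! n))"
    using assms(2) ty_var[OF has_type_wf_ctx[OF assms(2)]]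
    by (cases n) (auto simp: db)
qed

lemma weaken:
  assumes "\<Gamma> \<turnstile> a \<Ztypecolon> A" and "\<Gamma> \<turnstile> B \<Ztypecolon> Univ i"
  shows "B # \<Gamma> \<turnstile> ren Suc a \<Ztypecolon> ren Suc A"
  using weaken_append[OF assms(1), of "[B]"] assms(2) by (simp add: db ctx_ext)

text \<open>The type is a free variable with a syntactic equation as premise. The rule therefore
  resolves with any goal about a variable, and \<open>db\<close> decides the equation
  afterwards.\<close>

lemma ty_var_eq:
  "wf_ctx \<Gamma> \<Longrightarrow> n < length \<Gamma> \<Longrightarrow> wk (Suc n) (\<Gamma> ! n) = A \<Longrightarrow> \<Gamma> \<turnstile> Var n \<Ztypecolon> A"
  using ty_var by auto

lemma ty_App_eq:
  "\<Gamma> \<turnstile> f \<Ztypecolon> Pi A B \<Longrightarrow> \<Gamma> \<turnstile> a \<Ztypecolon> A \<Longrightarrow> inst 0 [a] B = C \<Longrightarrow> \<Gamma> \<turnstile> App f a \<Ztypecolon> C"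
  using ty_App by auto

lemma ty_App_Arrow: "\<Gamma> \<turnstile> f \<Ztypecolon> Arrow A B \<Longrightarrow> \<Gamma> \<turnstile> a \<Ztypecolon> A \<Longrightarrow> \<Gamma> \<turnstile> App f a \<Ztypecolon> B"
  using ty_App[of \<Gamma> f A "wk 1 B" a] by (simp add: Arrow_def db)

lemma derived_ren [simp]:
  "ren \<rho> (Arrow A B) = Arrow (ren \<rho> A) (ren \<rho> B)"
  "ren \<rho> (Prod A B) = Prod (ren \<rho> A) (ren \<rho> B)"
  "ren \<rho> (IsProp A) = IsProp (ren \<rho> A)"
  "ren \<rho> (Fiber A X s x) = Fiber (ren \<rho> A) (ren \<rho> X) (ren \<rho> s) (ren \<rho> x)"
  "ren \<rho> (IsEmbedding A X s) = IsEmbedding (ren \<rho> A) (ren \<rho> X) (ren \<rho> s)"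
  "ren \<rho> (WeaklyConstant A g) = WeaklyConstant (ren \<rho> A) (ren \<rho> g)"
  "ren \<rho> (WeaklyConstantEndo A) = WeaklyConstantEndo (ren \<rho> A)"
  by (simp_all add: Arrow_def Prod_def IsProp_def Fiber_def IsEmbedding_def WeaklyConstant_def
      WeaklyConstantEndo_def db)

lemma derived_subst [simp]:
  "subst \<sigma> (Arrow A B) = Arrow (subst \<sigma> A) (subst \<sigma> B)"
  "subst \<sigma> (Prod A B) = Prod (subst \<sigma> A) (subst \<sigma> B)"
  "subst \<sigma> (IsProp A) = IsProp (subst \<sigma> A)"
  "subst \<sigma> (Fiber A X s x) = Fiber (subst \<sigma> A) (subst \<sigma> X) (subst \<sigma> s) (subst \<sigma> x)"
  "subst \<sigma> (IsEmbedding A X s) = IsEmbedding (subst \<sigma> A) (subst \<sigma> X) (subst \<sigma> s)"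
  "subst \<sigma> (WeaklyConstant A g) = WeaklyConstant (subst \<sigma> A) (subst \<sigma> g)"
  "subst \<sigma> (WeaklyConstantEndo A) = WeaklyConstantEndo (subst \<sigma> A)"
  by (simp_all add: Arrow_def Prod_def IsProp_def Fiber_def IsEmbedding_def WeaklyConstant_def
      WeaklyConstantEndo_def db)

lemma ty_Arrow: "\<Gamma> \<turnstile> A \<Ztypecolon> Univ i \<Longrightarrow> \<Gamma> \<turnstile> B \<Ztypecolon> Univ i \<Longrightarrow> \<Gamma> \<turnstile> Arrow A B \<Ztypecolon> Univ i"
  using weaken[of \<Gamma> B "Univ i" A i] by (auto simp: Arrow_def db intro!: ty_Pi)

section \<open>Identity types\<close>

text \<open>\<open>J\<close> is applied to the family of functions from \<open>B\<close> at the
  first endpoint to \<open>B\<close> at the second; on the diagonal the identity function is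
  available. The result is then applied to \<open>u\<close>.\<close>

lemma transport:
  assumes A: "\<Gamma> \<turnstile> A \<Ztypecolon> Univ i" and B: "A # \<Gamma> \<turnstile> B \<Ztypecolon> Univ j"
    and a: "\<Gamma> \<turnstile> a \<Ztypecolon> A" and b: "\<Gamma> \<turnstile> b \<Ztypecolon> A" and p: "\<Gamma> \<turnstile> p \<Ztypecolon> Eq A a b"
    and u: "\<Gamma> \<turnstile> u \<Ztypecolon> inst 0 [a] B"
  shows "\<exists>v. \<Gamma> \<turnstile> v \<Ztypecolon> inst 0 [b] B"
proof -
  let ?\<Delta> = "Eq (wk 2 A) (Var 1) (Var 0) # wk 1 A # A # \<Gamma>"
  have wf1: "wf_ctx (A # \<Gamma>)" using A by (rule ctx_ext)
  have A1: "A # \<Gamma> \<turnstile> wk 1 A \<Ztypecolon> Univ i"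
    using weaken_append[OF A, of "[A]"] wf1 by (simp add: db)
  have wf2: "wf_ctx (wk 1 A # A # \<Gamma>)" using A1 by (rule ctx_ext)
  have A2: "wk 1 A # A # \<Gamma> \<turnstile> wk 2 A \<Ztypecolon> Univ i"
    using weaken_append[OF A, of "[wk 1 A, A]"] wf2 by (simp add: db)
  have wf3: "wf_ctx ?\<Delta>"
    by (rule ctx_ext[OF ty_Eq[OF A2]]) (rule ty_var_eq[OF wf2]; simp add: db)+
  \<comment> \<open>Under the three variables of the motive the endpoints are \<open>Var 2\<close>
    and \<open>Var 1\<close>; \<open>B\<close> is moved there with its own variable sent to either
    of them.\<close>
  have ren: "?\<Delta> \<turnstile> inst 3 [Var m] B \<Ztypecolon> Univ j" if "m = 1 \<or> m = 2" for m
    using ren_has_type[OF B wf3, of "case_nat m (\<lambda>n. n + 3)"] that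
    by (auto simp: db nth_Cons split: nat.splits)
  have C: "?\<Delta> \<turnstile> Arrow (inst 3 [Var 2] B) (inst 3 [Var 1] B) \<Ztypecolon> Univ j"
    by (intro ty_Arrow ren) auto
  have "B # A # \<Gamma> \<turnstile> Var 0 \<Ztypecolon> wk 1 B"
    by (rule ty_var_eq[OF ctx_ext[OF B]]) (auto simp: db)
  then have "A # \<Gamma> \<turnstile> Lam B (Var 0) \<Ztypecolon> Arrow B B"
    unfolding Arrow_def by (rule ty_Lam)
  then have "\<Gamma> \<turnstile> J (Arrow (inst 3 [Var 2] B) (inst 3 [Var 1] B)) (Lam B (Var 0)) a b p
      \<Ztypecolon> Arrow (inst 0 [a] B) (inst 0 [b] B)"
    using ty_J[OF C _ a b p, of "Lam B (Var 0)"] by (simp add: db)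
  from ty_App_Arrow[OF this u] show ?thesis by blast
qed

lemma wk_has_type:
  "\<Gamma> \<turnstile> a \<Ztypecolon> A \<Longrightarrow> wf_ctx (B # \<Gamma>) \<Longrightarrow> wk 1 A = T \<Longrightarrow> B # \<Gamma> \<turnstile> wk 1 a \<Ztypecolon> T"
  "\<Gamma> \<turnstile> a \<Ztypecolon> A \<Longrightarrow> wf_ctx (C # B # \<Gamma>) \<Longrightarrow> wk 2 A = T \<Longrightarrow> C # B # \<Gamma> \<turnstile> wk 2 a \<Ztypecolon> T"
  "\<Gamma> \<turnstile> a \<Ztypecolon> A \<Longrightarrow> wf_ctx (D # C # B # \<Gamma>) \<Longrightarrow> wk 3 A = T \<Longrightarrow> D # C # B # \<Gamma> \<turnstile> wk 3 a \<Ztypecolon> T"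
  "\<Gamma> \<turnstile> a \<Ztypecolon> A \<Longrightarrow> wf_ctx (E # D # C # B # \<Gamma>) \<Longrightarrow> wk 4 A = T
    \<Longrightarrow> E # D # C # B # \<Gamma> \<turnstile> wk 4 a \<Ztypecolon> T"
  using weaken_append[of \<Gamma> a A "[B]"] weaken_append[of \<Gamma> a A "[C, B]"]
    weaken_append[of \<Gamma> a A "[D, C, B]"] weaken_append[of \<Gamma> a A "[E, D, C, B]"]
  by (auto simp: numeral_eq_Suc)

text \<open>Passing through an applied abstraction avoids an induction over all congruence rules.\<close>

lemma inst_cong_type:
  assumes "A # \<Gamma> \<turnstile> B \<Ztypecolon> Univ i" "\<Gamma> \<turnstile> a \<Ztypecolon> A" "\<Gamma> \<turnstile> a' \<Ztypecolon> A" "\<Gamma> \<turnstile> a \<doteq> a' \<Ztypecolon> A"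
  shows "\<Gamma> \<turnstile> inst 0 [a] B \<doteq> inst 0 [a'] B \<Ztypecolon> Univ i"
proof -
  have "\<Gamma> \<turnstile> App (Lam A B) a \<doteq> App (Lam A B) a' \<Ztypecolon> Univ i"
    using cong_App[OF eq_refl[OF ty_Lam[OF assms(1)]] assms(4)] by (simp add: db)
  moreover have "\<Gamma> \<turnstile> App (Lam A B) x \<doteq> inst 0 [x] B \<Ztypecolon> Univ i" if "\<Gamma> \<turnstile> x \<Ztypecolon> A" for x
    using beta_Pi[OF assms(1) that] by (simp add: db)
  ultimately show ?thesis using assms(2,3) by (meson eq_sym eq_trans)
qed

text \<open>Resolution with these rules, alternating with \<open>simp add: db\<close> for the
  syntactic equations they leave behind, serves as a type checker below.\<close>

lemmas tyI = wk_has_type ctx_ext ty_Eq ty_Arrow ty_Refl ty_var_eq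

text \<open>Transport of \<open>Refl a\<close> along \<open>p\<close> in the family of paths x =
  a.\<close>

lemma Eq_sym:
  assumes A: "\<Gamma> \<turnstile> A \<Ztypecolon> Univ i" and a: "\<Gamma> \<turnstile> a \<Ztypecolon> A" and b: "\<Gamma> \<turnstile> b \<Ztypecolon> A" and p: "\<Gamma> \<turnstile> p \<Ztypecolon> Eq A a b"
  shows "\<exists>q. \<Gamma> \<turnstile> q \<Ztypecolon> Eq A b a"
proof -
  have B: "A # \<Gamma> \<turnstile> Eq (wk 1 A) (Var 0) (wk 1 a) \<Ztypecolon> Univ i"
    by (assumption | rule tyI A a | simp add: db; fail)+
  show ?thesis
    using transport[OF A B a b p, of "Refl a"] ty_Refl[OF A a] by (simp add: db)
qed

text \<open>Transport of \<open>p\<close> along \<open>q\<close> in the family of paths a =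
  x.\<close>

lemma Eq_trans:
  assumes A: "\<Gamma> \<turnstile> A \<Ztypecolon> Univ i" and a: "\<Gamma> \<turnstile> a \<Ztypecolon> A" and b: "\<Gamma> \<turnstile> b \<Ztypecolon> A" and c: "\<Gamma> \<turnstile> c \<Ztypecolon> A"
    and p: "\<Gamma> \<turnstile> p \<Ztypecolon> Eq A a b" and q: "\<Gamma> \<turnstile> q \<Ztypecolon> Eq A b c"
  shows "\<exists>r. \<Gamma> \<turnstile> r \<Ztypecolon> Eq A a c"
proof -
  have B: "A # \<Gamma> \<turnstile> Eq (wk 1 A) (wk 1 a) (Var 0) \<Ztypecolon> Univ i"
    by (rule tyI A a | simp add: db; fail)+
  show ?thesis
    using transport[OF A B b c q, of p] p by (simp add: db)
qed

text \<open>Transport of reflexivity in the family t(a) = t(x). An open term takes the place of a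
  function because the lemma is also applied to pairing and to the first projection, where this
  saves a beta step.\<close>

lemma Eq_ap:
  assumes A: "\<Gamma> \<turnstile> A \<Ztypecolon> Univ i" and B: "\<Gamma> \<turnstile> B \<Ztypecolon> Univ j" and t: "A # \<Gamma> \<turnstile> t \<Ztypecolon> wk 1 B"
    and a: "\<Gamma> \<turnstile> a \<Ztypecolon> A" and b: "\<Gamma> \<turnstile> b \<Ztypecolon> A" and p: "\<Gamma> \<turnstile> p \<Ztypecolon> Eq A a b"
  shows "\<exists>q. \<Gamma> \<turnstile> q \<Ztypecolon> Eq B (inst 0 [a] t) (inst 0 [b] t)"
proof -
  have ta: "\<Gamma> \<turnstile> inst 0 [a] t \<Ztypecolon> B" using inst_has_type[OF t a] by (simp add: db)
  have C: "A # \<Gamma> \<turnstile> Eq (wk 1 B) (wk 1 (inst 0 [a] t)) t \<Ztypecolon> Univ j"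
    by (rule tyI A B ta t | simp add: db; fail)+
  show ?thesis
    using transport[OF A C a b p, of "Refl (inst 0 [a] t)"] ty_Refl[OF B ta] by (simp add: db)
qed

lemma Eq_ap_App:
  assumes A: "\<Gamma> \<turnstile> A \<Ztypecolon> Univ i" and B: "\<Gamma> \<turnstile> B \<Ztypecolon> Univ j" and f: "\<Gamma> \<turnstile> f \<Ztypecolon> Arrow A B"
    and a: "\<Gamma> \<turnstile> a \<Ztypecolon> A" and b: "\<Gamma> \<turnstile> b \<Ztypecolon> A" and p: "\<Gamma> \<turnstile> p \<Ztypecolon> Eq A a b"
  shows "\<exists>q. \<Gamma> \<turnstile> q \<Ztypecolon> Eq B (App f a) (App f b)"
proof -
  have "A # \<Gamma> \<turnstile> App (wk 1 f) (Var 0) \<Ztypecolon> wk 1 B"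
    by (rule ty_App_Arrow[where A = "wk 1 A"]) (rule tyI A B f | simp add: db; fail)+
  from Eq_ap[OF A B this a b p] show ?thesis by (simp add: db)
qed

text \<open>Contraction of the singleton at \<open>a\<close>. In the motive the singleton type
  itself varies with the first endpoint, so the unbased \<open>J\<close> suffices.\<close>

lemma singleton_Eq:
  assumes A: "\<Gamma> \<turnstile> A \<Ztypecolon> Univ i" and a: "\<Gamma> \<turnstile> a \<Ztypecolon> A" and b: "\<Gamma> \<turnstile> b \<Ztypecolon> A" and p: "\<Gamma> \<turnstile> p \<Ztypecolon> Eq A a b"
  defines "P \<equiv> Eq (wk 1 A) (wk 1 a) (Var 0)"
  shows "\<exists>q. \<Gamma> \<turnstile> q \<Ztypecolon> Eq (Sig A P) (Pair A P a (Refl a)) (Pair A P b p)"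
proof -
  let ?\<Delta> = "Eq (wk 2 A) (Var 1) (Var 0) # wk 1 A # A # \<Gamma>"
  have wf: "wf_ctx ?\<Delta>" by (rule tyI A | simp add: db; fail)+
  let ?P = "Eq (wk 4 A) (Var 3) (Var 0)"
  have A3: "?\<Delta> \<turnstile> wk 3 A \<Ztypecolon> Univ i" by (rule tyI A wf | simp add: db; fail)+
  have wf4: "wf_ctx (wk 3 A # ?\<Delta>)" using A3 by (rule ctx_ext)
  have P: "wk 3 A # ?\<Delta> \<turnstile> ?P \<Ztypecolon> Univ i" by (rule tyI A wf4 | simp add: db; fail)+
  have v: "?\<Delta> \<turnstile> Var 2 \<Ztypecolon> wk 3 A" "?\<Delta> \<turnstile> Var 1 \<Ztypecolon> wk 3 A" "?\<Delta> \<turnstile> Var 0 \<Ztypecolon> Eq (wk 3 A) (Var 2) (Var 1)"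
    by (rule ty_var_eq[OF wf]; simp add: db)+
  have l: "?\<Delta> \<turnstile> Pair (wk 3 A) ?P (Var 2) (Refl (Var 2)) \<Ztypecolon> Sig (wk 3 A) ?P"
    by (rule ty_Pair[OF P v(1)]) (use ty_Refl[OF A3 v(1)] in \<open>simp add: db\<close>)
  have r: "?\<Delta> \<turnstile> Pair (wk 3 A) ?P (Var 1) (Var 0) \<Ztypecolon> Sig (wk 3 A) ?P"
    by (rule ty_Pair[OF P v(2)]) (use v(3) in \<open>simp add: db\<close>)
  have C: "?\<Delta> \<turnstile> Eq (Sig (wk 3 A) ?P) (Pair (wk 3 A) ?P (Var 2) (Refl (Var 2)))
      (Pair (wk 3 A) ?P (Var 1) (Var 0)) \<Ztypecolon> Univ i"
    by (rule ty_Eq ty_Sig A3 P l r)+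
  have wf1: "wf_ctx (A # \<Gamma>)" using A by (rule ctx_ext)
  have A1: "A # \<Gamma> \<turnstile> wk 1 A \<Ztypecolon> Univ i" by (rule tyI A wf1 | simp add: db; fail)+
  have v1: "A # \<Gamma> \<turnstile> Var 0 \<Ztypecolon> wk 1 A" by (rule ty_var_eq[OF wf1]; simp add: db)
  have P1: "wk 1 A # A # \<Gamma> \<turnstile> Eq (wk 2 A) (Var 1) (Var 0) \<Ztypecolon> Univ i"
      by (rule tyI A1 A | simp add: db; fail)+
  \<comment> \<open>On the diagonal both pairs become the same pair with reflexivity, whose
    \<open>Refl\<close> is the branch of \<open>J\<close>.\<close>
  have "A # \<Gamma> \<turnstile> Pair (wk 1 A) (Eq (wk 2 A) (Var 1) (Var 0)) (Var 0) (Refl (Var 0)) \<Ztypecolon>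
    Sig (wk 1 A) (Eq (wk 2 A) (Var 1) (Var 0))"
    by (rule ty_Pair[OF P1 v1]) (use ty_Refl[OF A1 v1] in \<open>simp add: db\<close>)
  from ty_J[OF C _ a b p] ty_Refl[OF ty_Sig[OF A1 P1] this]
  show ?thesis by (auto simp add: db P_def)
qed

text \<open>
  By large elimination a family over points and paths is a family over the singleton at \<open>a\<close>, along
  whose contraction it is transported.
\<close>

lemma based_path_induction:
  assumes A: "\<Gamma> \<turnstile> A \<Ztypecolon> Univ i" and a: "\<Gamma> \<turnstile> a \<Ztypecolon> A" and b: "\<Gamma> \<turnstile> b \<Ztypecolon> A" and p: "\<Gamma> \<turnstile> p \<Ztypecolon> Eq A a b"
    and C: "Eq (wk 1 A) (wk 1 a) (Var 0) # A # \<Gamma> \<turnstile> C \<Ztypecolon> Univ j"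
    and u: "\<Gamma> \<turnstile> u \<Ztypecolon> inst 0 [Refl a, a] C"
  shows "\<exists>v. \<Gamma> \<turnstile> v \<Ztypecolon> inst 0 [p, b] C"
proof -
  let ?P = "Eq (wk 1 A) (wk 1 a) (Var 0)"
  have P: "A # \<Gamma> \<turnstile> ?P \<Ztypecolon> Univ i" by (rule tyI A a | simp add: db; fail)+
  have S: "\<Gamma> \<turnstile> Sig A ?P \<Ztypecolon> Univ i" by (rule ty_Sig[OF A P])
  have wfS: "wf_ctx (Sig A ?P # \<Gamma>)" using S by (rule ctx_ext)
  have Pair: "\<Gamma> \<turnstile> Pair A ?P x q \<Ztypecolon> Sig A ?P" if "\<Gamma> \<turnstile> x \<Ztypecolon> A" "\<Gamma> \<turnstile> q \<Ztypecolon> Eq A a x" for x q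
    by (rule ty_Pair[OF P]) (use that in \<open>simp_all add: db\<close>)
  have beta: "\<Gamma> \<turnstile> SigInd (Univ j) C (Pair A ?P x q) \<doteq> inst 0 [q, x] C \<Ztypecolon> Univ j"
    if "\<Gamma> \<turnstile> x \<Ztypecolon> A" "\<Gamma> \<turnstile> q \<Ztypecolon> Eq A a x" for x q
    using beta_Sig[where C = "Univ j" and g = C and a = x and b = q, OF ty_univ[OF wfS]] C that by
        (simp add: db)
  \<comment> \<open>The family over the singleton: a type computed by recursion from the pair
    \<open>Var 0\<close>, which at a literal pair reduces to \<open>C\<close> by
    \<open>beta\<close>.\<close>
  let ?C = "SigInd (Univ j) (ren (up_ren (up_ren Suc)) C) (Var 0)"
  have A1: "Sig A ?P # \<Gamma> \<turnstile> wk 1 A \<Ztypecolon> Univ i" by (rule tyI A S | simp add: db; fail)+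
  have P1: "wk 1 A # Sig A ?P # \<Gamma> \<turnstile> Eq (wk 2 A) (wk 2 a) (Var 0) \<Ztypecolon> Univ i"
      by (rule tyI A1 A a | simp add: db; fail)+
  have wf: "wf_ctx (Eq (wk 2 A) (wk 2 a) (Var 0) # wk 1 A # Sig A ?P # \<Gamma>)"
    using P1 by (rule ctx_ext)
  have C1: "Eq (wk 2 A) (wk 2 a) (Var 0) # wk 1 A # Sig A ?P # \<Gamma> \<turnstile> ren (up_ren (up_ren Suc)) C
      \<Ztypecolon> Univ j"
    using ren_has_type[OF C wf, of "up_ren (up_ren Suc)"]
    by (auto simp: db nth_Cons split: nat.splits)
  have "wf_ctx (Sig (wk 1 A) (Eq (wk 2 A) (wk 2 a) (Var 0)) # Sig A ?P # \<Gamma>)"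
    by (rule ctx_ext[OF ty_Sig[OF A1 P1]])
  from ty_SigInd[where p = "Var 0", OF ty_univ[OF this, of j]] C1 ty_var[OF wfS, of 0]
  have C2: "Sig A ?P # \<Gamma> \<turnstile> ?C \<Ztypecolon> Univ j" by (simp add: db)
  \<comment> \<open>Conversion moves \<open>u\<close> into this family over the center; after the
    transport, conversion at the other pair leads back to \<open>C\<close>.\<close>
  have "\<Gamma> \<turnstile> u \<Ztypecolon> SigInd (Univ j) C (Pair A ?P a (Refl a))"
    by (rule ty_conv[OF u eq_sym[OF beta[OF a ty_Refl[OF A a]]]])
  moreover obtain q where "\<Gamma> \<turnstile> q \<Ztypecolon> Eq (Sig A ?P) (Pair A ?P a (Refl a)) (Pair A ?P b p)"
    using singleton_Eq[OF A a b p] by blast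
  moreover have "inst 0 [z] ?C = SigInd (Univ j) C z" for z by (simp add: db)
  ultimately obtain v where "\<Gamma> \<turnstile> v \<Ztypecolon> SigInd (Univ j) C (Pair A ?P b p)"
    using transport[OF S C2 Pair[OF a ty_Refl[OF A a]] Pair[OF b p]] by metis
  from ty_conv[OF this beta[OF b p]] show ?thesis by blast
qed

section \<open>Dependent sums and propositions\<close>

text \<open>New variables are inserted beneath the innermost one, which keeps families weakenable
  without losing their argument. Well-formedness of the context of \<open>b\<close> yields the
  universe of \<open>A\<close>.\<close>

lemma weaken_under:
  assumes b: "A # \<Gamma> \<turnstile> b \<Ztypecolon> B" and wf: "wf_ctx (\<Delta> @ \<Gamma>)" and k: "k = length \<Delta>"
  shows "wk k A # \<Delta> @ \<Gamma> \<turnstile> ren (up_ren (\<lambda>n. n + k)) b \<Ztypecolon> ren (up_ren (\<lambda>n. n + k)) B"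
proof (rule ren_has_type[OF b])
  obtain i where "\<Gamma> \<turnstile> A \<Ztypecolon> Univ i" using wf_ctx_Cons[OF has_type_wf_ctx[OF b]] by blast
  from weaken_append[OF this wf] show "wf_ctx (wk k A # \<Delta> @ \<Gamma>)"
    unfolding k by (intro ctx_ext) (simp add: db)
qed (auto simp: db k nth_Cons nth_append add.assoc split: nat.splits)

lemmas weaken_under1 = weaken_under[where \<Delta> = "[D]" and k = 1 for D, simplified]
lemmas weaken_under2 = weaken_under[where \<Delta> = "[E, D]" and k = 2 for D E, simplified]

text \<open>Only \<open>ty_Sig\<close>, \<open>ty_conv\<close> and \<open>ty_cumul\<close> can
  conclude a typing of a term of the form \<open>Sig A B\<close>, and the last two keep the subject,
  so their induction hypotheses already give the claim.\<close>

lemma Sig_formationD: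
  assumes "\<Gamma> \<turnstile> Sig A B \<Ztypecolon> T"
  shows "\<exists>i. \<Gamma> \<turnstile> A \<Ztypecolon> Univ i \<and> A # \<Gamma> \<turnstile> B \<Ztypecolon> Univ i"
proof -
  have "wf_ctx \<Gamma> \<Longrightarrow> True"
    and "\<Gamma> \<turnstile> t \<Ztypecolon> T \<Longrightarrow> \<forall>A B. t = Sig A B \<longrightarrow> (\<exists>i. \<Gamma> \<turnstile> A \<Ztypecolon> Univ i \<and> A # \<Gamma> \<turnstile> B \<Ztypecolon> Univ i)"
    and "\<Gamma> \<turnstile> t \<doteq> u \<Ztypecolon> T \<Longrightarrow> True" for t u
    by (induction \<Gamma> and \<Gamma> t T and \<Gamma> t u T rule: wf_ctx_has_type_def_eq.inducts) auto
  with assms show ?thesis by blast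
qed

section \<open>Projections from dependent sums\<close>

definition Fst :: "tm \<Rightarrow> tm \<Rightarrow> tm" where
  "Fst A z = SigInd (wk 1 A) (Var 1) z"

lemma Fst_ren [simp]: "ren \<rho> (Fst A z) = Fst (ren \<rho> A) (ren \<rho> z)"
  and Fst_subst [simp]: "subst \<sigma> (Fst A z) = Fst (subst \<sigma> A) (subst \<sigma> z)"
  by (simp_all add: Fst_def db)

lemma ty_Fst:
  assumes A: "\<Gamma> \<turnstile> A \<Ztypecolon> Univ i" and B: "A # \<Gamma> \<turnstile> B \<Ztypecolon> Univ i" and z: "\<Gamma> \<turnstile> z \<Ztypecolon> Sig A B"
  shows "\<Gamma> \<turnstile> Fst A z \<Ztypecolon> A"
proof -
  have "Sig A B # \<Gamma> \<turnstile> wk 1 A \<Ztypecolon> Univ i" by (rule tyI ty_Sig A B | simp add: db; fail)+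
  moreover have "B # A # \<Gamma> \<turnstile> Var 1 \<Ztypecolon> wk 2 A" by (rule tyI A B | simp add: db; fail)+
  ultimately show ?thesis
    using ty_SigInd[of A B \<Gamma> "wk 1 A" i "Var 1" z] z by (simp add: Fst_def db)
qed

lemma beta_Fst:
  assumes A: "\<Gamma> \<turnstile> A \<Ztypecolon> Univ i" and B: "A # \<Gamma> \<turnstile> B \<Ztypecolon> Univ i" and a: "\<Gamma> \<turnstile> a \<Ztypecolon> A"
    and b: "\<Gamma> \<turnstile> b \<Ztypecolon> inst 0 [a] B"
  shows "\<Gamma> \<turnstile> Fst A (Pair A B a b) \<doteq> a \<Ztypecolon> A"
proof -
  have "Sig A B # \<Gamma> \<turnstile> wk 1 A \<Ztypecolon> Univ i" by (rule tyI ty_Sig A B | simp add: db; fail)+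
  moreover have "B # A # \<Gamma> \<turnstile> Var 1 \<Ztypecolon> wk 2 A" by (rule tyI A B | simp add: db; fail)+
  ultimately show ?thesis
    using beta_Sig[of A B \<Gamma> "wk 1 A" i "Var 1" a b] a b by (simp add: Fst_def db)
qed

lemma Snd_exists:
  assumes A: "\<Gamma> \<turnstile> A \<Ztypecolon> Univ i" and B: "A # \<Gamma> \<turnstile> B \<Ztypecolon> Univ i" and z: "\<Gamma> \<turnstile> z \<Ztypecolon> Sig A B"
  shows "\<exists>b. \<Gamma> \<turnstile> b \<Ztypecolon> inst 0 [Fst A z] B"
proof -
  let ?C = "inst 1 [Fst (wk 1 A) (Var 0)] B"
  have wfS: "wf_ctx (Sig A B # \<Gamma>)" by (rule ctx_ext[OF ty_Sig[OF A B]])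
  have A1: "Sig A B # \<Gamma> \<turnstile> wk 1 A \<Ztypecolon> Univ i" by (rule tyI A wfS | simp add: db; fail)+
  have B1: "wk 1 A # Sig A B # \<Gamma> \<turnstile> ren (up_ren Suc) B \<Ztypecolon> Univ i"
    using weaken_under1[OF B wfS] by (simp add: db)
  have "Sig A B # \<Gamma> \<turnstile> Fst (wk 1 A) (Var 0) \<Ztypecolon> wk 1 A"
    by (rule ty_Fst[OF A1 B1]) (rule ty_var_eq[OF wfS]; simp add: db)
  from inst_has_type[OF B1 this] have C: "Sig A B # \<Gamma> \<turnstile> ?C \<Ztypecolon> Univ i" by (simp add: db)
  have wf2: "wf_ctx (B # A # \<Gamma>)" using B by (rule ctx_ext)
  let ?B = "ren (up_ren (\<lambda>n. n + 2)) B"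
  have A2: "B # A # \<Gamma> \<turnstile> wk 2 A \<Ztypecolon> Univ i" by (rule tyI A wf2 | simp add: db; fail)+
  have B2: "wk 2 A # B # A # \<Gamma> \<turnstile> ?B \<Ztypecolon> Univ i" using weaken_under2[OF B wf2] by (simp add: db)
  have v: "B # A # \<Gamma> \<turnstile> Var 1 \<Ztypecolon> wk 2 A" "B # A # \<Gamma> \<turnstile> Var 0 \<Ztypecolon> inst 0 [Var 1] ?B"
    by (rule ty_var_eq[OF wf2]; simp add: db)+
  \<comment> \<open>The branch must inhabit \<open>B\<close> at the first projection of the generic
    pair, whereas \<open>Var 0\<close> inhabits \<open>B\<close> at \<open>Var 1\<close>. The two
    types are definitionally equal by \<open>beta_Fst\<close>.\<close>
  have "B # A # \<Gamma> \<turnstile> Var 0 \<Ztypecolon> inst 0 [Fst (wk 2 A) (Pair (wk 2 A) ?B (Var 1) (Var 0))] ?B"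
    by (rule ty_conv[OF v(2) inst_cong_type[OF B2 v(1) ty_Fst[OF A2 B2 ty_Pair[OF B2 v]] eq_sym[OF
        beta_Fst[OF A2 B2 v]]]])
  then have "\<Gamma> \<turnstile> SigInd ?C (Var 0) z \<Ztypecolon> inst 0 [z] ?C"
    by (intro ty_SigInd[OF C _ z]) (simp add: db)
  then show ?thesis by (auto simp: db)
qed

text \<open>The elimination used when only inhabitation matters: components are produced, but
  \<open>z\<close> is not claimed to equal their pair. The formation of the second type is returned
  so that nested sums can be taken apart further.\<close>

lemma Sig_obtain:
  assumes S: "\<Gamma> \<turnstile> Sig A B \<Ztypecolon> T" and z: "\<Gamma> \<turnstile> z \<Ztypecolon> Sig A B"
  obtains a b i where "\<Gamma> \<turnstile> a \<Ztypecolon> A" "\<Gamma> \<turnstile> b \<Ztypecolon> inst 0 [a] B" "\<Gamma> \<turnstile> inst 0 [a] B \<Ztypecolon> Univ i"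
proof -
  obtain i where AB: "\<Gamma> \<turnstile> A \<Ztypecolon> Univ i" "A # \<Gamma> \<turnstile> B \<Ztypecolon> Univ i" using Sig_formationD[OF S] by blast
  then have "\<Gamma> \<turnstile> inst 0 [Fst A z] B \<Ztypecolon> Univ i"
      using inst_has_type[OF _ ty_Fst[OF _ _ z]] by (fastforce simp: db)
  with AB show thesis using that ty_Fst Snd_exists z by blast
qed

lemma Prod_obtain:
  assumes S: "\<Gamma> \<turnstile> Prod A B \<Ztypecolon> T" and z: "\<Gamma> \<turnstile> z \<Ztypecolon> Prod A B"
  obtains a b i where "\<Gamma> \<turnstile> a \<Ztypecolon> A" "\<Gamma> \<turnstile> b \<Ztypecolon> B" "\<Gamma> \<turnstile> B \<Ztypecolon> Univ i"
  using Sig_obtain[OF S[unfolded Prod_def] z[unfolded Prod_def]] by (auto simp: db)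

lemma IsPropD:
  assumes h: "\<Gamma> \<turnstile> h \<Ztypecolon> IsProp T" and a: "\<Gamma> \<turnstile> a \<Ztypecolon> T" and b: "\<Gamma> \<turnstile> b \<Ztypecolon> T"
  shows "\<Gamma> \<turnstile> App (App h a) b \<Ztypecolon> Eq T a b"
proof -
  have "\<Gamma> \<turnstile> App h a \<Ztypecolon> Pi T (Eq (wk 1 T) (wk 1 a) (Var 0))"
    using ty_App[OF h[unfolded IsProp_def] a] by (simp add: db)
  from ty_App[OF this b] show ?thesis by (simp add: db)
qed

lemma IsPropI:
  assumes "wk 1 T # T # \<Gamma> \<turnstile> t \<Ztypecolon> Eq (wk 2 T) (Var 1) (Var 0)"
  shows "\<exists>h. \<Gamma> \<turnstile> h \<Ztypecolon> IsProp T"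
  using ty_Lam[OF ty_Lam[OF assms]] by (auto simp: IsProp_def)

lemma conv_Eq:
  assumes "\<Gamma> \<turnstile> p \<Ztypecolon> Eq A a b" "\<Gamma> \<turnstile> A \<Ztypecolon> Univ i" "\<Gamma> \<turnstile> a \<doteq> a' \<Ztypecolon> A" "\<Gamma> \<turnstile> b \<doteq> b' \<Ztypecolon> A"
  shows "\<Gamma> \<turnstile> p \<Ztypecolon> Eq A a' b'"
  using ty_conv[OF assms(1) cong_Eq[OF eq_refl[OF assms(2)] assms(3,4)]] .

section \<open>Split surjections\<close>

text \<open>A map with a pointwise section exhibits \<open>V\<close> as a retract of
  \<open>U\<close>. Being a type of the object theory, it can itself be transported along
  paths.\<close>

definition SplitSurj :: "tm \<Rightarrow> tm \<Rightarrow> tm" where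
  "SplitSurj U V = Sig (Arrow U V) (Pi (wk 1 V) (Sig (wk 2 U) (Eq (wk 3 V) (App (Var 2) (Var 0))
      (Var 1))))"

lemma SplitSurj_ren [simp]: "ren \<rho> (SplitSurj U V) = SplitSurj (ren \<rho> U) (ren \<rho> V)"
  and SplitSurj_subst [simp]: "subst \<sigma> (SplitSurj U V) = SplitSurj (subst \<sigma> U) (subst \<sigma> V)"
  by (simp_all add: SplitSurj_def db)

lemma ty_SplitSurj:
  assumes U: "\<Gamma> \<turnstile> U \<Ztypecolon> Univ i" and V: "\<Gamma> \<turnstile> V \<Ztypecolon> Univ i"
  shows "Arrow U V # \<Gamma> \<turnstile> Pi (wk 1 V) (Sig (wk 2 U) (Eq (wk 3 V) (App (Var 2) (Var 0)) (Var 1)))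
      \<Ztypecolon> Univ i"
    and "\<Gamma> \<turnstile> SplitSurj U V \<Ztypecolon> Univ i"
proof -
  show 1: "Arrow U V # \<Gamma> \<turnstile> Pi (wk 1 V) (Sig (wk 2 U) (Eq (wk 3 V) (App (Var 2) (Var 0)) (Var 1)))
      \<Ztypecolon> Univ i"
    by (rule tyI ty_Pi ty_Sig U V ty_App_Arrow[where A = "wk 3 U"] | simp add: db; fail)+
  show "\<Gamma> \<turnstile> SplitSurj U V \<Ztypecolon> Univ i"
    unfolding SplitSurj_def by (intro ty_Sig ty_Arrow U V 1)
qed

lemma SplitSurjI:
  assumes U: "\<Gamma> \<turnstile> U \<Ztypecolon> Univ i" and V: "\<Gamma> \<turnstile> V \<Ztypecolon> Univ i" and f: "\<Gamma> \<turnstile> f \<Ztypecolon> Arrow U V"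
    and u: "V # \<Gamma> \<turnstile> u \<Ztypecolon> wk 1 U" and e: "V # \<Gamma> \<turnstile> e \<Ztypecolon> Eq (wk 1 V) (App (wk 1 f) u) (Var 0)"
  shows "\<exists>t. \<Gamma> \<turnstile> t \<Ztypecolon> SplitSurj U V"
proof -
  have B: "wk 1 U # V # \<Gamma> \<turnstile> Eq (wk 2 V) (App (wk 2 f) (Var 0)) (Var 1) \<Ztypecolon> Univ i"
    by (rule tyI U V f ty_App_Arrow[where A = "wk 2 U"] | simp add: db; fail)+
  have "V # \<Gamma> \<turnstile> Pair (wk 1 U) (Eq (wk 2 V) (App (wk 2 f) (Var 0)) (Var 1)) u e \<Ztypecolon>
     Sig (wk 1 U) (Eq (wk 2 V) (App (wk 2 f) (Var 0)) (Var 1))"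
    by (rule ty_Pair[OF B u]) (use e in \<open>simp add: db\<close>)
  from ty_Pair[OF ty_SplitSurj(1)[OF U V] f, of "Lam V _"] ty_Lam[OF this]
  show ?thesis by (auto simp: SplitSurj_def db)
qed

lemma SplitSurj_obtain:
  assumes U: "\<Gamma> \<turnstile> U \<Ztypecolon> Univ i" and V: "\<Gamma> \<turnstile> V \<Ztypecolon> Univ i" and t: "\<Gamma> \<turnstile> t \<Ztypecolon> SplitSurj U V"
  obtains f h where "\<Gamma> \<turnstile> f \<Ztypecolon> Arrow U V"
    "\<Gamma> \<turnstile> h \<Ztypecolon> Pi V (Sig (wk 1 U) (Eq (wk 2 V) (App (wk 2 f) (Var 0)) (Var 1)))"
  using Sig_obtain[OF ty_SplitSurj(2)[OF U V, unfolded SplitSurj_def] t[unfolded SplitSurj_def]]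
  by (simp add: db) blast

lemma SplitSurj_section:
  assumes U: "\<Gamma> \<turnstile> U \<Ztypecolon> Univ i" and V: "\<Gamma> \<turnstile> V \<Ztypecolon> Univ i" and f: "\<Gamma> \<turnstile> f \<Ztypecolon> Arrow U V"
    and h: "\<Gamma> \<turnstile> h \<Ztypecolon> Pi V (Sig (wk 1 U) (Eq (wk 2 V) (App (wk 2 f) (Var 0)) (Var 1)))"
    and v: "\<Gamma> \<turnstile> v \<Ztypecolon> V"
  obtains u e where "\<Gamma> \<turnstile> u \<Ztypecolon> U" "\<Gamma> \<turnstile> e \<Ztypecolon> Eq V (App f u) v"
proof -
  have "\<Gamma> \<turnstile> App h v \<Ztypecolon> Sig U (Eq (wk 1 V) (App (wk 1 f) (Var 0)) (wk 1 v))"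
    using ty_App[OF h v] by (simp add: db)
  moreover have "\<Gamma> \<turnstile> Sig U (Eq (wk 1 V) (App (wk 1 f) (Var 0)) (wk 1 v)) \<Ztypecolon> Univ i"
    by (rule tyI ty_Sig U V f v ty_App_Arrow[where A = "wk 1 U"] | simp add: db; fail)+
  ultimately obtain u e where "\<Gamma> \<turnstile> u \<Ztypecolon> U" "\<Gamma> \<turnstile> e
      \<Ztypecolon> inst 0 [u] (Eq (wk 1 V) (App (wk 1 f) (Var 0)) (wk 1 v))"
    using Sig_obtain by blast
  then show thesis using that by (simp add: db)
qed

lemma SplitSurj_refl:
  assumes U: "\<Gamma> \<turnstile> U \<Ztypecolon> Univ i"
  shows "\<exists>t. \<Gamma> \<turnstile> t \<Ztypecolon> SplitSurj U U"
proof (rule SplitSurjI[OF U U])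
  show "\<Gamma> \<turnstile> Lam U (Var 0) \<Ztypecolon> Arrow U U"
    unfolding Arrow_def by (rule tyI ty_Lam U | simp add: db; fail)+
  show v: "U # \<Gamma> \<turnstile> Var 0 \<Ztypecolon> wk 1 U" by (rule tyI U | simp add: db; fail)+
  have U1: "U # \<Gamma> \<turnstile> wk 1 U \<Ztypecolon> Univ i" by (rule tyI U | simp add: db; fail)+
  have "wk 1 U # U # \<Gamma> \<turnstile> Var 0 \<Ztypecolon> wk 2 U" by (rule tyI U | simp add: db; fail)+
  from beta_Pi[OF this v] have "U # \<Gamma> \<turnstile> App (wk 1 (Lam U (Var 0))) (Var 0) \<doteq> Var 0 \<Ztypecolon> wk 1 U"
    by (simp add: db)
  from conv_Eq[OF ty_Refl[OF U1 v] U1 eq_sym[OF this] eq_refl[OF v]]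
  show "U # \<Gamma> \<turnstile> Refl (Var 0) \<Ztypecolon> Eq (wk 1 U) (App (wk 1 (Lam U (Var 0))) (Var 0)) (Var 0)" .
qed

text \<open>The identity on a = c, as a split surjection, is transported along \<open>p\<close> in
  the family of split surjections from a = c to x = c. No inverse or composite of paths has to be
  computed.\<close>

lemma SplitSurj_Eq:
  assumes A: "\<Gamma> \<turnstile> A \<Ztypecolon> Univ i" and a: "\<Gamma> \<turnstile> a \<Ztypecolon> A" and b: "\<Gamma> \<turnstile> b \<Ztypecolon> A" and c: "\<Gamma> \<turnstile> c \<Ztypecolon> A"
    and p: "\<Gamma> \<turnstile> p \<Ztypecolon> Eq A a b"
  shows "\<exists>t. \<Gamma> \<turnstile> t \<Ztypecolon> SplitSurj (Eq A a c) (Eq A b c)"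
proof -
  have B: "A # \<Gamma> \<turnstile> SplitSurj (Eq (wk 1 A) (wk 1 a) (wk 1 c)) (Eq (wk 1 A) (Var 0) (wk 1 c))
      \<Ztypecolon> Univ i"
    by (rule tyI ty_SplitSurj A a c | simp add: db; fail)+
  obtain t where "\<Gamma> \<turnstile> t \<Ztypecolon> SplitSurj (Eq A a c) (Eq A a c)"
    using SplitSurj_refl[OF ty_Eq[OF A a c]] by blast
  then show ?thesis using transport[OF A B a b p, of t] by (simp add: db)
qed

text \<open>Two generic points of \<open>V\<close> are f x and f y for some x and y in
  \<open>U\<close>; since x = y, also f x = f y.\<close>

lemma SplitSurj_IsProp:
  assumes U: "\<Gamma> \<turnstile> U \<Ztypecolon> Univ i" and V: "\<Gamma> \<turnstile> V \<Ztypecolon> Univ i" and t: "\<Gamma> \<turnstile> t \<Ztypecolon> SplitSurj U V"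
    and h: "\<Gamma> \<turnstile> h \<Ztypecolon> IsProp U"
  shows "\<exists>k. \<Gamma> \<turnstile> k \<Ztypecolon> IsProp V"
proof -
  let ?\<Delta> = "wk 1 V # V # \<Gamma>"
  have wf: "wf_ctx ?\<Delta>" by (rule tyI V | simp add: db; fail)+
  have U2: "?\<Delta> \<turnstile> wk 2 U \<Ztypecolon> Univ i" and V2: "?\<Delta> \<turnstile> wk 2 V \<Ztypecolon> Univ i"
    and t2: "?\<Delta> \<turnstile> wk 2 t \<Ztypecolon> SplitSurj (wk 2 U) (wk 2 V)" and h2: "?\<Delta> \<turnstile> wk 2 h \<Ztypecolon> IsProp (wk 2 U)"
    and v: "?\<Delta> \<turnstile> Var 1 \<Ztypecolon> wk 2 V" "?\<Delta> \<turnstile> Var 0 \<Ztypecolon> wk 2 V"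
    by (rule tyI U V t h wf | simp add: db; fail)+
  obtain f s where f: "?\<Delta> \<turnstile> f \<Ztypecolon> Arrow (wk 2 U) (wk 2 V)"
    and s: "?\<Delta> \<turnstile> s \<Ztypecolon> Pi (wk 2 V) (Sig (wk 1 (wk 2 U)) (Eq (wk 2 (wk 2 V)) (App (wk 2 f) (Var 0))
        (Var 1)))"
    using SplitSurj_obtain[OF U2 V2 t2] .
  obtain x e where x: "?\<Delta> \<turnstile> x \<Ztypecolon> wk 2 U" and e: "?\<Delta> \<turnstile> e \<Ztypecolon> Eq (wk 2 V) (App f x) (Var 1)"
    using SplitSurj_section[OF U2 V2 f s v(1)] .
  obtain y d where y: "?\<Delta> \<turnstile> y \<Ztypecolon> wk 2 U" and d: "?\<Delta> \<turnstile> d \<Ztypecolon> Eq (wk 2 V) (App f y) (Var 0)"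
    using SplitSurj_section[OF U2 V2 f s v(2)] .
  note fx = ty_App_Arrow[OF f x] and fy = ty_App_Arrow[OF f y]
  obtain q where q: "?\<Delta> \<turnstile> q \<Ztypecolon> Eq (wk 2 V) (App f x) (App f y)"
    using Eq_ap_App[OF U2 V2 f x y IsPropD[OF h2 x y]] by blast
  show ?thesis
    using Eq_sym[OF V2 fx v(1) e] Eq_trans[OF V2 fx fy v(2) q d] Eq_trans[OF V2 v(1) fx v(2)]
        IsPropI
    by blast
qed

section \<open>Fixed points of weakly constant maps\<close>

abbreviation FixEq :: "tm \<Rightarrow> tm \<Rightarrow> tm" where
  "FixEq T g \<equiv> Eq (wk 1 T) (App (wk 1 g) (Var 0)) (Var 0)"

abbreviation FixPt :: "tm \<Rightarrow> tm \<Rightarrow> tm" where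
  "FixPt T g \<equiv> Sig T (FixEq T g)"

lemma ty_FixPt:
  assumes T: "\<Gamma> \<turnstile> T \<Ztypecolon> Univ i" and g: "\<Gamma> \<turnstile> g \<Ztypecolon> Arrow T T"
  shows "T # \<Gamma> \<turnstile> FixEq T g \<Ztypecolon> Univ i" and "\<Gamma> \<turnstile> FixPt T g \<Ztypecolon> Univ i"
proof -
  show 1: "T # \<Gamma> \<turnstile> FixEq T g \<Ztypecolon> Univ i"
    by (rule tyI T g ty_App_Arrow[where A = "wk 1 T"] | simp add: db; fail)+
  show "\<Gamma> \<turnstile> FixPt T g \<Ztypecolon> Univ i" by (rule ty_Sig[OF T 1])
qed

lemma ty_Pair_FixPt:
  assumes T: "\<Gamma> \<turnstile> T \<Ztypecolon> Univ i" and g: "\<Gamma> \<turnstile> g \<Ztypecolon> Arrow T T" and t: "\<Gamma> \<turnstile> t \<Ztypecolon> T"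
    and p: "\<Gamma> \<turnstile> p \<Ztypecolon> Eq T (App g t) t"
  shows "\<Gamma> \<turnstile> Pair T (FixEq T g) t p \<Ztypecolon> FixPt T g"
  by (rule ty_Pair[OF ty_FixPt(1)[OF T g] t]) (use p in \<open>simp add: db\<close>)

lemma WeaklyConstantD:
  assumes h: "\<Gamma> \<turnstile> h \<Ztypecolon> WeaklyConstant T g" and a: "\<Gamma> \<turnstile> a \<Ztypecolon> T" and b: "\<Gamma> \<turnstile> b \<Ztypecolon> T"
  shows "\<Gamma> \<turnstile> App (App h a) b \<Ztypecolon> Eq T (App g a) (App g b)"
proof -
  have "\<Gamma> \<turnstile> App h a \<Ztypecolon> Pi T (Eq (wk 1 T) (wk 1 (App g a)) (App (wk 1 g) (Var 0)))"
    using ty_App[OF h[unfolded WeaklyConstant_def] a] by (simp add: db)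
  from ty_App[OF this b] show ?thesis by (simp add: db)
qed

text \<open>
  If \<open>G\<close> maps paths \<open>a = x\<close> to fixed-point proofs \<open>g x = x\<close>, it maps the singleton at \<open>a\<close>, hence its
  center, into the fixed points.  For weakly constant \<open>g\<close> one takes \<open>a = g t\<close> and, pointwise in \<open>x\<close>,
  for \<open>G\<close> the composition with \<open>g t = g x\<close>, which is a split surjection; so the fixed points are a
  retract of a singleton.
\<close>

abbreviation FixCenter :: "tm \<Rightarrow> tm \<Rightarrow> tm \<Rightarrow> tm \<Rightarrow> tm" where
  "FixCenter T g a G \<equiv> Pair T (FixEq T g) a (App (inst 0 [a] G) (Refl a))"

text \<open>Based path induction on \<open>q\<close>: at \<open>Refl a\<close> the right-hand pair
  is the center. The first claim is the typing of the pairs being compared.\<close>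

lemma FixPt_path:
  assumes T: "\<Gamma> \<turnstile> T \<Ztypecolon> Univ i" and g: "\<Gamma> \<turnstile> g \<Ztypecolon> Arrow T T" and a: "\<Gamma> \<turnstile> a \<Ztypecolon> T"
    and G: "T # \<Gamma> \<turnstile> G \<Ztypecolon> Arrow (Eq (wk 1 T) (wk 1 a) (Var 0)) (FixEq T g)"
  shows "\<Gamma> \<turnstile> x \<Ztypecolon> T \<Longrightarrow> \<Gamma> \<turnstile> q \<Ztypecolon> Eq T a x \<Longrightarrow> \<Gamma> \<turnstile> Pair T (FixEq T g) x (App (inst 0 [x] G) q) \<Ztypecolon> FixPt T g"
    and "\<Gamma> \<turnstile> x \<Ztypecolon> T \<Longrightarrow> \<Gamma> \<turnstile> q \<Ztypecolon> Eq T a x \<Longrightarrow>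
    \<exists>t. \<Gamma> \<turnstile> t \<Ztypecolon> Eq (FixPt T g) (FixCenter T g a G) (Pair T (FixEq T g) x (App (inst 0 [x] G) q))"
proof -
  show pair: "\<Gamma> \<turnstile> Pair T (FixEq T g) x (App (inst 0 [x] G) q) \<Ztypecolon> FixPt T g"
    if x: "\<Gamma> \<turnstile> x \<Ztypecolon> T" and q: "\<Gamma> \<turnstile> q \<Ztypecolon> Eq T a x" for x q
  proof (rule ty_Pair_FixPt[OF T g x])
    have "\<Gamma> \<turnstile> inst 0 [x] G \<Ztypecolon> Arrow (Eq T a x) (Eq T (App g x) x)"
      using inst_has_type[OF G x] by (simp add: db)
    then show "\<Gamma> \<turnstile> App (inst 0 [x] G) q \<Ztypecolon> Eq T (App g x) x" using q by (rule ty_App_Arrow)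
  qed
  let ?ctr = "FixCenter T g a G"
  have ctr: "\<Gamma> \<turnstile> ?ctr \<Ztypecolon> FixPt T g" by (rule pair[OF a ty_Refl[OF T a]])
  let ?\<Delta> = "Eq (wk 1 T) (wk 1 a) (Var 0) # T # \<Gamma>"
  have wf: "wf_ctx ?\<Delta>" by (rule tyI T a | simp add: db; fail)+
  have T2: "?\<Delta> \<turnstile> wk 2 T \<Ztypecolon> Univ i" and g2: "?\<Delta> \<turnstile> wk 2 g \<Ztypecolon> Arrow (wk 2 T) (wk 2 T)"
    and G1: "?\<Delta> \<turnstile> wk 1 G \<Ztypecolon> Arrow (Eq (wk 2 T) (wk 2 a) (Var 1)) (Eq (wk 2 T) (App (wk 2 g) (Var
        1)) (Var 1))"
    and ctr2: "?\<Delta> \<turnstile> wk 2 ?ctr \<Ztypecolon> FixPt (wk 2 T) (wk 2 g)"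
    and v: "?\<Delta> \<turnstile> Var 1 \<Ztypecolon> wk 2 T" "?\<Delta> \<turnstile> Var 0 \<Ztypecolon> Eq (wk 2 T) (wk 2 a) (Var 1)"
    by (rule tyI T a wf g G ctr | simp add: db; fail)+
  have C: "?\<Delta> \<turnstile> Eq (FixPt (wk 2 T) (wk 2 g)) (wk 2 ?ctr)
      (Pair (wk 2 T) (FixEq (wk 2 T) (wk 2 g)) (Var 1) (App (wk 1 G) (Var 0))) \<Ztypecolon> Univ i"
    by (rule ty_Eq ty_FixPt T2 g2 ctr2 ty_Pair_FixPt v ty_App_Arrow[OF G1])+
  show "\<exists>t. \<Gamma> \<turnstile> t \<Ztypecolon> Eq (FixPt T g) ?ctr (Pair T (FixEq T g) x (App (inst 0 [x] G) q))"
    if x: "\<Gamma> \<turnstile> x \<Ztypecolon> T" and q: "\<Gamma> \<turnstile> q \<Ztypecolon> Eq T a x" for x q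
    using based_path_induction[OF T a x q C, of "Refl ?ctr"] ty_Refl[OF ty_FixPt(2)[OF T g] ctr]
    by (simp add: db)
qed

text \<open>The section provides a path \<open>m\<close> from a to t that \<open>G\<close> sends to
  a path equal to \<open>p\<close>. The center equals the pair built from \<open>m\<close> by
  \<open>FixPt_path\<close>, and that pair equals (t, p) by applying pairing with t to this
  equality.\<close>

lemma FixPt_center_Pair:
  assumes T: "\<Gamma> \<turnstile> T \<Ztypecolon> Univ i" and g: "\<Gamma> \<turnstile> g \<Ztypecolon> Arrow T T" and a: "\<Gamma> \<turnstile> a \<Ztypecolon> T"
    and G: "T # \<Gamma> \<turnstile> G \<Ztypecolon> Arrow (Eq (wk 1 T) (wk 1 a) (Var 0)) (FixEq T g)"
    and h: "T # \<Gamma> \<turnstile> h \<Ztypecolon> Pi (FixEq T g) (Sig (wk 1 (Eq (wk 1 T) (wk 1 a) (Var 0)))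
              (Eq (wk 2 (FixEq T g)) (App (wk 2 G) (Var 0)) (Var 1)))"
    and t: "\<Gamma> \<turnstile> t \<Ztypecolon> T" and p: "\<Gamma> \<turnstile> p \<Ztypecolon> Eq T (App g t) t"
  shows "\<exists>e. \<Gamma> \<turnstile> e \<Ztypecolon> Eq (FixPt T g) (FixCenter T g a G) (Pair T (FixEq T g) t p)"
proof -
  let ?V = "Eq T (App g t) t"
  have U: "\<Gamma> \<turnstile> Eq T a t \<Ztypecolon> Univ i" and V: "\<Gamma> \<turnstile> ?V \<Ztypecolon> Univ i"
    by (intro ty_Eq T a t ty_App_Arrow[OF g])+
  have Gt: "\<Gamma> \<turnstile> inst 0 [t] G \<Ztypecolon> Arrow (Eq T a t) ?V"
    using inst_has_type[OF G t] by (simp add: db)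
  have ht: "\<Gamma> \<turnstile> inst 0 [t] h \<Ztypecolon> Pi ?V (Sig (wk 1 (Eq T a t)) (Eq (wk 2 ?V) (App (wk 2 (inst 0 [t]
      G)) (Var 0)) (Var 1)))"
    using inst_has_type[OF h t] by (simp add: db)
  obtain m e where m: "\<Gamma> \<turnstile> m \<Ztypecolon> Eq T a t" and e: "\<Gamma> \<turnstile> e \<Ztypecolon> Eq ?V (App (inst 0 [t] G) m) p"
    using SplitSurj_section[OF U V Gt ht p] .
  have T1: "?V # \<Gamma> \<turnstile> wk 1 T \<Ztypecolon> Univ i" and g1: "?V # \<Gamma> \<turnstile> wk 1 g \<Ztypecolon> Arrow (wk 1 T) (wk 1 T)"
    and t1: "?V # \<Gamma> \<turnstile> wk 1 t \<Ztypecolon> wk 1 T"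
    and v: "?V # \<Gamma> \<turnstile> Var 0 \<Ztypecolon> Eq (wk 1 T) (App (wk 1 g) (wk 1 t)) (wk 1 t)"
    by (rule tyI T V g t | simp add: db; fail)+
  have F: "\<Gamma> \<turnstile> FixPt T g \<Ztypecolon> Univ i" by (rule ty_FixPt(2)[OF T g])
  have "?V # \<Gamma> \<turnstile> Pair (wk 1 T) (FixEq (wk 1 T) (wk 1 g)) (wk 1 t) (Var 0) \<Ztypecolon> wk 1 (FixPt T g)"
    using ty_Pair_FixPt[OF T1 g1 t1 v] by (simp add: db)
  from Eq_ap[OF V F this ty_App_Arrow[OF Gt m] p e]
  obtain q where q: "\<Gamma> \<turnstile> q \<Ztypecolon> Eq (FixPt T g) (Pair T (FixEq T g) t (App (inst 0 [t] G) m)) (Pair T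
      (FixEq T g) t p)"
    by (auto simp: db)
  obtain r where r: "\<Gamma> \<turnstile> r \<Ztypecolon> Eq (FixPt T g) (FixCenter T g a G) (Pair T (FixEq T g) t (App (inst 0
      [t] G) m))"
    using FixPt_path(2)[OF T g a G t m] by blast
  show ?thesis
    by (rule Eq_trans[OF F FixPt_path(1)[OF T g a G a ty_Refl[OF T a]] FixPt_path(1)[OF T g a G t
        m] ty_Pair_FixPt[OF T g t p] r q])
qed

text \<open>Without eta, \<open>z\<close> is not definitionally a pair; \<open>SigInd\<close>
  reduces the claim to the generic pair, in a context where all parameters are weakened by
  two.\<close>

lemma FixPt_center:
  assumes T: "\<Gamma> \<turnstile> T \<Ztypecolon> Univ i" and g: "\<Gamma> \<turnstile> g \<Ztypecolon> Arrow T T" and a: "\<Gamma> \<turnstile> a \<Ztypecolon> T"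
    and G: "T # \<Gamma> \<turnstile> G \<Ztypecolon> Arrow (Eq (wk 1 T) (wk 1 a) (Var 0)) (FixEq T g)"
    and h: "T # \<Gamma> \<turnstile> h \<Ztypecolon> Pi (FixEq T g) (Sig (wk 1 (Eq (wk 1 T) (wk 1 a) (Var 0)))
              (Eq (wk 2 (FixEq T g)) (App (wk 2 G) (Var 0)) (Var 1)))"
    and z: "\<Gamma> \<turnstile> z \<Ztypecolon> FixPt T g"
  shows "\<exists>e. \<Gamma> \<turnstile> e \<Ztypecolon> Eq (FixPt T g) (FixCenter T g a G) z"
proof -
  note F = ty_FixPt[OF T g]
  let ?ctr = "FixCenter T g a G"
  have ctr: "\<Gamma> \<turnstile> ?ctr \<Ztypecolon> FixPt T g" by (rule FixPt_path(1)[OF T g a G a ty_Refl[OF T a]])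
  have C: "FixPt T g # \<Gamma> \<turnstile> Eq (wk 1 (FixPt T g)) (wk 1 ?ctr) (Var 0) \<Ztypecolon> Univ i"
    by (rule tyI F(2) ctr | simp add: db; fail)+
  let ?\<Delta> = "FixEq T g # T # \<Gamma>" and ?u = "ren (up_ren (\<lambda>n. n + 2))"
  have wf: "wf_ctx ?\<Delta>" using F(1) by (rule ctx_ext)
  have T2: "?\<Delta> \<turnstile> wk 2 T \<Ztypecolon> Univ i" and g2: "?\<Delta> \<turnstile> wk 2 g \<Ztypecolon> Arrow (wk 2 T) (wk 2 T)"
    and a2: "?\<Delta> \<turnstile> wk 2 a \<Ztypecolon> wk 2 T"
    and v: "?\<Delta> \<turnstile> Var 1 \<Ztypecolon> wk 2 T" "?\<Delta> \<turnstile> Var 0 \<Ztypecolon> Eq (wk 2 T) (App (wk 2 g) (Var 1)) (Var 1)"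
    by (rule tyI T a wf g | simp add: db; fail)+
  have G2: "wk 2 T # ?\<Delta> \<turnstile> ?u G \<Ztypecolon> Arrow (Eq (wk 1 (wk 2 T)) (wk 1 (wk 2 a)) (Var 0)) (FixEq (wk 2
      T) (wk 2 g))"
    using weaken_under2[OF G wf] by (simp add: db)
  have h2: "wk 2 T # ?\<Delta> \<turnstile> ?u h \<Ztypecolon> Pi (FixEq (wk 2 T) (wk 2 g)) (Sig (wk 1 (Eq (wk 1 (wk 2 T)) (wk 1
      (wk 2 a)) (Var 0)))
              (Eq (wk 2 (FixEq (wk 2 T) (wk 2 g))) (App (wk 2 (?u G)) (Var 0)) (Var 1)))"
    using weaken_under2[OF h wf] by (simp add: db)
  obtain e where "?\<Delta> \<turnstile> e \<Ztypecolon> Eq (FixPt (wk 2 T) (wk 2 g)) (FixCenter (wk 2 T) (wk 2 g) (wk 2 a) (?u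
      G))
      (Pair (wk 2 T) (FixEq (wk 2 T) (wk 2 g)) (Var 1) (Var 0))"
    using FixPt_center_Pair[OF T2 g2 a2 G2 h2 v] by blast
  then have "\<Gamma> \<turnstile> SigInd (Eq (wk 1 (FixPt T g)) (wk 1 ?ctr) (Var 0)) e z
      \<Ztypecolon> inst 0 [z] (Eq (wk 1 (FixPt T g)) (wk 1 ?ctr) (Var 0))"
    by (intro ty_SigInd[OF C _ z]) (simp add: db)
  then show ?thesis by (auto simp: db)
qed

lemma FixPt_IsProp:
  assumes T: "\<Gamma> \<turnstile> T \<Ztypecolon> Univ i" and g: "\<Gamma> \<turnstile> g \<Ztypecolon> Arrow T T" and c: "\<Gamma> \<turnstile> c \<Ztypecolon> WeaklyConstant T g"
  shows "\<exists>k. \<Gamma> \<turnstile> k \<Ztypecolon> IsProp (FixPt T g)"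
proof -
  \<comment> \<open>Proved in every context, so that it can be applied to two fixed points that are
    variables.\<close>
  have path: "\<exists>e. \<Gamma> \<turnstile> e \<Ztypecolon> Eq (FixPt T g) z w"
    if T: "\<Gamma> \<turnstile> T \<Ztypecolon> Univ i" and g: "\<Gamma> \<turnstile> g \<Ztypecolon> Arrow T T" and c: "\<Gamma> \<turnstile> c \<Ztypecolon> WeaklyConstant T g"
      and z: "\<Gamma> \<turnstile> z \<Ztypecolon> FixPt T g" and w: "\<Gamma> \<turnstile> w \<Ztypecolon> FixPt T g" for \<Gamma> T g c z w
  proof -
    note F = ty_FixPt[OF T g]
    \<comment> \<open>The center needs a point of \<open>T\<close>. The fixed point \<open>z\<close>
      supplies one, so \<open>T\<close> itself is not assumed inhabited.\<close>
    let ?t = "Fst T z"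
    have t: "\<Gamma> \<turnstile> ?t \<Ztypecolon> T" by (rule ty_Fst[OF T F(1) z])
    have a: "\<Gamma> \<turnstile> App g ?t \<Ztypecolon> T" by (rule ty_App_Arrow[OF g t])
    have T1: "T # \<Gamma> \<turnstile> wk 1 T \<Ztypecolon> Univ i" and a1: "T # \<Gamma> \<turnstile> wk 1 (App g ?t) \<Ztypecolon> wk 1 T"
      and g1: "T # \<Gamma> \<turnstile> wk 1 g \<Ztypecolon> Arrow (wk 1 T) (wk 1 T)"
      and c1: "T # \<Gamma> \<turnstile> wk 1 c \<Ztypecolon> WeaklyConstant (wk 1 T) (wk 1 g)"
      and t1: "T # \<Gamma> \<turnstile> wk 1 ?t \<Ztypecolon> wk 1 T" and v: "T # \<Gamma> \<turnstile> Var 0 \<Ztypecolon> wk 1 T"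
      by (rule tyI T a g c t | simp add: db; fail)+
    have b1: "T # \<Gamma> \<turnstile> App (wk 1 g) (Var 0) \<Ztypecolon> wk 1 T" by (rule ty_App_Arrow[OF g1 v])
    \<comment> \<open>For the variable x, weak constancy gives g t = g x, which
      \<open>SplitSurj_Eq\<close> turns into a split surjection from g t = x onto g x = x.\<close>
    have "T # \<Gamma> \<turnstile> App (App (wk 1 c) (wk 1 ?t)) (Var 0)
        \<Ztypecolon> Eq (wk 1 T) (wk 1 (App g ?t)) (App (wk 1 g) (Var 0))"
      using WeaklyConstantD[OF c1 t1 v] by (simp add: db)
    from SplitSurj_Eq[OF T1 a1 b1 v this] obtain s
      where s: "T # \<Gamma> \<turnstile> s \<Ztypecolon> SplitSurj (Eq (wk 1 T) (wk 1 (App g ?t)) (Var 0)) (FixEq T g)" by blast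
    obtain G h where Gh: "T # \<Gamma> \<turnstile> G \<Ztypecolon> Arrow (Eq (wk 1 T) (wk 1 (App g ?t)) (Var 0)) (FixEq T g)"
      "T # \<Gamma> \<turnstile> h \<Ztypecolon> Pi (FixEq T g) (Sig (wk 1 (Eq (wk 1 T) (wk 1 (App g ?t)) (Var 0)))
         (Eq (wk 2 (FixEq T g)) (App (wk 2 G) (Var 0)) (Var 1)))"
      using SplitSurj_obtain[OF ty_Eq[OF T1 a1 v] F(1) s] .
    have ctr: "\<Gamma> \<turnstile> FixCenter T g (App g ?t) G \<Ztypecolon> FixPt T g"
      by (rule FixPt_path(1)[OF T g a Gh(1) a ty_Refl[OF T a]])
    obtain p q where p: "\<Gamma> \<turnstile> p \<Ztypecolon> Eq (FixPt T g) (FixCenter T g (App g ?t) G) z"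
      and q: "\<Gamma> \<turnstile> q \<Ztypecolon> Eq (FixPt T g) (FixCenter T g (App g ?t) G) w"
      using FixPt_center[OF T g a Gh z] FixPt_center[OF T g a Gh w] by blast
    obtain p' where "\<Gamma> \<turnstile> p' \<Ztypecolon> Eq (FixPt T g) z (FixCenter T g (App g ?t) G)"
      using Eq_sym[OF F(2) ctr z p] by blast
    from Eq_trans[OF F(2) z ctr w this q] show ?thesis .
  qed
  let ?F = "FixPt T g"
  have F: "\<Gamma> \<turnstile> ?F \<Ztypecolon> Univ i" by (rule ty_FixPt(2)[OF T g])
  let ?\<Delta> = "wk 1 ?F # ?F # \<Gamma>"
  have wf: "wf_ctx ?\<Delta>" by (rule ctx_ext) (rule wk_has_type F ctx_ext | simp add: db; fail)+
  have "?\<Delta> \<turnstile> wk 2 T \<Ztypecolon> Univ i" "?\<Delta> \<turnstile> wk 2 g \<Ztypecolon> Arrow (wk 2 T) (wk 2 T)"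
    "?\<Delta> \<turnstile> wk 2 c \<Ztypecolon> WeaklyConstant (wk 2 T) (wk 2 g)"
    "?\<Delta> \<turnstile> Var 1 \<Ztypecolon> FixPt (wk 2 T) (wk 2 g)" "?\<Delta> \<turnstile> Var 0 \<Ztypecolon> FixPt (wk 2 T) (wk 2 g)"
    by (rule tyI T wf g c | simp add: db; fail)+
  from path[OF this] obtain e where "?\<Delta> \<turnstile> e \<Ztypecolon> Eq (FixPt (wk 2 T) (wk 2 g)) (Var 1) (Var 0)" by blast
  then have "?\<Delta> \<turnstile> e \<Ztypecolon> Eq (wk 2 ?F) (Var 1) (Var 0)" by (simp add: db)
  then show ?thesis by (rule IsPropI)
qed

text \<open>Weak constancy at g t and t is a path from g (g t) to g t, so g t is a fixed
  point.\<close>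

lemma FixPt_inhabited:
  assumes T: "\<Gamma> \<turnstile> T \<Ztypecolon> Univ i" and g: "\<Gamma> \<turnstile> g \<Ztypecolon> Arrow T T" and c: "\<Gamma> \<turnstile> c \<Ztypecolon> WeaklyConstant T g"
    and t: "\<Gamma> \<turnstile> t \<Ztypecolon> T"
  shows "\<exists>z. \<Gamma> \<turnstile> z \<Ztypecolon> FixPt T g"
  using ty_Pair_FixPt[OF T g ty_App_Arrow[OF g t] WeaklyConstantD[OF c ty_App_Arrow[OF g t] t]] by
      blast

section \<open>Projections from subtypes\<close>

abbreviation FiberEq :: "tm \<Rightarrow> tm \<Rightarrow> tm \<Rightarrow> tm" where
  "FiberEq X s x \<equiv> Eq (wk 1 X) (App (wk 1 s) (Var 0)) (wk 1 x)"

lemma ty_Fiber: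
  assumes A: "\<Gamma> \<turnstile> A \<Ztypecolon> Univ i" and X: "\<Gamma> \<turnstile> X \<Ztypecolon> Univ i" and s: "\<Gamma> \<turnstile> s \<Ztypecolon> Arrow A X" and x: "\<Gamma> \<turnstile> x \<Ztypecolon> X"
  shows "A # \<Gamma> \<turnstile> FiberEq X s x \<Ztypecolon> Univ i" and "\<Gamma> \<turnstile> Fiber A X s x \<Ztypecolon> Univ i"
proof -
  show 1: "A # \<Gamma> \<turnstile> FiberEq X s x \<Ztypecolon> Univ i"
    by (rule tyI A X s x ty_App_Arrow[where A = "wk 1 A"] | simp add: db; fail)+
  show "\<Gamma> \<turnstile> Fiber A X s x \<Ztypecolon> Univ i"
    unfolding Fiber_def by (rule ty_Sig[OF A 1])
qed

lemma ty_Pair_Fiber: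
  assumes A: "\<Gamma> \<turnstile> A \<Ztypecolon> Univ i" and X: "\<Gamma> \<turnstile> X \<Ztypecolon> Univ i" and s: "\<Gamma> \<turnstile> s \<Ztypecolon> Arrow A X" and x: "\<Gamma> \<turnstile> x \<Ztypecolon> X"
    and a: "\<Gamma> \<turnstile> a \<Ztypecolon> A" and q: "\<Gamma> \<turnstile> q \<Ztypecolon> Eq X (App s a) x"
  shows "\<Gamma> \<turnstile> Pair A (FiberEq X s x) a q \<Ztypecolon> Fiber A X s x"
  unfolding Fiber_def by (rule ty_Pair[OF ty_Fiber(1)[OF A X s x] a]) (use q in \<open>simp add: db\<close>)

lemma Fiber_obtain:
  assumes A: "\<Gamma> \<turnstile> A \<Ztypecolon> Univ i" and X: "\<Gamma> \<turnstile> X \<Ztypecolon> Univ i" and s: "\<Gamma> \<turnstile> s \<Ztypecolon> Arrow A X" and x: "\<Gamma> \<turnstile> x \<Ztypecolon> X"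
    and z: "\<Gamma> \<turnstile> z \<Ztypecolon> Fiber A X s x"
  obtains a q where "\<Gamma> \<turnstile> a \<Ztypecolon> A" "\<Gamma> \<turnstile> q \<Ztypecolon> Eq X (App s a) x"
  using Sig_obtain[OF ty_Fiber(2)[OF A X s x, unfolded Fiber_def] z[unfolded Fiber_def]]
  by (simp add: db) blast

definition Proj :: "tm \<Rightarrow> tm \<Rightarrow> tm" where
  "Proj X Q = Lam (Sig X Q) (Fst (wk 1 X) (Var 0))"

lemma Proj_ren [simp]: "ren \<rho> (Proj X Q) = Proj (ren \<rho> X) (ren (up_ren \<rho>) Q)"
  and Proj_subst [simp]: "subst \<sigma> (Proj X Q) = Proj (subst \<sigma> X) (subst (up \<sigma>) Q)"
  by (simp_all add: Proj_def db)

lemma ty_Proj: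
  assumes X: "\<Gamma> \<turnstile> X \<Ztypecolon> Univ i" and Q: "X # \<Gamma> \<turnstile> Q \<Ztypecolon> Univ i"
  shows "Sig X Q # \<Gamma> \<turnstile> Fst (wk 1 X) (Var 0) \<Ztypecolon> wk 1 X" and "\<Gamma> \<turnstile> Proj X Q \<Ztypecolon> Arrow (Sig X Q) X"
proof -
  have wf: "wf_ctx (Sig X Q # \<Gamma>)" by (rule ctx_ext[OF ty_Sig[OF X Q]])
  have X1: "Sig X Q # \<Gamma> \<turnstile> wk 1 X \<Ztypecolon> Univ i" by (rule tyI X wf | simp add: db; fail)+
  have Q1: "wk 1 X # Sig X Q # \<Gamma> \<turnstile> ren (up_ren Suc) Q \<Ztypecolon> Univ i"
    using weaken_under1[OF Q wf] by (simp add: db)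
  show 1: "Sig X Q # \<Gamma> \<turnstile> Fst (wk 1 X) (Var 0) \<Ztypecolon> wk 1 X"
    by (rule ty_Fst[OF X1 Q1]) (rule ty_var_eq[OF wf]; simp add: db)
  show "\<Gamma> \<turnstile> Proj X Q \<Ztypecolon> Arrow (Sig X Q) X"
    unfolding Proj_def Arrow_def by (rule ty_Lam[OF 1])
qed

lemma beta_Proj:
  assumes X: "\<Gamma> \<turnstile> X \<Ztypecolon> Univ i" and Q: "X # \<Gamma> \<turnstile> Q \<Ztypecolon> Univ i"
  shows "\<Gamma> \<turnstile> w \<Ztypecolon> Sig X Q \<Longrightarrow> \<Gamma> \<turnstile> App (Proj X Q) w \<doteq> Fst X w \<Ztypecolon> X"
    and "\<Gamma> \<turnstile> x \<Ztypecolon> X \<Longrightarrow> \<Gamma> \<turnstile> b \<Ztypecolon> inst 0 [x] Q \<Longrightarrow> \<Gamma> \<turnstile> App (Proj X Q) (Pair X Q x b) \<doteq> x \<Ztypecolon> X"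
proof -
  show 1: "\<Gamma> \<turnstile> App (Proj X Q) w \<doteq> Fst X w \<Ztypecolon> X" if "\<Gamma> \<turnstile> w \<Ztypecolon> Sig X Q" for w
    using beta_Pi[OF ty_Proj(1)[OF X Q] that] by (simp add: Proj_def db)
  show "\<Gamma> \<turnstile> App (Proj X Q) (Pair X Q x b) \<doteq> x \<Ztypecolon> X"
    if x: "\<Gamma> \<turnstile> x \<Ztypecolon> X" and b: "\<Gamma> \<turnstile> b \<Ztypecolon> inst 0 [x] Q"
    by (rule eq_trans[OF 1[OF ty_Pair[OF Q x b]] beta_Fst[OF X Q x b]])
qed

abbreviation ProjFiber :: "tm \<Rightarrow> tm \<Rightarrow> tm \<Rightarrow> tm" where
  "ProjFiber X Q x \<equiv> Fiber (Sig X Q) X (Proj X Q) x"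

section \<open>The fibers of a projection as retracts of the family\<close>

definition FiberPair :: "tm \<Rightarrow> tm \<Rightarrow> tm \<Rightarrow> tm \<Rightarrow> tm \<Rightarrow> tm" where
  "FiberPair X Q x w q = Pair (Sig X Q) (FiberEq X (Proj X Q) x) w q"

definition FiberPoint :: "tm \<Rightarrow> tm \<Rightarrow> tm \<Rightarrow> tm \<Rightarrow> tm" where
  "FiberPoint X Q x b = FiberPair X Q x (Pair X Q x b) (Refl x)"

text \<open>The points of the form \<open>(x, b), refl\<close> exhaust the fiber over \<open>x\<close>, so it is a retract of \<open>Q
    x\<close>.\<close>

definition Lift :: "tm \<Rightarrow> tm \<Rightarrow> tm \<Rightarrow> tm \<Rightarrow> tm" where
  "Lift X Q x z = Sig (inst 0 [x] Q) (Eq (wk 1 (ProjFiber X Q x))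
     (FiberPoint (wk 1 X) (ren (up_ren Suc) Q) (wk 1 x) (Var 0)) (wk 1 z))"

lemma Fiber_terms_ren [simp]:
  "ren \<rho> (FiberPair X Q x w q) = FiberPair (ren \<rho> X) (ren (up_ren \<rho>) Q) (ren \<rho> x) (ren \<rho> w) (ren \<rho>
      q)"
  "ren \<rho> (FiberPoint X Q x b) = FiberPoint (ren \<rho> X) (ren (up_ren \<rho>) Q) (ren \<rho> x) (ren \<rho> b)"
  "ren \<rho> (Lift X Q x z) = Lift (ren \<rho> X) (ren (up_ren \<rho>) Q) (ren \<rho> x) (ren \<rho> z)"
  by (simp_all add: FiberPair_def FiberPoint_def Lift_def db)

lemma Fiber_terms_subst [simp]:
  "subst \<sigma> (FiberPair X Q x w q) = FiberPair (subst \<sigma> X) (subst (up \<sigma>) Q) (subst \<sigma> x) (subst \<sigma> w)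
      (subst \<sigma> q)"
  "subst \<sigma> (FiberPoint X Q x b) = FiberPoint (subst \<sigma> X) (subst (up \<sigma>) Q) (subst \<sigma> x) (subst \<sigma> b)"
  "subst \<sigma> (Lift X Q x z) = Lift (subst \<sigma> X) (subst (up \<sigma>) Q) (subst \<sigma> x) (subst \<sigma> z)"
  by (simp_all add: FiberPair_def FiberPoint_def Lift_def db)

lemma ty_ProjFiber:
  assumes X: "\<Gamma> \<turnstile> X \<Ztypecolon> Univ i" and Q: "X # \<Gamma> \<turnstile> Q \<Ztypecolon> Univ i" and x: "\<Gamma> \<turnstile> x \<Ztypecolon> X"
  shows "\<Gamma> \<turnstile> ProjFiber X Q x \<Ztypecolon> Univ i"
  by (rule ty_Fiber(2)[OF ty_Sig[OF X Q] X ty_Proj(2)[OF X Q] x])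

lemma ty_FiberPair:
  assumes X: "\<Gamma> \<turnstile> X \<Ztypecolon> Univ i" and Q: "X # \<Gamma> \<turnstile> Q \<Ztypecolon> Univ i" and x: "\<Gamma> \<turnstile> x \<Ztypecolon> X"
    and w: "\<Gamma> \<turnstile> w \<Ztypecolon> Sig X Q" and q: "\<Gamma> \<turnstile> q \<Ztypecolon> Eq X (App (Proj X Q) w) x"
  shows "\<Gamma> \<turnstile> FiberPair X Q x w q \<Ztypecolon> ProjFiber X Q x"
  unfolding FiberPair_def
  by (rule ty_Pair_Fiber[OF ty_Sig[OF X Q] X ty_Proj(2)[OF X Q] x w q])

lemma ty_FiberPoint:
  assumes X: "\<Gamma> \<turnstile> X \<Ztypecolon> Univ i" and Q: "X # \<Gamma> \<turnstile> Q \<Ztypecolon> Univ i" and x: "\<Gamma> \<turnstile> x \<Ztypecolon> X"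
    and b: "\<Gamma> \<turnstile> b \<Ztypecolon> inst 0 [x] Q"
  shows "\<Gamma> \<turnstile> FiberPoint X Q x b \<Ztypecolon> ProjFiber X Q x"
  unfolding FiberPoint_def
  by (rule ty_FiberPair[OF X Q x ty_Pair[OF Q x b]
        conv_Eq[OF ty_Refl[OF X x] X eq_sym[OF beta_Proj(2)[OF X Q x b]] eq_refl[OF x]]])

lemma ty_Lift_family:
  assumes X: "\<Gamma> \<turnstile> X \<Ztypecolon> Univ i" and Q: "X # \<Gamma> \<turnstile> Q \<Ztypecolon> Univ i" and x: "\<Gamma> \<turnstile> x \<Ztypecolon> X"
  shows "\<Gamma> \<turnstile> inst 0 [x] Q \<Ztypecolon> Univ i"
    and "inst 0 [x] Q # \<Gamma> \<turnstile> FiberPoint (wk 1 X) (ren (up_ren Suc) Q) (wk 1 x) (Var 0)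
        \<Ztypecolon> wk 1 (ProjFiber X Q x)"
    and "\<Gamma> \<turnstile> z \<Ztypecolon> ProjFiber X Q x \<Longrightarrow> inst 0 [x] Q # \<Gamma> \<turnstile> Eq (wk 1 (ProjFiber X Q x))
     (FiberPoint (wk 1 X) (ren (up_ren Suc) Q) (wk 1 x) (Var 0)) (wk 1 z) \<Ztypecolon> Univ i"
proof -
  show Qx: "\<Gamma> \<turnstile> inst 0 [x] Q \<Ztypecolon> Univ i" using inst_has_type[OF Q x] by (simp add: db)
  let ?\<Delta> = "inst 0 [x] Q # \<Gamma>"
  have wf: "wf_ctx ?\<Delta>" using Qx by (rule ctx_ext)
  have X1: "?\<Delta> \<turnstile> wk 1 X \<Ztypecolon> Univ i" and x1: "?\<Delta> \<turnstile> wk 1 x \<Ztypecolon> wk 1 X"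
    and v: "?\<Delta> \<turnstile> Var 0 \<Ztypecolon> inst 0 [wk 1 x] (ren (up_ren Suc) Q)"
    by (rule tyI wf X x | simp add: db; fail)+
  have Q1: "wk 1 X # ?\<Delta> \<turnstile> ren (up_ren Suc) Q \<Ztypecolon> Univ i"
    using weaken_under1[OF Q wf] by (simp add: db)
  show P: "?\<Delta> \<turnstile> FiberPoint (wk 1 X) (ren (up_ren Suc) Q) (wk 1 x) (Var 0) \<Ztypecolon> wk 1 (ProjFiber X Q x)"
    using ty_FiberPoint[OF X1 Q1 x1 v] by (simp add: db)
  show "?\<Delta> \<turnstile> Eq (wk 1 (ProjFiber X Q x)) (FiberPoint (wk 1 X) (ren (up_ren Suc) Q) (wk 1 x) (Var
      0)) (wk 1 z) \<Ztypecolon> Univ i"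
    if z: "\<Gamma> \<turnstile> z \<Ztypecolon> ProjFiber X Q x"
    by (rule ty_Eq[OF _ P]) (rule wk_has_type wf ty_ProjFiber[OF X Q x] z | simp add: db; fail)+
qed

lemma ty_Lift:
  assumes X: "\<Gamma> \<turnstile> X \<Ztypecolon> Univ i" and Q: "X # \<Gamma> \<turnstile> Q \<Ztypecolon> Univ i" and x: "\<Gamma> \<turnstile> x \<Ztypecolon> X"
    and z: "\<Gamma> \<turnstile> z \<Ztypecolon> ProjFiber X Q x"
  shows "\<Gamma> \<turnstile> Lift X Q x z \<Ztypecolon> Univ i"
  unfolding Lift_def by (rule ty_Sig[OF ty_Lift_family(1)[OF X Q x] ty_Lift_family(3)[OF X Q x z]])

text \<open>\<open>x\<close> is definitionally but not syntactically \<open>y\<close>. So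
  \<open>b\<close> can be retyped over \<open>x\<close>, the two fiber points are definitionally
  equal, and reflexivity connects them after conversion. The detour through \<open>x\<close> gives
  the base point that the path induction in \<open>Lift_FiberPair\<close> requires.\<close>

lemma Lift_Pair:
  assumes X: "\<Gamma> \<turnstile> X \<Ztypecolon> Univ i" and Q: "X # \<Gamma> \<turnstile> Q \<Ztypecolon> Univ i" and y: "\<Gamma> \<turnstile> y \<Ztypecolon> X"
    and b: "\<Gamma> \<turnstile> b \<Ztypecolon> inst 0 [y] Q"
  defines "w \<equiv> Pair X Q y b"
  defines "x \<equiv> App (Proj X Q) w"
  shows "\<exists>t. \<Gamma> \<turnstile> t \<Ztypecolon> Lift X Q x (FiberPair X Q x w (Refl x))"
proof -
  have w: "\<Gamma> \<turnstile> w \<Ztypecolon> Sig X Q" unfolding w_def by (rule ty_Pair[OF Q y b])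
  have x: "\<Gamma> \<turnstile> x \<Ztypecolon> X" unfolding x_def by (rule ty_App_Arrow[OF ty_Proj(2)[OF X Q] w])
  have yx: "\<Gamma> \<turnstile> y \<doteq> x \<Ztypecolon> X" unfolding x_def w_def by (rule eq_sym[OF beta_Proj(2)[OF X Q y b]])
  have b': "\<Gamma> \<turnstile> b \<Ztypecolon> inst 0 [x] Q" by (rule ty_conv[OF b inst_cong_type[OF Q y x yx]])
  have z: "\<Gamma> \<turnstile> FiberPair X Q x w (Refl x) \<Ztypecolon> ProjFiber X Q x"
    by (rule ty_FiberPair[OF X Q x w]) (use ty_Refl[OF X x] in \<open>simp add: x_def\<close>)
  note S = ty_Sig[OF X Q]
  have w': "\<Gamma> \<turnstile> w \<doteq> Pair X Q x b \<Ztypecolon> Sig X Q"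
    unfolding w_def by (rule cong_Pair[OF eq_refl[OF X] eq_refl[OF Q] yx eq_refl[OF b]])
  have r: "\<Gamma> \<turnstile> Refl x \<Ztypecolon> inst 0 [w] (FiberEq X (Proj X Q) x)"
    using ty_Refl[OF X x] by (simp add: db x_def)
  have "\<Gamma> \<turnstile> FiberPair X Q x w (Refl x) \<doteq> FiberPoint X Q x b \<Ztypecolon> ProjFiber X Q x"
    unfolding FiberPoint_def FiberPair_def Fiber_def
    by (rule cong_Pair[OF eq_refl[OF S] eq_refl[OF ty_Fiber(1)[OF S X ty_Proj(2)[OF X Q] x]] w'
        eq_refl[OF r]])
  from conv_Eq[OF ty_Refl[OF ty_ProjFiber[OF X Q x] z] ty_ProjFiber[OF X Q x] this eq_refl[OF z]]
  have "\<Gamma> \<turnstile> Refl (FiberPair X Q x w (Refl x))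
      \<Ztypecolon> Eq (ProjFiber X Q x) (FiberPoint X Q x b) (FiberPair X Q x w (Refl x))" .
  then have "\<Gamma> \<turnstile> Refl (FiberPair X Q x w (Refl x)) \<Ztypecolon> inst 0 [b] (Eq (wk 1 (ProjFiber X Q x))
     (FiberPoint (wk 1 X) (ren (up_ren Suc) Q) (wk 1 x) (Var 0)) (wk 1 (FiberPair X Q x w (Refl
         x))))"
    by (simp add: db)
  from ty_Pair[OF ty_Lift_family(3)[OF X Q x z] b' this] show ?thesis
    unfolding Lift_def by blast
qed

text \<open>\<open>SigInd\<close> on \<open>w\<close> reduces the claim to a literal pair, where
  \<open>Lift_Pair\<close> applies.\<close>

lemma Lift_Refl:
  assumes X: "\<Gamma> \<turnstile> X \<Ztypecolon> Univ i" and Q: "X # \<Gamma> \<turnstile> Q \<Ztypecolon> Univ i" and w: "\<Gamma> \<turnstile> w \<Ztypecolon> Sig X Q"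
  defines "x \<equiv> App (Proj X Q) w"
  shows "\<exists>t. \<Gamma> \<turnstile> t \<Ztypecolon> Lift X Q x (FiberPair X Q x w (Refl x))"
proof -
  note S = ty_Sig[OF X Q]
  let ?\<Delta> = "Sig X Q # \<Gamma>" and ?Q = "ren (up_ren Suc) Q"
  let ?x = "App (Proj (wk 1 X) ?Q) (Var 0)"
  have wf: "wf_ctx ?\<Delta>" using S by (rule ctx_ext)
  have X1: "?\<Delta> \<turnstile> wk 1 X \<Ztypecolon> Univ i" and v: "?\<Delta> \<turnstile> Var 0 \<Ztypecolon> Sig (wk 1 X) ?Q"
    by (rule tyI wf X | simp add: db; fail)+
  have Q1: "wk 1 X # ?\<Delta> \<turnstile> ?Q \<Ztypecolon> Univ i"
    using weaken_under1[OF Q wf] by (simp add: db)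
  have x1: "?\<Delta> \<turnstile> ?x \<Ztypecolon> wk 1 X" by (rule ty_App_Arrow[OF ty_Proj(2)[OF X1 Q1] v])
  have C: "?\<Delta> \<turnstile> Lift (wk 1 X) ?Q ?x (FiberPair (wk 1 X) ?Q ?x (Var 0) (Refl ?x)) \<Ztypecolon> Univ i"
    by (rule ty_Lift[OF X1 Q1 x1 ty_FiberPair[OF X1 Q1 x1 v ty_Refl[OF X1 x1]]])
  let ?\<Delta>2 = "Q # X # \<Gamma>" and ?Q2 = "ren (up_ren (\<lambda>n. n + 2)) Q"
  have wf2: "wf_ctx ?\<Delta>2" using Q by (rule ctx_ext)
  have X2: "?\<Delta>2 \<turnstile> wk 2 X \<Ztypecolon> Univ i" and v2: "?\<Delta>2 \<turnstile> Var 1 \<Ztypecolon> wk 2 X" "?\<Delta>2 \<turnstile> Var 0 \<Ztypecolon> inst 0 [Var 1] ?Q2"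
    by (rule tyI wf2 X | simp add: db; fail)+
  have Q2: "wk 2 X # ?\<Delta>2 \<turnstile> ?Q2 \<Ztypecolon> Univ i"
    using weaken_under2[OF Q wf2] by (simp add: db)
  obtain t where "?\<Delta>2 \<turnstile> t \<Ztypecolon> inst 2 [Pair (wk 2 X) ?Q2 (Var 1) (Var 0)]
     (Lift (wk 1 X) ?Q ?x (FiberPair (wk 1 X) ?Q ?x (Var 0) (Refl ?x)))"
    using Lift_Pair[OF X2 Q2 v2] by (auto simp: db)
  from ty_SigInd[OF C this w] show ?thesis by (auto simp: db x_def)
qed

text \<open>Based path induction on \<open>q\<close>, starting at the projection of
  \<open>w\<close>, leaves the case of reflexivity.\<close>

lemma Lift_FiberPair:
  assumes X: "\<Gamma> \<turnstile> X \<Ztypecolon> Univ i" and Q: "X # \<Gamma> \<turnstile> Q \<Ztypecolon> Univ i" and w: "\<Gamma> \<turnstile> w \<Ztypecolon> Sig X Q"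
    and x: "\<Gamma> \<turnstile> x \<Ztypecolon> X" and q: "\<Gamma> \<turnstile> q \<Ztypecolon> Eq X (App (Proj X Q) w) x"
  shows "\<exists>t. \<Gamma> \<turnstile> t \<Ztypecolon> Lift X Q x (FiberPair X Q x w q)"
proof -
  let ?y = "App (Proj X Q) w"
  have y: "\<Gamma> \<turnstile> ?y \<Ztypecolon> X" by (rule ty_App_Arrow[OF ty_Proj(2)[OF X Q] w])
  let ?\<Delta> = "Eq (wk 1 X) (wk 1 ?y) (Var 0) # X # \<Gamma>" and ?Q = "ren (up_ren (\<lambda>n. n + 2)) Q"
  have wf: "wf_ctx ?\<Delta>" by (rule ctx_ext, rule ty_Eq) (rule wk_has_type ty_var_eq ctx_ext X y |
      simp add: db; fail)+
  have X2: "?\<Delta> \<turnstile> wk 2 X \<Ztypecolon> Univ i" and w2: "?\<Delta> \<turnstile> wk 2 w \<Ztypecolon> Sig (wk 2 X) ?Q"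
    and v: "?\<Delta> \<turnstile> Var 1 \<Ztypecolon> wk 2 X" "?\<Delta> \<turnstile> Var 0
        \<Ztypecolon> Eq (wk 2 X) (App (Proj (wk 2 X) ?Q) (wk 2 w)) (Var 1)"
    by (rule tyI wf X w | simp add: db; fail)+
  have Q2: "wk 2 X # ?\<Delta> \<turnstile> ?Q \<Ztypecolon> Univ i"
    using weaken_under2[OF Q wf] by (simp add: db)
  have C: "?\<Delta> \<turnstile> Lift (wk 2 X) ?Q (Var 1) (FiberPair (wk 2 X) ?Q (Var 1) (wk 2 w) (Var 0)) \<Ztypecolon> Univ i"
    by (rule ty_Lift[OF X2 Q2 v(1) ty_FiberPair[OF X2 Q2 v(1) w2 v(2)]])
  obtain u where "\<Gamma> \<turnstile> u \<Ztypecolon> Lift X Q ?y (FiberPair X Q ?y w (Refl ?y))"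
    using Lift_Refl[OF X Q w] by blast
  then show ?thesis using based_path_induction[OF X y x q C, of u] by (simp add: db)
qed

text \<open>\<open>SigInd\<close> on \<open>z\<close> leaves fiber elements that are literal pairs
  (w, q).\<close>

lemma Lift_exists:
  assumes X: "\<Gamma> \<turnstile> X \<Ztypecolon> Univ i" and Q: "X # \<Gamma> \<turnstile> Q \<Ztypecolon> Univ i"
    and x: "\<Gamma> \<turnstile> x \<Ztypecolon> X" and z: "\<Gamma> \<turnstile> z \<Ztypecolon> ProjFiber X Q x"
  shows "\<exists>t. \<Gamma> \<turnstile> t \<Ztypecolon> Lift X Q x z"
proof -
  note S = ty_Sig[OF X Q] and F = ty_ProjFiber[OF X Q x]
  let ?\<Delta> = "ProjFiber X Q x # \<Gamma>" and ?Q = "ren (up_ren Suc) Q"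
  have wf: "wf_ctx ?\<Delta>" using F by (rule ctx_ext)
  have X1: "?\<Delta> \<turnstile> wk 1 X \<Ztypecolon> Univ i" and x1: "?\<Delta> \<turnstile> wk 1 x \<Ztypecolon> wk 1 X"
    and v: "?\<Delta> \<turnstile> Var 0 \<Ztypecolon> ProjFiber (wk 1 X) ?Q (wk 1 x)"
    by (rule tyI wf X x | simp add: db; fail)+
  have Q1: "wk 1 X # ?\<Delta> \<turnstile> ?Q \<Ztypecolon> Univ i"
    using weaken_under1[OF Q wf] by (simp add: db)
  note C = ty_Lift[OF X1 Q1 x1 v]
  note FE = ty_Fiber(1)[OF S X ty_Proj(2)[OF X Q] x]
  let ?\<Delta>2 = "FiberEq X (Proj X Q) x # Sig X Q # \<Gamma>" and ?Q2 = "ren (up_ren (\<lambda>n. n + 2)) Q"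
  have wf2: "wf_ctx ?\<Delta>2" using FE by (rule ctx_ext)
  have X2: "?\<Delta>2 \<turnstile> wk 2 X \<Ztypecolon> Univ i" and x2: "?\<Delta>2 \<turnstile> wk 2 x \<Ztypecolon> wk 2 X"
    and v2: "?\<Delta>2 \<turnstile> Var 1 \<Ztypecolon> Sig (wk 2 X) ?Q2" "?\<Delta>2 \<turnstile> Var 0
        \<Ztypecolon> Eq (wk 2 X) (App (Proj (wk 2 X) ?Q2) (Var 1)) (wk 2 x)"
    by (rule tyI wf2 X x | simp add: db; fail)+
  have Q2: "wk 2 X # ?\<Delta>2 \<turnstile> ?Q2 \<Ztypecolon> Univ i"
    using weaken_under2[OF Q wf2] by (simp add: db)
  obtain t where "?\<Delta>2 \<turnstile> t \<Ztypecolon> inst 2 [Pair (wk 2 (Sig X Q)) (ren (up_ren (\<lambda>n. n + 2)) (FiberEq X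
      (Proj X Q) x)) (Var 1) (Var 0)]
     (Lift (wk 1 X) ?Q (wk 1 x) (Var 0))"
    using Lift_FiberPair[OF X2 Q2 v2(1) x2 v2(2)] by (auto simp: db FiberPair_def)
  from ty_SigInd[OF C[unfolded Fiber_def] this z[unfolded Fiber_def]] show ?thesis
      by (auto simp: db)
qed

text \<open>The map sends b to the point ((x, b), refl). Its section is \<open>Lift_exists\<close>
  at a generic element of the fiber.\<close>

lemma SplitSurj_ProjFiber:
  assumes X: "\<Gamma> \<turnstile> X \<Ztypecolon> Univ i" and Q: "X # \<Gamma> \<turnstile> Q \<Ztypecolon> Univ i" and x: "\<Gamma> \<turnstile> x \<Ztypecolon> X"
  shows "\<exists>t. \<Gamma> \<turnstile> t \<Ztypecolon> SplitSurj (inst 0 [x] Q) (ProjFiber X Q x)"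
proof -
  note F = ty_ProjFiber[OF X Q x] and L = ty_Lift_family[OF X Q x]
  let ?f = "Lam (inst 0 [x] Q) (FiberPoint (wk 1 X) (ren (up_ren Suc) Q) (wk 1 x) (Var 0))"
  have f: "\<Gamma> \<turnstile> ?f \<Ztypecolon> Arrow (inst 0 [x] Q) (ProjFiber X Q x)"
    unfolding Arrow_def by (rule ty_Lam[OF L(2)])
  let ?\<Delta> = "ProjFiber X Q x # \<Gamma>" and ?Q = "ren (up_ren Suc) Q"
  have wf: "wf_ctx ?\<Delta>" using F by (rule ctx_ext)
  have X1: "?\<Delta> \<turnstile> wk 1 X \<Ztypecolon> Univ i" and x1: "?\<Delta> \<turnstile> wk 1 x \<Ztypecolon> wk 1 X"
    and v: "?\<Delta> \<turnstile> Var 0 \<Ztypecolon> ProjFiber (wk 1 X) ?Q (wk 1 x)"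
    by (rule tyI wf X x | simp add: db; fail)+
  have Q1: "wk 1 X # ?\<Delta> \<turnstile> ?Q \<Ztypecolon> Univ i"
    using weaken_under1[OF Q wf] by (simp add: db)
  obtain t where "?\<Delta> \<turnstile> t \<Ztypecolon> Lift (wk 1 X) ?Q (wk 1 x) (Var 0)"
    using Lift_exists[OF X1 Q1 x1 v] by blast
  from Sig_obtain[OF ty_Lift[OF X1 Q1 x1 v, unfolded Lift_def] this[unfolded Lift_def]]
  obtain b e where b: "?\<Delta> \<turnstile> b \<Ztypecolon> inst 0 [wk 1 x] ?Q"
    and e: "?\<Delta> \<turnstile> e \<Ztypecolon> Eq (ProjFiber (wk 1 X) ?Q (wk 1 x)) (FiberPoint (wk 1 X) ?Q (wk 1 x) b) (Var
        0)"
    by (simp add: db) blast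
  have "?\<Delta> \<turnstile> App (wk 1 ?f) b \<doteq> FiberPoint (wk 1 X) ?Q (wk 1 x) b \<Ztypecolon> ProjFiber (wk 1 X) ?Q (wk 1 x)"
    using beta_Pi[OF ty_Lift_family(2)[OF X1 Q1 x1] b] by (simp add: db)
  from conv_Eq[OF e ty_ProjFiber[OF X1 Q1 x1] eq_sym[OF this] eq_refl[OF v]]
  have "?\<Delta> \<turnstile> e \<Ztypecolon> Eq (wk 1 (ProjFiber X Q x)) (App (wk 1 ?f) b) (Var 0)"
    by (simp add: db)
  then show ?thesis
    by (rule SplitSurjI[OF L(1) F f, of b, rotated]) (use b in \<open>simp add: db\<close>)
qed

lemma Proj_IsEmbedding:
  assumes X: "\<Gamma> \<turnstile> X \<Ztypecolon> Univ i" and Q: "X # \<Gamma> \<turnstile> Q \<Ztypecolon> Univ i" and h: "X # \<Gamma> \<turnstile> h \<Ztypecolon> IsProp Q"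
  shows "\<exists>t. \<Gamma> \<turnstile> t \<Ztypecolon> IsEmbedding (Sig X Q) X (Proj X Q)"
proof -
  let ?\<Delta> = "X # \<Gamma>" and ?Q = "ren (up_ren Suc) Q"
  have wf: "wf_ctx ?\<Delta>" using X by (rule ctx_ext)
  have X1: "?\<Delta> \<turnstile> wk 1 X \<Ztypecolon> Univ i" and v: "?\<Delta> \<turnstile> Var 0 \<Ztypecolon> wk 1 X"
    by (rule tyI wf X | simp add: db; fail)+
  have Q1: "wk 1 X # ?\<Delta> \<turnstile> ?Q \<Ztypecolon> Univ i"
    using weaken_under1[OF Q wf] by (simp add: db)
  \<comment> \<open>At the generic point the weakened family is \<open>Q\<close> itself, so the
    fiber over this point is a retract of the proposition \<open>Q\<close>.\<close>
  have "inst 0 [Var 0] ?Q = Q" by (simp add: db)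
  then obtain t where "?\<Delta> \<turnstile> t \<Ztypecolon> SplitSurj Q (ProjFiber (wk 1 X) ?Q (Var 0))"
    using SplitSurj_ProjFiber[OF X1 Q1 v] by auto
  from SplitSurj_IsProp[OF Q ty_ProjFiber[OF X1 Q1 v] this h]
  obtain k where "?\<Delta> \<turnstile> k \<Ztypecolon> IsProp (ProjFiber (wk 1 X) ?Q (Var 0))" by blast
  then have "?\<Delta> \<turnstile> k \<Ztypecolon> IsProp (Fiber (wk 1 (Sig X Q)) (wk 1 X) (wk 1 (Proj X Q)) (Var 0))"
    by (simp add: db)
  from ty_Lam[OF this] show ?thesis unfolding IsEmbedding_def by blast
qed

section \<open>Formation of the types in the theorem\<close>

lemma htpy_ren [simp]:
  "ren \<rho> (RetractHtpy A r s) = RetractHtpy (ren \<rho> A) (ren \<rho> r) (ren \<rho> s)"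
  "ren \<rho> (SplitHtpy X f r s) = SplitHtpy (ren \<rho> X) (ren \<rho> f) (ren \<rho> r) (ren \<rho> s)"
  by (simp_all add: RetractHtpy_def SplitHtpy_def db)

lemma htpy_subst [simp]:
  "subst \<sigma> (RetractHtpy A r s) = RetractHtpy (subst \<sigma> A) (subst \<sigma> r) (subst \<sigma> s)"
  "subst \<sigma> (SplitHtpy X f r s) = SplitHtpy (subst \<sigma> X) (subst \<sigma> f) (subst \<sigma> r) (subst \<sigma> s)"
  by (simp_all add: RetractHtpy_def SplitHtpy_def db)

lemma ty_IsProp: "\<Gamma> \<turnstile> T \<Ztypecolon> Univ i \<Longrightarrow> \<Gamma> \<turnstile> IsProp T \<Ztypecolon> Univ i"
  unfolding IsProp_def by (assumption | rule tyI ty_Pi | simp add: db; fail)+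

lemma ty_IsEmbedding:
  assumes A: "\<Gamma> \<turnstile> A \<Ztypecolon> Univ i" and X: "\<Gamma> \<turnstile> X \<Ztypecolon> Univ i" and s: "\<Gamma> \<turnstile> s \<Ztypecolon> Arrow A X"
  shows "\<Gamma> \<turnstile> IsEmbedding A X s \<Ztypecolon> Univ i"
  unfolding IsEmbedding_def
  by (rule tyI ty_Pi A X s ty_IsProp ty_Fiber(2) | simp add: db; fail)+

lemma ty_RetractHtpy:
  assumes A: "\<Gamma> \<turnstile> A \<Ztypecolon> Univ i" and X: "\<Gamma> \<turnstile> X \<Ztypecolon> Univ i" and r: "\<Gamma> \<turnstile> r \<Ztypecolon> Arrow X A"
    and s: "\<Gamma> \<turnstile> s \<Ztypecolon> Arrow A X"
  shows "\<Gamma> \<turnstile> RetractHtpy A r s \<Ztypecolon> Univ i"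
proof -
  have r1: "A # \<Gamma> \<turnstile> wk 1 r \<Ztypecolon> Arrow (wk 1 X) (wk 1 A)"
    and s1: "A # \<Gamma> \<turnstile> wk 1 s \<Ztypecolon> Arrow (wk 1 A) (wk 1 X)"
    by (rule tyI A r s | simp add: db; fail)+
  show ?thesis unfolding RetractHtpy_def
    by (rule tyI ty_Pi A ty_App_Arrow[OF r1] ty_App_Arrow[OF s1] | simp add: db; fail)+
qed

lemma ty_SplitHtpy:
  assumes A: "\<Gamma> \<turnstile> A \<Ztypecolon> Univ i" and X: "\<Gamma> \<turnstile> X \<Ztypecolon> Univ i" and f: "\<Gamma> \<turnstile> f \<Ztypecolon> Arrow X X"
    and r: "\<Gamma> \<turnstile> r \<Ztypecolon> Arrow X A" and s: "\<Gamma> \<turnstile> s \<Ztypecolon> Arrow A X"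
  shows "\<Gamma> \<turnstile> SplitHtpy X f r s \<Ztypecolon> Univ i"
proof -
  have r1: "X # \<Gamma> \<turnstile> wk 1 r \<Ztypecolon> Arrow (wk 1 X) (wk 1 A)"
    and s1: "X # \<Gamma> \<turnstile> wk 1 s \<Ztypecolon> Arrow (wk 1 A) (wk 1 X)"
    and f1: "X # \<Gamma> \<turnstile> wk 1 f \<Ztypecolon> Arrow (wk 1 X) (wk 1 X)" and v: "X # \<Gamma> \<turnstile> Var 0 \<Ztypecolon> wk 1 X"
    and X1: "X # \<Gamma> \<turnstile> wk 1 X \<Ztypecolon> Univ i"
    by (rule tyI X f r s | simp add: db; fail)+
  show ?thesis unfolding SplitHtpy_def
    by (rule ty_Pi[OF X ty_Eq[OF X1 ty_App_Arrow[OF s1 ty_App_Arrow[OF r1 v]] ty_App_Arrow[OF f1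
        v]]])
qed

lemma ty_Prod: "\<Gamma> \<turnstile> A \<Ztypecolon> Univ i \<Longrightarrow> \<Gamma> \<turnstile> B \<Ztypecolon> Univ i \<Longrightarrow> \<Gamma> \<turnstile> Prod A B \<Ztypecolon> Univ i"
  unfolding Prod_def by (assumption | rule tyI ty_Sig | simp add: db; fail)+

lemma Prod_intro:
  assumes A: "\<Gamma> \<turnstile> A \<Ztypecolon> Univ i" and B: "\<Gamma> \<turnstile> B \<Ztypecolon> Univ i" and a: "\<Gamma> \<turnstile> a \<Ztypecolon> A" and b: "\<Gamma> \<turnstile> b \<Ztypecolon> B"
  shows "\<exists>t. \<Gamma> \<turnstile> t \<Ztypecolon> Prod A B"
proof -
  have "A # \<Gamma> \<turnstile> wk 1 B \<Ztypecolon> Univ i" by (rule tyI A B | simp add: db; fail)+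
  from ty_Pair[OF this a, of b] b show ?thesis by (auto simp: Prod_def db)
qed

lemma ty_WeaklyConstant:
  assumes T: "\<Gamma> \<turnstile> T \<Ztypecolon> Univ i" and g: "\<Gamma> \<turnstile> g \<Ztypecolon> Arrow T T"
  shows "\<Gamma> \<turnstile> WeaklyConstant T g \<Ztypecolon> Univ i"
  unfolding WeaklyConstant_def
  by (rule tyI ty_Pi T g ty_App_Arrow[where A = "wk 2 T"] | simp add: db; fail)+

lemma ty_WeaklyConstantEndo:
  assumes T: "\<Gamma> \<turnstile> T \<Ztypecolon> Univ i"
  shows "Arrow T T # \<Gamma> \<turnstile> WeaklyConstant (wk 1 T) (Var 0) \<Ztypecolon> Univ i"
    and "\<Gamma> \<turnstile> WeaklyConstantEndo T \<Ztypecolon> Univ i"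
proof -
  show 1: "Arrow T T # \<Gamma> \<turnstile> WeaklyConstant (wk 1 T) (Var 0) \<Ztypecolon> Univ i"
    by (rule ty_WeaklyConstant) (rule tyI T | simp add: db; fail)+
  show "\<Gamma> \<turnstile> WeaklyConstantEndo T \<Ztypecolon> Univ i"
    unfolding WeaklyConstantEndo_def by (rule ty_Sig[OF ty_Arrow[OF T T] 1])
qed

lemma WeaklyConstantEndo_through_IsProp:
  assumes T: "\<Gamma> \<turnstile> T \<Ztypecolon> Univ i" and P: "\<Gamma> \<turnstile> P \<Ztypecolon> Univ i" and h: "\<Gamma> \<turnstile> h \<Ztypecolon> IsProp P"
    and f: "\<Gamma> \<turnstile> f \<Ztypecolon> Arrow T P" and g: "\<Gamma> \<turnstile> g \<Ztypecolon> Arrow P T"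
  shows "\<exists>t. \<Gamma> \<turnstile> t \<Ztypecolon> WeaklyConstantEndo T"
proof -
  let ?e = "Lam T (App (wk 1 g) (App (wk 1 f) (Var 0)))"
  have f1: "T # \<Gamma> \<turnstile> wk 1 f \<Ztypecolon> Arrow (wk 1 T) (wk 1 P)"
    and g1: "T # \<Gamma> \<turnstile> wk 1 g \<Ztypecolon> Arrow (wk 1 P) (wk 1 T)"
    and v1: "T # \<Gamma> \<turnstile> Var 0 \<Ztypecolon> wk 1 T"
    by (rule tyI T f g | simp add: db; fail)+
  have e: "\<Gamma> \<turnstile> ?e \<Ztypecolon> Arrow T T"
    unfolding Arrow_def by (rule ty_Lam[OF ty_App_Arrow[OF g1 ty_App_Arrow[OF f1 v1]]])
  let ?\<Delta> = "wk 1 T # T # \<Gamma>"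
  have wf: "wf_ctx ?\<Delta>" by (rule tyI T | simp add: db; fail)+
  have T2: "?\<Delta> \<turnstile> wk 2 T \<Ztypecolon> Univ i" and P2: "?\<Delta> \<turnstile> wk 2 P \<Ztypecolon> Univ i"
    and h2: "?\<Delta> \<turnstile> wk 2 h \<Ztypecolon> IsProp (wk 2 P)"
    and f2: "?\<Delta> \<turnstile> wk 2 f \<Ztypecolon> Arrow (wk 2 T) (wk 2 P)" and g2: "?\<Delta> \<turnstile> wk 2 g \<Ztypecolon> Arrow (wk 2 P) (wk 2 T)"
    and v: "?\<Delta> \<turnstile> Var 1 \<Ztypecolon> wk 2 T" "?\<Delta> \<turnstile> Var 0 \<Ztypecolon> wk 2 T"
    by (rule tyI wf T P h f g | simp add: db; fail)+
  have "wk 2 T # ?\<Delta> \<turnstile> App (wk 3 g) (App (wk 3 f) (Var 0)) \<Ztypecolon> wk 3 T"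
    by (rule ty_App_Arrow[where A = "wk 3 P"] ty_App_Arrow[where A = "wk 3 T"] tyI T2 T f g | simp
        add: db; fail)+
  \<comment> \<open>The constancy path obtained below connects the values g (f x) written out; these
    contractions replace its endpoints by applications of the composite.\<close>
  from beta_Pi[OF this] have beta: "?\<Delta> \<turnstile> App (wk 2 ?e) x \<doteq> App (wk 2 g) (App (wk 2 f) x) \<Ztypecolon> wk 2 T"
    if "?\<Delta> \<turnstile> x \<Ztypecolon> wk 2 T" for x using that by (fastforce simp: db)
  note fv = ty_App_Arrow[OF f2 v(1)] ty_App_Arrow[OF f2 v(2)]
  obtain q where q: "?\<Delta> \<turnstile> q \<Ztypecolon> Eq (wk 2 T) (App (wk 2 g) (App (wk 2 f) (Var 1))) (App (wk 2 g) (App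
      (wk 2 f) (Var 0)))"
    using Eq_ap_App[OF P2 T2 g2 fv IsPropD[OF h2 fv]] by blast
  from ty_Lam[OF ty_Lam[OF conv_Eq[OF q T2 eq_sym[OF beta[OF v(1)]] eq_sym[OF beta[OF v(2)]]]]]
  have "\<Gamma> \<turnstile> Lam T (Lam (wk 1 T) q) \<Ztypecolon> inst 0 [?e] (WeaklyConstant (wk 1 T) (Var 0))"
    by (simp add: db WeaklyConstant_def)
  from ty_Pair[OF ty_WeaklyConstantEndo(1)[OF T] e this] show ?thesis
    unfolding WeaklyConstantEndo_def by blast
qed

lemma IsEmbeddingD:
  assumes E: "\<Gamma> \<turnstile> E \<Ztypecolon> IsEmbedding A X s" and x: "\<Gamma> \<turnstile> x \<Ztypecolon> X"
  shows "\<Gamma> \<turnstile> App E x \<Ztypecolon> IsProp (Fiber A X s x)"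
  using ty_App[OF E[unfolded IsEmbedding_def] x] by (simp add: db)

text \<open>(a, p) and (b, refl) lie in the fiber over s b, hence are equal; the first projection of
  that path, converted by \<open>beta_Fst\<close>, connects a and b.\<close>

lemma IsEmbedding_injective:
  assumes A: "\<Gamma> \<turnstile> A \<Ztypecolon> Univ i" and X: "\<Gamma> \<turnstile> X \<Ztypecolon> Univ i" and s: "\<Gamma> \<turnstile> s \<Ztypecolon> Arrow A X"
    and E: "\<Gamma> \<turnstile> E \<Ztypecolon> IsEmbedding A X s" and a: "\<Gamma> \<turnstile> a \<Ztypecolon> A" and b: "\<Gamma> \<turnstile> b \<Ztypecolon> A"
    and p: "\<Gamma> \<turnstile> p \<Ztypecolon> Eq X (App s a) (App s b)"
  shows "\<exists>q. \<Gamma> \<turnstile> q \<Ztypecolon> Eq A a b"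
proof -
  note sb = ty_App_Arrow[OF s b]
  note F = ty_Fiber[OF A X s sb] and r = ty_Refl[OF X sb]
  note fp = ty_Pair_Fiber[OF A X s sb a p] ty_Pair_Fiber[OF A X s sb b r]
  obtain q where "\<Gamma> \<turnstile> q \<Ztypecolon> Eq A (Fst A (Pair A (FiberEq X s (App s b)) a p)) (Fst A (Pair A
      (FiberEq X s (App s b)) b (Refl (App s b))))"
    using Eq_ap[OF F(2) A ty_Proj(1)[OF A F(1), folded Fiber_def] fp IsPropD[OF IsEmbeddingD[OF E
        sb] fp]]
    by (auto simp: db)
  from conv_Eq[OF this A beta_Fst[OF A F(1) a] beta_Fst[OF A F(1) b]] p r show ?thesis
    by (auto simp: db)
qed

lemma ty_Idempotency:
  assumes X: "\<Gamma> \<turnstile> X \<Ztypecolon> Univ i" and f: "\<Gamma> \<turnstile> f \<Ztypecolon> Arrow X X"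
  shows "\<Gamma> \<turnstile> Idempotency X f \<Ztypecolon> Univ i"
proof -
  have f1: "X # \<Gamma> \<turnstile> wk 1 f \<Ztypecolon> Arrow (wk 1 X) (wk 1 X)"
    by (rule tyI X f | simp add: db; fail)+
  show ?thesis unfolding Idempotency_def
    by (rule tyI ty_Pi X ty_App_Arrow[OF f1] | simp add: db; fail)+
qed

lemma ty_ConstantEndos:
  assumes X: "\<Gamma> \<turnstile> X \<Ztypecolon> Univ i" and f: "\<Gamma> \<turnstile> f \<Ztypecolon> Arrow X X"
  shows "X # \<Gamma> \<turnstile> Eq (wk 1 X) (App (wk 1 f) (Var 0)) (Var 0) \<Ztypecolon> Univ i"
    and "\<Gamma> \<turnstile> Pi X (WeaklyConstantEndo (Eq (wk 1 X) (App (wk 1 f) (Var 0)) (Var 0))) \<Ztypecolon> Univ i"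
proof -
  show 1: "X # \<Gamma> \<turnstile> Eq (wk 1 X) (App (wk 1 f) (Var 0)) (Var 0) \<Ztypecolon> Univ i"
      by (rule ty_FixPt(1)[OF X f])
  show "\<Gamma> \<turnstile> Pi X (WeaklyConstantEndo (Eq (wk 1 X) (App (wk 1 f) (Var 0)) (Var 0))) \<Ztypecolon> Univ i"
    by (rule ty_Pi[OF X ty_WeaklyConstantEndo(2)[OF 1]])
qed

lemma ty_IdempotentWithConstantEndos:
  assumes X: "\<Gamma> \<turnstile> X \<Ztypecolon> Univ i" and f: "\<Gamma> \<turnstile> f \<Ztypecolon> Arrow X X"
  shows "\<Gamma> \<turnstile> IdempotentWithConstantEndos X f \<Ztypecolon> Univ i"
  unfolding IdempotentWithConstantEndos_def
  by (rule ty_Prod[OF ty_Idempotency[OF X f] ty_ConstantEndos(2)[OF X f]])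

text \<open>The layers of the iterated sum in \<open>EmbSplitting\<close> get names and explicit
  parameters, so that substitution acts on the parameters only and each layer is introduced or
  eliminated by one rule for \<open>Sig\<close>.\<close>

definition SplitData :: "tm \<Rightarrow> tm \<Rightarrow> tm \<Rightarrow> tm \<Rightarrow> tm \<Rightarrow> tm" where
  "SplitData X f A r s = Prod (RetractHtpy A r s) (Prod (SplitHtpy X f r s) (IsEmbedding A X s))"

definition SectionData :: "tm \<Rightarrow> tm \<Rightarrow> tm \<Rightarrow> tm \<Rightarrow> tm" where
  "SectionData X f A r = Sig (Arrow A X) (SplitData (wk 1 X) (wk 1 f) (wk 1 A) (wk 1 r) (Var 0))"

definition RetractData :: "tm \<Rightarrow> tm \<Rightarrow> tm \<Rightarrow> tm" where
  "RetractData X f A = Sig (Arrow X A) (SectionData (wk 1 X) (wk 1 f) (wk 1 A) (Var 0))"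

lemma split_data_ren [simp]:
  "ren \<rho> (SplitData X f A r s) = SplitData (ren \<rho> X) (ren \<rho> f) (ren \<rho> A) (ren \<rho> r) (ren \<rho> s)"
  "ren \<rho> (SectionData X f A r) = SectionData (ren \<rho> X) (ren \<rho> f) (ren \<rho> A) (ren \<rho> r)"
  "ren \<rho> (RetractData X f A) = RetractData (ren \<rho> X) (ren \<rho> f) (ren \<rho> A)"
  by (simp_all add: SplitData_def SectionData_def RetractData_def db)

lemma split_data_subst [simp]:
  "subst \<sigma> (SplitData X f A r s) = SplitData (subst \<sigma> X) (subst \<sigma> f) (subst \<sigma> A) (subst \<sigma> r)
      (subst \<sigma> s)"
  "subst \<sigma> (SectionData X f A r) = SectionData (subst \<sigma> X) (subst \<sigma> f) (subst \<sigma> A) (subst \<sigma> r)"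
  "subst \<sigma> (RetractData X f A) = RetractData (subst \<sigma> X) (subst \<sigma> f) (subst \<sigma> A)"
  by (simp_all add: SplitData_def SectionData_def RetractData_def db)

lemma EmbSplitting_eq: "EmbSplitting i X f = Sig (Univ i) (RetractData (wk 1 X) (wk 1 f) (Var 0))"
  by (simp add: EmbSplitting_def SplitData_def SectionData_def RetractData_def db)

lemma ty_SplitData:
  assumes A: "\<Gamma> \<turnstile> A \<Ztypecolon> Univ i" and X: "\<Gamma> \<turnstile> X \<Ztypecolon> Univ i" and f: "\<Gamma> \<turnstile> f \<Ztypecolon> Arrow X X"
    and r: "\<Gamma> \<turnstile> r \<Ztypecolon> Arrow X A" and s: "\<Gamma> \<turnstile> s \<Ztypecolon> Arrow A X"
  shows "\<Gamma> \<turnstile> SplitData X f A r s \<Ztypecolon> Univ i"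
  unfolding SplitData_def
  by (intro ty_Prod ty_RetractHtpy[OF A X r s] ty_SplitHtpy[OF A X f r s] ty_IsEmbedding[OF A X s])

lemma ty_SectionData:
  assumes A: "\<Gamma> \<turnstile> A \<Ztypecolon> Univ i" and X: "\<Gamma> \<turnstile> X \<Ztypecolon> Univ i" and f: "\<Gamma> \<turnstile> f \<Ztypecolon> Arrow X X"
    and r: "\<Gamma> \<turnstile> r \<Ztypecolon> Arrow X A"
  shows "Arrow A X # \<Gamma> \<turnstile> SplitData (wk 1 X) (wk 1 f) (wk 1 A) (wk 1 r) (Var 0) \<Ztypecolon> Univ i"
    and "\<Gamma> \<turnstile> SectionData X f A r \<Ztypecolon> Univ i"
proof -
  show 1: "Arrow A X # \<Gamma> \<turnstile> SplitData (wk 1 X) (wk 1 f) (wk 1 A) (wk 1 r) (Var 0) \<Ztypecolon> Univ i"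
    by (rule ty_SplitData) (rule tyI A X f r | simp add: db; fail)+
  show "\<Gamma> \<turnstile> SectionData X f A r \<Ztypecolon> Univ i"
    unfolding SectionData_def by (rule ty_Sig[OF ty_Arrow[OF A X] 1])
qed

lemma ty_RetractData:
  assumes A: "\<Gamma> \<turnstile> A \<Ztypecolon> Univ i" and X: "\<Gamma> \<turnstile> X \<Ztypecolon> Univ i" and f: "\<Gamma> \<turnstile> f \<Ztypecolon> Arrow X X"
  shows "Arrow X A # \<Gamma> \<turnstile> SectionData (wk 1 X) (wk 1 f) (wk 1 A) (Var 0) \<Ztypecolon> Univ i"
    and "\<Gamma> \<turnstile> RetractData X f A \<Ztypecolon> Univ i"
proof -
  show 1: "Arrow X A # \<Gamma> \<turnstile> SectionData (wk 1 X) (wk 1 f) (wk 1 A) (Var 0) \<Ztypecolon> Univ i"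
    by (rule ty_SectionData) (rule tyI A X f | simp add: db; fail)+
  show "\<Gamma> \<turnstile> RetractData X f A \<Ztypecolon> Univ i"
    unfolding RetractData_def by (rule ty_Sig[OF ty_Arrow[OF X A] 1])
qed

lemma ty_EmbSplitting:
  assumes X: "\<Gamma> \<turnstile> X \<Ztypecolon> Univ i" and f: "\<Gamma> \<turnstile> f \<Ztypecolon> Arrow X X"
  shows "Univ i # \<Gamma> \<turnstile> RetractData (wk 1 X) (wk 1 f) (Var 0) \<Ztypecolon> Univ (Suc i)"
    and "\<Gamma> \<turnstile> EmbSplitting i X f \<Ztypecolon> Univ (Suc i)"
proof -
  have U: "\<Gamma> \<turnstile> Univ i \<Ztypecolon> Univ (Suc i)" by (rule ty_univ[OF has_type_wf_ctx[OF X]])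
  show 1: "Univ i # \<Gamma> \<turnstile> RetractData (wk 1 X) (wk 1 f) (Var 0) \<Ztypecolon> Univ (Suc i)"
    \<comment> \<open>The body lies in \<open>Univ i\<close> but is summed over
      \<open>Univ i\<close> itself, so it is raised one level before the sum is formed.\<close>
    by (rule ty_cumul, rule ty_RetractData(2)) (rule wk_has_type ty_var_eq ctx_ext U X f | simp
        add: db; fail)+
  show "\<Gamma> \<turnstile> EmbSplitting i X f \<Ztypecolon> Univ (Suc i)"
    unfolding EmbSplitting_eq by (rule ty_Sig[OF U 1])
qed

lemma EmbSplitting_intro:
  assumes A: "\<Gamma> \<turnstile> A \<Ztypecolon> Univ i" and X: "\<Gamma> \<turnstile> X \<Ztypecolon> Univ i" and f: "\<Gamma> \<turnstile> f \<Ztypecolon> Arrow X X"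
    and r: "\<Gamma> \<turnstile> r \<Ztypecolon> Arrow X A" and s: "\<Gamma> \<turnstile> s \<Ztypecolon> Arrow A X"
    and H: "\<Gamma> \<turnstile> H \<Ztypecolon> RetractHtpy A r s" and K: "\<Gamma> \<turnstile> K \<Ztypecolon> SplitHtpy X f r s"
    and E: "\<Gamma> \<turnstile> E \<Ztypecolon> IsEmbedding A X s"
  shows "\<exists>t. \<Gamma> \<turnstile> t \<Ztypecolon> EmbSplitting i X f"
proof -
  obtain d where "\<Gamma> \<turnstile> d \<Ztypecolon> SplitData X f A r s"
    unfolding SplitData_def
    using Prod_intro[OF ty_SplitHtpy[OF A X f r s] ty_IsEmbedding[OF A X s] K E]
      Prod_intro[OF ty_RetractHtpy[OF A X r s] ty_Prod[OF ty_SplitHtpy[OF A X f r s]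
          ty_IsEmbedding[OF A X s]] H]
    by blast
  then have "\<Gamma> \<turnstile> d \<Ztypecolon> inst 0 [s] (SplitData (wk 1 X) (wk 1 f) (wk 1 A) (wk 1 r) (Var 0))"
      by (simp add: db)
  from ty_Pair[OF ty_SectionData(1)[OF A X f r] s this]
  obtain d where "\<Gamma> \<turnstile> d \<Ztypecolon> SectionData X f A r" unfolding SectionData_def by blast
  then have "\<Gamma> \<turnstile> d \<Ztypecolon> inst 0 [r] (SectionData (wk 1 X) (wk 1 f) (wk 1 A) (Var 0))" by (simp add: db)
  from ty_Pair[OF ty_RetractData(1)[OF A X f] r this]
  obtain d where "\<Gamma> \<turnstile> d \<Ztypecolon> RetractData X f A" unfolding RetractData_def by blast
  then have "\<Gamma> \<turnstile> d \<Ztypecolon> inst 0 [A] (RetractData (wk 1 X) (wk 1 f) (Var 0))" by (simp add: db)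
  from ty_Pair[OF ty_EmbSplitting(1)[OF X f] A this]
  show ?thesis unfolding EmbSplitting_eq by blast
qed

lemma EmbSplitting_obtain:
  assumes X: "\<Gamma> \<turnstile> X \<Ztypecolon> Univ i" and f: "\<Gamma> \<turnstile> f \<Ztypecolon> Arrow X X" and t: "\<Gamma> \<turnstile> t \<Ztypecolon> EmbSplitting i X f"
  obtains A r s H K E where "\<Gamma> \<turnstile> A \<Ztypecolon> Univ i" "\<Gamma> \<turnstile> r \<Ztypecolon> Arrow X A" "\<Gamma> \<turnstile> s \<Ztypecolon> Arrow A X"
    "\<Gamma> \<turnstile> H \<Ztypecolon> RetractHtpy A r s" "\<Gamma> \<turnstile> K \<Ztypecolon> SplitHtpy X f r s" "\<Gamma> \<turnstile> E \<Ztypecolon> IsEmbedding A X s"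
proof -
  obtain A d where A: "\<Gamma> \<turnstile> A \<Ztypecolon> Univ i" and "\<Gamma> \<turnstile> d \<Ztypecolon> RetractData X f A"
    using Sig_obtain[OF ty_EmbSplitting(2)[OF X f, unfolded EmbSplitting_eq] t[unfolded
        EmbSplitting_eq]]
    by (simp add: db) blast
  from Sig_obtain[OF ty_RetractData(2)[OF A X f, unfolded RetractData_def] this(2)[unfolded
      RetractData_def]]
  obtain r d where r: "\<Gamma> \<turnstile> r \<Ztypecolon> Arrow X A" and "\<Gamma> \<turnstile> d \<Ztypecolon> SectionData X f A r"
    by (simp add: db) blast
  from Sig_obtain[OF ty_SectionData(2)[OF A X f r, unfolded SectionData_def] this(2)[unfolded
      SectionData_def]]
  obtain s d where s: "\<Gamma> \<turnstile> s \<Ztypecolon> Arrow A X" and d: "\<Gamma> \<turnstile> d \<Ztypecolon> SplitData X f A r s"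
    by (simp add: db) blast
  obtain H e j where H: "\<Gamma> \<turnstile> H \<Ztypecolon> RetractHtpy A r s"
    and e: "\<Gamma> \<turnstile> e \<Ztypecolon> Prod (SplitHtpy X f r s) (IsEmbedding A X s)"
      "\<Gamma> \<turnstile> Prod (SplitHtpy X f r s) (IsEmbedding A X s) \<Ztypecolon> Univ j"
    using Prod_obtain[OF ty_SplitData[OF A X f r s, unfolded SplitData_def] d[unfolded
        SplitData_def]] by blast
  from Prod_obtain[OF e(2,1)] that[OF A r s H] show thesis by blast
qed

section \<open>The two implications\<close>

lemma SplitHtpyD:
  assumes K: "\<Gamma> \<turnstile> K \<Ztypecolon> SplitHtpy X f r s" and x: "\<Gamma> \<turnstile> x \<Ztypecolon> X"
  shows "\<Gamma> \<turnstile> App K x \<Ztypecolon> Eq X (App s (App r x)) (App f x)"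
  using ty_App[OF K[unfolded SplitHtpy_def] x] by (simp add: db)

lemma RetractHtpyD:
  assumes H: "\<Gamma> \<turnstile> H \<Ztypecolon> RetractHtpy A r s" and a: "\<Gamma> \<turnstile> a \<Ztypecolon> A"
  shows "\<Gamma> \<turnstile> App H a \<Ztypecolon> Eq A (App r (App s a)) a"
  using ty_App[OF H[unfolded RetractHtpy_def] a] by (simp add: db)

text \<open>f (s a) = s (r (s a)) = s a by \<open>K\<close> and \<open>H\<close>; transport along
  \<open>q\<close> carries this fixed-point path from s a to x. With a = r x and K x as path it also
  yields idempotency.\<close>

lemma splitting_fixes_image:
  assumes A: "\<Gamma> \<turnstile> A \<Ztypecolon> Univ i" and X: "\<Gamma> \<turnstile> X \<Ztypecolon> Univ i" and f: "\<Gamma> \<turnstile> f \<Ztypecolon> Arrow X X"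
    and r: "\<Gamma> \<turnstile> r \<Ztypecolon> Arrow X A" and s: "\<Gamma> \<turnstile> s \<Ztypecolon> Arrow A X"
    and H: "\<Gamma> \<turnstile> H \<Ztypecolon> RetractHtpy A r s" and K: "\<Gamma> \<turnstile> K \<Ztypecolon> SplitHtpy X f r s"
    and a: "\<Gamma> \<turnstile> a \<Ztypecolon> A" and x: "\<Gamma> \<turnstile> x \<Ztypecolon> X" and q: "\<Gamma> \<turnstile> q \<Ztypecolon> Eq X (App s a) x"
  shows "\<exists>t. \<Gamma> \<turnstile> t \<Ztypecolon> Eq X (App f x) x"
proof -
  note sa = ty_App_Arrow[OF s a]
  note rsa = ty_App_Arrow[OF r sa]
  note srsa = ty_App_Arrow[OF s rsa] and fsa = ty_App_Arrow[OF f sa]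
  obtain k where k: "\<Gamma> \<turnstile> k \<Ztypecolon> Eq X (App f (App s a)) (App s (App r (App s a)))"
    using Eq_sym[OF X srsa fsa SplitHtpyD[OF K sa]] by blast
  obtain h where h: "\<Gamma> \<turnstile> h \<Ztypecolon> Eq X (App s (App r (App s a))) (App s a)"
    using Eq_ap_App[OF A X s rsa a RetractHtpyD[OF H a]] by blast
  obtain u where "\<Gamma> \<turnstile> u \<Ztypecolon> Eq X (App f (App s a)) (App s a)"
    using Eq_trans[OF X fsa srsa sa k h] by blast
  then show ?thesis
    using transport[OF X ty_FixPt(1)[OF X f] sa x q, of u] by (simp add: db)
qed

lemma splitting_WeaklyConstantEndo:
  assumes A: "\<Gamma> \<turnstile> A \<Ztypecolon> Univ i" and X: "\<Gamma> \<turnstile> X \<Ztypecolon> Univ i" and f: "\<Gamma> \<turnstile> f \<Ztypecolon> Arrow X X"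
    and r: "\<Gamma> \<turnstile> r \<Ztypecolon> Arrow X A" and s: "\<Gamma> \<turnstile> s \<Ztypecolon> Arrow A X"
    and H: "\<Gamma> \<turnstile> H \<Ztypecolon> RetractHtpy A r s" and K: "\<Gamma> \<turnstile> K \<Ztypecolon> SplitHtpy X f r s"
    and E: "\<Gamma> \<turnstile> E \<Ztypecolon> IsEmbedding A X s" and x: "\<Gamma> \<turnstile> x \<Ztypecolon> X"
  shows "\<exists>t. \<Gamma> \<turnstile> t \<Ztypecolon> WeaklyConstantEndo (Eq X (App f x) x)"
proof -
  let ?T = "Eq X (App f x) x" and ?F = "Fiber A X s x"
  have T: "\<Gamma> \<turnstile> ?T \<Ztypecolon> Univ i" by (rule ty_Eq[OF X ty_App_Arrow[OF f x] x])
  note F = ty_Fiber[OF A X s x]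
  obtain u where u: "?T # \<Gamma> \<turnstile> u \<Ztypecolon> wk 1 ?F"
  proof -
    let ?\<Delta> = "?T # \<Gamma>"
    have wf: "wf_ctx ?\<Delta>" using T by (rule ctx_ext)
    have A1: "?\<Delta> \<turnstile> wk 1 A \<Ztypecolon> Univ i" and X1: "?\<Delta> \<turnstile> wk 1 X \<Ztypecolon> Univ i"
      and f1: "?\<Delta> \<turnstile> wk 1 f \<Ztypecolon> Arrow (wk 1 X) (wk 1 X)"
      and r1: "?\<Delta> \<turnstile> wk 1 r \<Ztypecolon> Arrow (wk 1 X) (wk 1 A)"
      and s1: "?\<Delta> \<turnstile> wk 1 s \<Ztypecolon> Arrow (wk 1 A) (wk 1 X)"
      and K1: "?\<Delta> \<turnstile> wk 1 K \<Ztypecolon> SplitHtpy (wk 1 X) (wk 1 f) (wk 1 r) (wk 1 s)"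
      and x1: "?\<Delta> \<turnstile> wk 1 x \<Ztypecolon> wk 1 X"
      and v: "?\<Delta> \<turnstile> Var 0 \<Ztypecolon> Eq (wk 1 X) (App (wk 1 f) (wk 1 x)) (wk 1 x)"
      by (rule tyI wf A X f r s K x | simp add: db; fail)+
    note rx = ty_App_Arrow[OF r1 x1]
    \<comment> \<open>A path f x = x puts r x into the fiber over x, because s (r x) = f x =
      x.\<close>
    obtain q where "?\<Delta> \<turnstile> q \<Ztypecolon> Eq (wk 1 X) (App (wk 1 s) (App (wk 1 r) (wk 1 x))) (wk 1 x)"
      using Eq_trans[OF X1 ty_App_Arrow[OF s1 rx] ty_App_Arrow[OF f1 x1] x1 SplitHtpyD[OF K1 x1]
          v] by blast
    from ty_Pair_Fiber[OF A1 X1 s1 x1 rx this] show thesis by (intro that) (simp add: db)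
  qed
  obtain w where w: "?F # \<Gamma> \<turnstile> w \<Ztypecolon> wk 1 ?T"
  proof -
    let ?\<Delta> = "?F # \<Gamma>"
    have wf: "wf_ctx ?\<Delta>" using F(2) by (rule ctx_ext)
    have A1: "?\<Delta> \<turnstile> wk 1 A \<Ztypecolon> Univ i" and X1: "?\<Delta> \<turnstile> wk 1 X \<Ztypecolon> Univ i"
      and f1: "?\<Delta> \<turnstile> wk 1 f \<Ztypecolon> Arrow (wk 1 X) (wk 1 X)"
      and r1: "?\<Delta> \<turnstile> wk 1 r \<Ztypecolon> Arrow (wk 1 X) (wk 1 A)"
      and s1: "?\<Delta> \<turnstile> wk 1 s \<Ztypecolon> Arrow (wk 1 A) (wk 1 X)"
      and H1: "?\<Delta> \<turnstile> wk 1 H \<Ztypecolon> RetractHtpy (wk 1 A) (wk 1 r) (wk 1 s)"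
      and K1: "?\<Delta> \<turnstile> wk 1 K \<Ztypecolon> SplitHtpy (wk 1 X) (wk 1 f) (wk 1 r) (wk 1 s)"
      and x1: "?\<Delta> \<turnstile> wk 1 x \<Ztypecolon> wk 1 X"
      and v: "?\<Delta> \<turnstile> Var 0 \<Ztypecolon> Fiber (wk 1 A) (wk 1 X) (wk 1 s) (wk 1 x)"
      by (rule tyI wf A X f r s H K x | simp add: db; fail)+
    obtain a q where a: "?\<Delta> \<turnstile> a \<Ztypecolon> wk 1 A" and q: "?\<Delta> \<turnstile> q \<Ztypecolon> Eq (wk 1 X) (App (wk 1 s) a) (wk 1 x)"
      using Fiber_obtain[OF A1 X1 s1 x1 v] .
    obtain w where "?\<Delta> \<turnstile> w \<Ztypecolon> Eq (wk 1 X) (App (wk 1 f) (wk 1 x)) (wk 1 x)"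
      using splitting_fixes_image[OF A1 X1 f1 r1 s1 H1 K1 a x1 q] ..
    then show thesis using that by (simp add: db)
  qed
  show ?thesis
    by (rule WeaklyConstantEndo_through_IsProp[OF T F(2) IsEmbeddingD[OF E x]
          ty_Lam[OF u, folded Arrow_def] ty_Lam[OF w, folded Arrow_def]])
qed

lemma EmbSplitting_imp_IdempotentWithConstantEndos:
  assumes X: "\<Gamma> \<turnstile> X \<Ztypecolon> Univ i" and f: "\<Gamma> \<turnstile> f \<Ztypecolon> Arrow X X" and t: "\<Gamma> \<turnstile> t \<Ztypecolon> EmbSplitting i X f"
  shows "\<exists>u. \<Gamma> \<turnstile> u \<Ztypecolon> IdempotentWithConstantEndos X f"
proof -
  obtain A r s H K E where A: "\<Gamma> \<turnstile> A \<Ztypecolon> Univ i" and r: "\<Gamma> \<turnstile> r \<Ztypecolon> Arrow X A" and s: "\<Gamma> \<turnstile> s \<Ztypecolon> Arrow A X"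
    and H: "\<Gamma> \<turnstile> H \<Ztypecolon> RetractHtpy A r s" and K: "\<Gamma> \<turnstile> K \<Ztypecolon> SplitHtpy X f r s"
    and E: "\<Gamma> \<turnstile> E \<Ztypecolon> IsEmbedding A X s"
    using EmbSplitting_obtain[OF X f t] .
  let ?\<Delta> = "X # \<Gamma>"
  have wf: "wf_ctx ?\<Delta>" using X by (rule ctx_ext)
  have A1: "?\<Delta> \<turnstile> wk 1 A \<Ztypecolon> Univ i" and X1: "?\<Delta> \<turnstile> wk 1 X \<Ztypecolon> Univ i"
    and f1: "?\<Delta> \<turnstile> wk 1 f \<Ztypecolon> Arrow (wk 1 X) (wk 1 X)"
    and r1: "?\<Delta> \<turnstile> wk 1 r \<Ztypecolon> Arrow (wk 1 X) (wk 1 A)" and s1: "?\<Delta> \<turnstile> wk 1 s \<Ztypecolon> Arrow (wk 1 A) (wk 1 X)"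
    and H1: "?\<Delta> \<turnstile> wk 1 H \<Ztypecolon> RetractHtpy (wk 1 A) (wk 1 r) (wk 1 s)"
    and K1: "?\<Delta> \<turnstile> wk 1 K \<Ztypecolon> SplitHtpy (wk 1 X) (wk 1 f) (wk 1 r) (wk 1 s)"
    and E1: "?\<Delta> \<turnstile> wk 1 E \<Ztypecolon> IsEmbedding (wk 1 A) (wk 1 X) (wk 1 s)"
    and v: "?\<Delta> \<turnstile> Var 0 \<Ztypecolon> wk 1 X"
    by (rule tyI wf A X f r s H K E | simp add: db; fail)+
  obtain e where "?\<Delta> \<turnstile> e \<Ztypecolon> Eq (wk 1 X) (App (wk 1 f) (App (wk 1 f) (Var 0))) (App (wk 1 f) (Var 0))"
    \<comment> \<open>The point f x is in the image of s, as witnessed by r x and K x.\<close>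
    using splitting_fixes_image[OF A1 X1 f1 r1 s1 H1 K1 ty_App_Arrow[OF r1 v] ty_App_Arrow[OF f1
        v] SplitHtpyD[OF K1 v]] by blast
  then have I: "\<Gamma> \<turnstile> Lam X e \<Ztypecolon> Idempotency X f" unfolding Idempotency_def by (rule ty_Lam)
  obtain g where "?\<Delta> \<turnstile> g \<Ztypecolon> WeaklyConstantEndo (Eq (wk 1 X) (App (wk 1 f) (Var 0)) (Var 0))"
    using splitting_WeaklyConstantEndo[OF A1 X1 f1 r1 s1 H1 K1 E1 v] by blast
  then show ?thesis
    unfolding IdempotentWithConstantEndos_def
    by (intro Prod_intro[OF ty_Idempotency[OF X f] ty_ConstantEndos(2)[OF X f] I ty_Lam])
qed

text \<open>s (r (s a)) = f (s a) = s a by \<open>K\<close> and \<open>p\<close>, and an embedding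
  is injective.\<close>

lemma RetractHtpy_of_IsEmbedding:
  assumes A: "\<Gamma> \<turnstile> A \<Ztypecolon> Univ i" and X: "\<Gamma> \<turnstile> X \<Ztypecolon> Univ i" and f: "\<Gamma> \<turnstile> f \<Ztypecolon> Arrow X X"
    and r: "\<Gamma> \<turnstile> r \<Ztypecolon> Arrow X A" and s: "\<Gamma> \<turnstile> s \<Ztypecolon> Arrow A X"
    and K: "\<Gamma> \<turnstile> K \<Ztypecolon> SplitHtpy X f r s" and E: "\<Gamma> \<turnstile> E \<Ztypecolon> IsEmbedding A X s"
    and p: "A # \<Gamma> \<turnstile> p \<Ztypecolon> Eq (wk 1 X) (App (wk 1 f) (App (wk 1 s) (Var 0))) (App (wk 1 s) (Var 0))"
  shows "\<exists>H. \<Gamma> \<turnstile> H \<Ztypecolon> RetractHtpy A r s"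
proof -
  let ?\<Delta> = "A # \<Gamma>"
  have wf: "wf_ctx ?\<Delta>" using A by (rule ctx_ext)
  have A1: "?\<Delta> \<turnstile> wk 1 A \<Ztypecolon> Univ i" and X1: "?\<Delta> \<turnstile> wk 1 X \<Ztypecolon> Univ i"
    and f1: "?\<Delta> \<turnstile> wk 1 f \<Ztypecolon> Arrow (wk 1 X) (wk 1 X)"
    and r1: "?\<Delta> \<turnstile> wk 1 r \<Ztypecolon> Arrow (wk 1 X) (wk 1 A)" and s1: "?\<Delta> \<turnstile> wk 1 s \<Ztypecolon> Arrow (wk 1 A) (wk 1 X)"
    and K1: "?\<Delta> \<turnstile> wk 1 K \<Ztypecolon> SplitHtpy (wk 1 X) (wk 1 f) (wk 1 r) (wk 1 s)"
    and E1: "?\<Delta> \<turnstile> wk 1 E \<Ztypecolon> IsEmbedding (wk 1 A) (wk 1 X) (wk 1 s)"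
    and v: "?\<Delta> \<turnstile> Var 0 \<Ztypecolon> wk 1 A"
    by (rule tyI wf A X f r s K E | simp add: db; fail)+
  note sv = ty_App_Arrow[OF s1 v]
  note rsv = ty_App_Arrow[OF r1 sv]
  obtain q where "?\<Delta> \<turnstile> q \<Ztypecolon> Eq (wk 1 X) (App (wk 1 s) (App (wk 1 r) (App (wk 1 s) (Var 0)))) (App
      (wk 1 s) (Var 0))"
    using Eq_trans[OF X1 ty_App_Arrow[OF s1 rsv] ty_App_Arrow[OF f1 sv] sv SplitHtpyD[OF K1 sv] p]
        by blast
  from IsEmbedding_injective[OF A1 X1 s1 E1 rsv v this] show ?thesis
    unfolding RetractHtpy_def using ty_Lam by blast
qed

lemma IdempotentWithConstantEndos_imp_EmbSplitting:
  assumes X: "\<Gamma> \<turnstile> X \<Ztypecolon> Univ i" and f: "\<Gamma> \<turnstile> f \<Ztypecolon> Arrow X X"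
    and t: "\<Gamma> \<turnstile> t \<Ztypecolon> IdempotentWithConstantEndos X f"
  shows "\<exists>u. \<Gamma> \<turnstile> u \<Ztypecolon> EmbSplitting i X f"
proof -
  let ?\<Delta> = "X # \<Gamma>" and ?T = "Eq (wk 1 X) (App (wk 1 f) (Var 0)) (Var 0)"
  obtain I W where I: "\<Gamma> \<turnstile> I \<Ztypecolon> Idempotency X f" and W: "\<Gamma> \<turnstile> W \<Ztypecolon> Pi X (WeaklyConstantEndo ?T)"
    using Prod_obtain[OF ty_IdempotentWithConstantEndos[OF X f, unfolded
        IdempotentWithConstantEndos_def]
        t[unfolded IdempotentWithConstantEndos_def]] by blast
  have wf: "wf_ctx ?\<Delta>" using X by (rule ctx_ext)
  have X1: "?\<Delta> \<turnstile> wk 1 X \<Ztypecolon> Univ i" and f1: "?\<Delta> \<turnstile> wk 1 f \<Ztypecolon> Arrow (wk 1 X) (wk 1 X)"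
    and I1: "?\<Delta> \<turnstile> wk 1 I \<Ztypecolon> Pi (wk 1 X) (Eq (wk 2 X) (App (wk 2 f) (App (wk 2 f) (Var 0))) (App (wk
        2 f) (Var 0)))"
    and W1: "?\<Delta> \<turnstile> wk 1 W \<Ztypecolon> Pi (wk 1 X) (WeaklyConstantEndo (Eq (wk 2 X) (App (wk 2 f) (Var 0))
        (Var 0)))"
    and v: "?\<Delta> \<turnstile> Var 0 \<Ztypecolon> wk 1 X"
    by (rule tyI wf X f I W | simp add: db Idempotency_def; fail)+
  note fv = ty_App_Arrow[OF f1 v]
  have T: "?\<Delta> \<turnstile> ?T \<Ztypecolon> Univ i" by (rule ty_ConstantEndos(1)[OF X f])
  have "?\<Delta> \<turnstile> App (wk 1 W) (Var 0) \<Ztypecolon> WeaklyConstantEndo ?T"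
    by (rule ty_App_eq[OF W1 v]) (simp add: db)
  from Sig_obtain[OF ty_WeaklyConstantEndo(2)[OF T, unfolded WeaklyConstantEndo_def] this[unfolded
      WeaklyConstantEndo_def]]
  \<comment> \<open>Both are open terms over the generic point x, so they stand for families that
    can be instantiated at other points.\<close>
  obtain g c where g: "?\<Delta> \<turnstile> g \<Ztypecolon> Arrow ?T ?T" and c: "?\<Delta> \<turnstile> c \<Ztypecolon> WeaklyConstant ?T g"
    by (simp add: db) blast
  define Q where "Q = FixPt ?T g"
  have Q: "?\<Delta> \<turnstile> Q \<Ztypecolon> Univ i" unfolding Q_def by (rule ty_FixPt(2)[OF T g])
  obtain h where h: "?\<Delta> \<turnstile> h \<Ztypecolon> IsProp Q" unfolding Q_def using FixPt_IsProp[OF T g c] by blast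
  let ?A = "Sig X Q" and ?s = "Proj X Q" and ?Q = "ren (up_ren Suc) Q" and ?u = "ren (up_ren Suc)"
  have A: "\<Gamma> \<turnstile> ?A \<Ztypecolon> Univ i" by (rule ty_Sig[OF X Q])
  have s: "\<Gamma> \<turnstile> ?s \<Ztypecolon> Arrow ?A X" by (rule ty_Proj(2)[OF X Q])
  obtain E where E: "\<Gamma> \<turnstile> E \<Ztypecolon> IsEmbedding ?A X ?s" using Proj_IsEmbedding[OF X Q h] by blast
  have Q1: "wk 1 X # ?\<Delta> \<turnstile> ?Q \<Ztypecolon> Univ i" using weaken_under1[OF Q wf] by (simp add: db)

  \<comment> \<open>For the map r, the family of endofunctions is instantiated at f x: weakening
    beneath its variable first frees a place for the generic x.\<close>
  let ?fv = "App (wk 1 f) (Var 0)"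
  let ?T' = "Eq (wk 1 X) (App (wk 1 f) ?fv) ?fv"
  have T': "?\<Delta> \<turnstile> ?T' \<Ztypecolon> Univ i" by (rule ty_Eq[OF X1 ty_App_Arrow[OF f1 fv] fv])
  have g': "?\<Delta> \<turnstile> inst 0 [?fv] (?u g) \<Ztypecolon> Arrow ?T' ?T'"
    using inst_has_type[OF weaken_under1[OF g wf], of ?fv] fv by (simp add: db)
  have c': "?\<Delta> \<turnstile> inst 0 [?fv] (?u c) \<Ztypecolon> WeaklyConstant ?T' (inst 0 [?fv] (?u g))"
    using inst_has_type[OF weaken_under1[OF c wf], of ?fv] fv by (simp add: db)
  have "?\<Delta> \<turnstile> App (wk 1 I) (Var 0) \<Ztypecolon> ?T'"
    by (rule ty_App_eq[OF I1 v]) (simp add: db)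
  from FixPt_inhabited[OF T' g' c' this]
  obtain q where "?\<Delta> \<turnstile> q \<Ztypecolon> FixPt ?T' (inst 0 [?fv] (?u g))" ..
  then have q: "?\<Delta> \<turnstile> q \<Ztypecolon> inst 0 [?fv] ?Q" by (simp add: db Q_def)
  let ?b = "Pair (wk 1 X) ?Q ?fv q" and ?r = "Lam X (Pair (wk 1 X) ?Q (App (wk 1 f) (Var 0)) q)"
  have b: "?\<Delta> \<turnstile> ?b \<Ztypecolon> wk 1 ?A" using ty_Pair[OF Q1 fv q] by (simp add: db)
  have r: "\<Gamma> \<turnstile> ?r \<Ztypecolon> Arrow X ?A" unfolding Arrow_def by (rule ty_Lam[OF b])

  have s1: "?\<Delta> \<turnstile> wk 1 ?s \<Ztypecolon> Arrow (wk 1 ?A) (wk 1 X)" by (rule tyI wf s | simp add: db; fail)+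
  \<comment> \<open>Two contractions, of r at the variable and of the projection at a pair, turn s
    (r x) into f x; the homotopy \<open>K\<close> is then reflexivity.\<close>
  have "?\<Delta> \<turnstile> App (wk 1 ?r) (Var 0) \<doteq> ?b \<Ztypecolon> wk 1 ?A"
    using beta_Pi[OF weaken_under1[OF b wf] v[unfolded One_nat_def]] by (simp add: db)
  from cong_App[OF eq_refl[OF s1[unfolded Arrow_def]] this]
  have "?\<Delta> \<turnstile> App (wk 1 ?s) (App (wk 1 ?r) (Var 0)) \<doteq> App (wk 1 ?s) ?b \<Ztypecolon> wk 1 X"
    by (simp add: db)
  moreover have "?\<Delta> \<turnstile> App (wk 1 ?s) ?b \<doteq> ?fv \<Ztypecolon> wk 1 X"
    using beta_Proj(2)[OF X1 Q1 fv q] by (simp add: db)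
  ultimately have sr: "?\<Delta> \<turnstile> App (wk 1 ?s) (App (wk 1 ?r) (Var 0)) \<doteq> ?fv \<Ztypecolon> wk 1 X"
    by (rule eq_trans)
  have K: "\<Gamma> \<turnstile> Lam X (Refl ?fv) \<Ztypecolon> SplitHtpy X f ?r ?s"
    unfolding SplitHtpy_def
    by (rule ty_Lam[OF conv_Eq[OF ty_Refl[OF X1 fv] X1 eq_sym[OF sr] eq_refl[OF fv]]])

  let ?\<Theta> = "?A # \<Gamma>"
  have wfA: "wf_ctx ?\<Theta>" using A by (rule ctx_ext)
  have XA: "?\<Theta> \<turnstile> wk 1 X \<Ztypecolon> Univ i" and fA: "?\<Theta> \<turnstile> wk 1 f \<Ztypecolon> Arrow (wk 1 X) (wk 1 X)"
    and w: "?\<Theta> \<turnstile> Var 0 \<Ztypecolon> Sig (wk 1 X) ?Q"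
    by (rule tyI wfA X f | simp add: db; fail)+
  have QA: "wk 1 X # ?\<Theta> \<turnstile> ?Q \<Ztypecolon> Univ i" using weaken_under1[OF Q wfA] by (simp add: db)
  let ?x = "Fst (wk 1 X) (Var 0)"
  have x: "?\<Theta> \<turnstile> ?x \<Ztypecolon> wk 1 X" by (rule ty_Fst[OF XA QA w])
  obtain z where z: "?\<Theta> \<turnstile> z \<Ztypecolon> inst 0 [?x] ?Q" using Snd_exists[OF XA QA w] by blast
  have Qx: "inst 0 [?x] ?Q = FixPt (Eq (wk 1 X) (App (wk 1 f) ?x) ?x) (inst 0 [?x] (?u g))"
    by (simp add: db Q_def)
  \<comment> \<open>The second component of an element of \<open>A\<close> is a fixed point of g x,
    whose first component is a path f x = x.\<close>
  obtain p where p: "?\<Theta> \<turnstile> p \<Ztypecolon> Eq (wk 1 X) (App (wk 1 f) ?x) ?x"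
    using Sig_obtain[OF inst_has_type[OF QA x, unfolded Qx] z[unfolded Qx]] by blast
  have sx: "?\<Theta> \<turnstile> ?x \<doteq> App (wk 1 ?s) (Var 0) \<Ztypecolon> wk 1 X"
    using eq_sym[OF beta_Proj(1)[OF XA QA w]] by (simp add: db)
  have "?\<Theta> \<turnstile> App (wk 1 f) ?x \<doteq> App (wk 1 f) (App (wk 1 ?s) (Var 0)) \<Ztypecolon> wk 1 X"
    using cong_App[OF eq_refl[OF fA[unfolded Arrow_def]] sx] by (simp add: db)
  from RetractHtpy_of_IsEmbedding[OF A X f r s K E conv_Eq[OF p XA this sx]]
  obtain H where H: "\<Gamma> \<turnstile> H \<Ztypecolon> RetractHtpy ?A ?r ?s" ..
  show ?thesis by (rule EmbSplitting_intro[OF A X f r s H K E])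
qed

theorem theorem3p10:
  fixes i :: nat
  shows "\<exists>t. [] \<turnstile> t \<Ztypecolon>
     Pi (Univ i)
      (Pi (Arrow (Var 0) (Var 0))
        (Iff (EmbSplitting i (Var 1) (Var 0))
             (IdempotentWithConstantEndos (Var 1) (Var 0))))"
proof -
  let ?\<Gamma> = "[Arrow (Var 0) (Var 0), Univ i]"
  let ?E = "EmbSplitting i (Var 1) (Var 0)" and ?I = "IdempotentWithConstantEndos (Var 1) (Var 0)"
  have U: "[Univ i] \<turnstile> Var 0 \<Ztypecolon> Univ i"
    by (rule ty_var_eq ctx_ext ty_univ ctx_empty | simp add: db; fail)+
  have wf: "wf_ctx ?\<Gamma>" by (rule ctx_ext[OF ty_Arrow[OF U U]])
  have X: "?\<Gamma> \<turnstile> Var 1 \<Ztypecolon> Univ i" and f: "?\<Gamma> \<turnstile> Var 0 \<Ztypecolon> Arrow (Var 1) (Var 1)"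
    by (rule ty_var_eq[OF wf]; simp add: db)+
  \<comment> \<open>\<open>EmbSplitting\<close> lives one universe higher because it sums over
    \<open>Univ i\<close>; cumulativity brings the other side to the same level, as forming the
    arrows requires.\<close>
  note E = ty_EmbSplitting(2)[OF X f] and I = ty_cumul[OF ty_IdempotentWithConstantEndos[OF X f]]
  have "\<exists>t. ?\<Gamma> \<turnstile> t \<Ztypecolon> Arrow ?E ?I"
  proof -
    have wf1: "wf_ctx (?E # ?\<Gamma>)" using E by (rule ctx_ext)
    have "?E # ?\<Gamma> \<turnstile> Var 2 \<Ztypecolon> Univ i" "?E # ?\<Gamma> \<turnstile> Var 1 \<Ztypecolon> Arrow (Var 2) (Var 2)"
      "?E # ?\<Gamma> \<turnstile> Var 0 \<Ztypecolon> EmbSplitting i (Var 2) (Var 1)"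
      by (rule ty_var_eq[OF wf1]; simp add: db EmbSplitting_eq)+
    from EmbSplitting_imp_IdempotentWithConstantEndos[OF this]
    have "\<exists>t. ?E # ?\<Gamma> \<turnstile> t \<Ztypecolon> wk 1 ?I"
      by (simp add: db IdempotentWithConstantEndos_def Idempotency_def)
    then show ?thesis unfolding Arrow_def using ty_Lam by blast
  qed
  moreover have "\<exists>t. ?\<Gamma> \<turnstile> t \<Ztypecolon> Arrow ?I ?E"
  proof -
    have wf1: "wf_ctx (?I # ?\<Gamma>)" using I by (rule ctx_ext)
    have "?I # ?\<Gamma> \<turnstile> Var 2 \<Ztypecolon> Univ i" "?I # ?\<Gamma> \<turnstile> Var 1 \<Ztypecolon> Arrow (Var 2) (Var 2)"
      "?I # ?\<Gamma> \<turnstile> Var 0 \<Ztypecolon> IdempotentWithConstantEndos (Var 2) (Var 1)"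
      by (rule ty_var_eq[OF wf1]; simp add: db IdempotentWithConstantEndos_def Idempotency_def)+
    from IdempotentWithConstantEndos_imp_EmbSplitting[OF this]
    have "\<exists>t. ?I # ?\<Gamma> \<turnstile> t \<Ztypecolon> wk 1 ?E"
      by (simp add: db EmbSplitting_eq)
    then show ?thesis unfolding Arrow_def using ty_Lam by blast
  qed
  ultimately obtain t where "?\<Gamma> \<turnstile> t \<Ztypecolon> Iff ?E ?I"
    unfolding Iff_def using Prod_intro[OF ty_Arrow[OF E I] ty_Arrow[OF I E]] by blast
  from ty_Lam[OF ty_Lam[OF this]] show ?thesis by blast
qed

end
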